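(* Let $G$ be a finite connected simple undirected graph with $N$ vertices and normalized graph Laplacian $L$, and consider the linear-quadratic game on $G$ with parameters $T,a,q,\varepsilon,c,\sigma$ described in the context. Suppose that fictitious play starts from $F^{i,0}\equiv 0$ for every $i\in[N]$ (i.e. from the linear feedback functions $\phi^{i,0}(t,x)=-q e_i^{\top}Lx$), and that $$C_L:=\max\left\{100\,T[c+T(\varepsilon-q^2)]\,\|L\|^2,\ \frac{2}{\log 2}(a+q)T\|L\|\right\}\le 1.$$ Then the fictitious play scheme converges to the Markovian Nash equilibrium of the game. That is, for every $i\in[N]$ and $t\in[0,T]$ the limit $F^{i,\infty}_t:=\lim_{k\to\infty}F^{i,k}_t$ exists, $(F^{1,\infty},\dots,F^{N,\infty})$ solves on $[0,T]$ the coupled Riccati system (R) of the context, and hence the feedback functions $\phi^{i,k}(t,x)=-e_i^{\top}(F^{i,k}_t+qL)x$ converge pointwise as $k\to\infty$ to $\hat\alpha^i(t,x)=-q e_i^{\top}Lx-e_i^{\top}F^{i,\infty}_t x$, where $(\hat\alpha^1,\dots,\hat\alpha^N)$ is the Markovian Nash equilibrium associated with the solution of (R).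
   Context: Notation: $[N]=\{1,\dots,N\}$; $\mathbb{S}^{N\times N}$ is the set of real symmetric $N\times N$ matrices; $\|\cdot\|$ is the matrix 2-norm; $e_1,\dots,e_N$ is the standard basis of $\mathbb{R}^N$; $\log$ is the natural logarithm; $\mathbb{N}$ includes $0$. Graph: $G=(V,E)$, $V=\{v_1,\dots,v_N\}$, $d_v$ is the degree of $v$, $u\sim v$ means adjacency. The normalized Laplacian $L\in\mathbb{S}^{N\times N}$ is $L_{ii}=1$, $L_{ij}=-1/\sqrt{d_{v_i}d_{v_j}}$ if $i\ne j$ and $v_i\sim v_j$, $L_{ij}=0$ otherwise. Game: parameters $T>0$, $a\ge0$, $q\ge 0$, $\varepsilon\ge 0$, $c>0$, $\sigma>0$ with $q^2\le\varepsilon$. On a filtered probability space supporting independent Brownian motions $W^1,\dots,W^N$, with $(\mathcal{F}_t)$ the filtration they generate, player $i$ has real-valued state $$dX^i_t=(\alpha^i_t-a e_i^{\top}LX_t)\,dt+\sigma\,dW^i_t,\qquad X_t=[X^1_t,\dots,X^N_t]^{\top},\quad X_0=x_0\in\mathbb{R}^N,$$ and chooses $\alpha^i$ in $\mathcal{A}=\{\alpha:\ \alpha \text{ progressively measurable with respect to }(\mathcal{F}_t),\ \mathbb{E}\int_0^T|\alpha_t|^2dt<\infty\}$ to minimize $$J^i(\alpha)=\mathbb{E}\left[\int_0^T \left(\tfrac12(\alpha^i_t)^2+q\alpha^i_t\, e_i^{\top}LX_t+\tfrac{\varepsilon}{2}(e_i^{\top}LX_t)^2\right)dt+\tfrac{c}{2}(e_i^{\top}LX_T)^2\right],\quad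 \alpha=(\alpha^1,\dots,\alpha^N).$$ A Markovian strategy is $\alpha^i_t=\phi^i(t,X_t)$ with $\phi^i:[0,T]\times\mathbb{R}^N\to\mathbb{R}$ Borel and $\sup_{t,x}|\phi^i(t,x)|/(1+\|x\|)<\infty$. A collection $\hat\alpha=(\hat\alpha^1,\dots,\hat\alpha^N)$ of Markovian strategies is a Markovian Nash equilibrium if $J^i((\alpha,\hat\alpha^{-i}))\ge J^i(\hat\alpha)$ for all $i\in[N]$ and $\alpha\in\mathcal{A}$, where $(\alpha,\hat\alpha^{-i})$ is obtained by replacing player $i$'s strategy by $\alpha$ while all other players keep their (feedback) strategies. Coupled Riccati system (R) for $F^i:[0,T]\to\mathbb{S}^{N\times N}$, $i\in[N]$: $$\dot F^i_t+\sum_{j=1}^N[-(a+q)L-F^j_t]e_je_j^{\top}F^i_t+\sum_{j=1}^N F^i_te_je_j^{\top}[-(a+q)L-F^j_t]+(\varepsilon-q^2)Le_ie_i^{\top}L+F^i_te_ie_i^{\top}F^i_t=0,\quad F^i_T=cLe_ie_i^{\top}L.$$ Fictitious play: at stage $k+1$ each player $i$ optimizes her own cost assuming every player $j\neq i$ uses the feedback function $\phi^{j,k}$ of stage $k$; the optimizer is $\phi^{i,k+1}$. Started from linear feedback functions $\phi^{j,0}(t,x)=-e_j^{\top}(F^{j,0}_t+qL)x$, the procedure is described by $\phi^{i,k}(t,x)=-e_i^{\top}(F^{i,k}_t+qL)x$, where, given $\{F^{j,k}\}_{j\in[N]}$, $F^{i,k+1}:[0,T]\to\mathbb{S}^{N\times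 N}$ is the solution of $$\dot F^{i,k+1}_t-F^{i,k+1}_te_ie_i^{\top}F^{i,k+1}_t+(\varepsilon-q^2)Le_ie_i^{\top}L-(a+q)LF^{i,k+1}_t-(a+q)F^{i,k+1}_tL-F^{i,k+1}_t\sum_{j\ne i}e_je_j^{\top}F^{j,k}_t-\sum_{j\neq i}F^{j,k}_te_je_j^{\top}F^{i,k+1}_t=0,$$ $F^{i,k+1}_T=cLe_ie_i^{\top}L$. *)

theory Defs
  imports "HOL-Probability.Probability"
begin

text \<open>
  The vertex set \<open>{v_1, ..., v_N}\<close> and the set of players \<open>[N]\<close> are both the universe of a finite
  type \<open>'n\<close>, with \<open>N = CARD('n)\<close>.
\<close>

definition connected_simple_graph :: "('n::finite \<Rightarrow> 'n \<Rightarrow> bool) \<Rightarrow> bool" where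
  "connected_simple_graph E \<longleftrightarrow> symp E \<and> irreflp E \<and> (\<forall>u v. E\<^sup>*\<^sup>* u v)"

definition degree :: "('n::finite \<Rightarrow> 'n \<Rightarrow> bool) \<Rightarrow> 'n \<Rightarrow> nat" where
  "degree E u = card {v. E u v}"

definition normalized_laplacian :: "('n::finite \<Rightarrow> 'n \<Rightarrow> bool) \<Rightarrow> real^'n^'n" where
  "normalized_laplacian E =
    (\<chi> i j. if i = j then 1
            else if E i j then - 1 / sqrt (real (degree E i) * real (degree E j))
            else 0)"

definition matrix_2norm :: "real^'n^'n \<Rightarrow> real" where
  "matrix_2norm A = onorm (\<lambda>x. A *v x)"

definition symmetric_matrix :: "real^'n^'n \<Rightarrow> bool" where
  "symmetric_matrix A \<longleftrightarrow> transpose A = A"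

definition ee :: "'n::finite \<Rightarrow> real^'n^'n" where
  "ee i = (columnvector (axis i 1) :: real^1^'n) ** (rowvector (axis i 1) :: real^'n^1)"

definition brownian_motion :: "'w measure \<Rightarrow> (real \<Rightarrow> 'w \<Rightarrow> real) \<Rightarrow> bool" where
  "brownian_motion M B \<longleftrightarrow>
     prob_space M \<and>
     (\<forall>t\<ge>0. B t \<in> borel_measurable M) \<and>
     (\<forall>\<omega>\<in>space M. B 0 \<omega> = 0 \<and> continuous_on {0..} (\<lambda>t. B t \<omega>)) \<and>
     (\<forall>s t. 0 \<le> s \<and> s < t \<longrightarrow>
        distributed M lborel (\<lambda>\<omega>. B t \<omega> - B s \<omega>) (normal_density 0 (sqrt (t - s)))) \<and>
     (\<forall>(\<tau> :: nat \<Rightarrow> real) m. 0 \<le> \<tau> 0 \<and> mono \<tau> \<longrightarrow>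
        prob_space.indep_vars M (\<lambda>_. borel) (\<lambda>k \<omega>. B (\<tau> (Suc k)) \<omega> - B (\<tau> k) \<omega>) {..<m})"

text \<open>The processes are independent when their paths are independent random elements of the
  product space of real functions on \<open>{0..}\<close>.\<close>

definition independent_brownian_motions ::
    "'w measure \<Rightarrow> ('n::finite \<Rightarrow> real \<Rightarrow> 'w \<Rightarrow> real) \<Rightarrow> bool" where
  "independent_brownian_motions M W \<longleftrightarrow>
     prob_space M \<and>
     (\<forall>i. brownian_motion M (W i)) \<and>
     prob_space.indep_vars M (\<lambda>_. Pi\<^sub>M {0..} (\<lambda>_. borel)) (\<lambda>i \<omega>. \<lambda>t\<in>{0..}. W i t \<omega>) UNIV"

definition generated_filtration ::
    "'w measure \<Rightarrow> ('n::finite \<Rightarrow> real \<Rightarrow> 'w \<Rightarrow> real) \<Rightarrow> real \<Rightarrow> 'w measure" where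
  "generated_filtration M W t =
     sigma (space M) {W j s -` B \<inter> space M | j s B. s \<in> {0..t} \<and> B \<in> sets borel}"

definition progressively_measurable ::
    "real \<Rightarrow> (real \<Rightarrow> 'w measure) \<Rightarrow> (real \<Rightarrow> 'w \<Rightarrow> 'b::topological_space) \<Rightarrow> bool" where
  "progressively_measurable T \<F> X \<longleftrightarrow>
     (\<forall>t\<in>{0..T}. (\<lambda>(s, \<omega>). X s \<omega>) \<in> borel_measurable (restrict_space borel {0..t} \<Otimes>\<^sub>M \<F> t))"

definition admissible_controls ::
    "'w measure \<Rightarrow> ('n::finite \<Rightarrow> real \<Rightarrow> 'w \<Rightarrow> real) \<Rightarrow> real \<Rightarrow> (real \<Rightarrow> 'w \<Rightarrow> real) set" where
  "admissible_controls M W T =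
     {\<alpha>. progressively_measurable T (generated_filtration M W) \<alpha> \<and>
         (\<integral>\<^sup>+\<omega>. (\<integral>\<^sup>+t\<in>{0..T}. ennreal (\<bar>\<alpha> t \<omega>\<bar>\<^sup>2) \<partial>lborel) \<partial>M) < \<infinity>}"

text \<open>The noise being additive, the state equation is an ordinary integral equation along almost
  every path, and no stochastic integral is needed.\<close>

definition state_process ::
    "'w measure \<Rightarrow> ('n::finite \<Rightarrow> real \<Rightarrow> 'w \<Rightarrow> real) \<Rightarrow> real \<Rightarrow> real \<Rightarrow> real \<Rightarrow> real^'n^'n \<Rightarrow> real^'n
      \<Rightarrow> ('n \<Rightarrow> real \<Rightarrow> 'w \<Rightarrow> real) \<Rightarrow> (real \<Rightarrow> 'w \<Rightarrow> real^'n) \<Rightarrow> bool" where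
  "state_process M W T a \<sigma> L x0 \<alpha> X \<longleftrightarrow>
     progressively_measurable T (generated_filtration M W) X \<and>
     (AE \<omega> in M. \<forall>i. \<forall>t\<in>{0..T}.
        set_integrable lborel {0..t} (\<lambda>s. \<alpha> i s \<omega> - a * (L *v X s \<omega>) $ i) \<and>
        X t \<omega> $ i = x0 $ i + (LBINT s:{0..t}. \<alpha> i s \<omega> - a * (L *v X s \<omega>) $ i) + \<sigma> * W i t \<omega>)"

text \<open>For an admissible control of player \<open>i\<close> and feedback controls of linear growth all integrals
  in the cost are finite, so the default value of a non-integrable integral plays no role.\<close>

definition cost ::
    "'w measure \<Rightarrow> real \<Rightarrow> real \<Rightarrow> real \<Rightarrow> real \<Rightarrow> real^'n^'n \<Rightarrow> 'n::finite
      \<Rightarrow> (real \<Rightarrow> 'w \<Rightarrow> real) \<Rightarrow> (real \<Rightarrow> 'w \<Rightarrow> real^'n) \<Rightarrow> real" where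
  "cost M T q \<epsilon> c L i \<alpha> X =
     (\<integral>\<omega>. (LBINT t:{0..T}. 1 / 2 * (\<alpha> t \<omega>)\<^sup>2 + q * \<alpha> t \<omega> * (L *v X t \<omega>) $ i
                         + \<epsilon> / 2 * ((L *v X t \<omega>) $ i)\<^sup>2)
           + c / 2 * ((L *v X T \<omega>) $ i)\<^sup>2 \<partial>M)"

definition markovian_feedback :: "real \<Rightarrow> (real \<Rightarrow> real^'n::finite \<Rightarrow> real) \<Rightarrow> bool" where
  "markovian_feedback T \<phi> \<longleftrightarrow>
     (\<lambda>(t, x). \<phi> t x) \<in> borel_measurable (restrict_space borel ({0..T} \<times> UNIV)) \<and>
     bdd_above ((\<lambda>(t, x). \<bar>\<phi> t x\<bar> / (1 + norm x)) ` ({0..T} \<times> UNIV))"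

definition feedback_controls ::
    "('n \<Rightarrow> real \<Rightarrow> real^'n \<Rightarrow> real) \<Rightarrow> (real \<Rightarrow> 'w \<Rightarrow> real^'n) \<Rightarrow> 'n \<Rightarrow> real \<Rightarrow> 'w \<Rightarrow> real" where
  "feedback_controls \<phi> X j t \<omega> = \<phi> j t (X t \<omega>)"

text \<open>
  The controls after a deviation of player \<open>i\<close> to \<open>\<beta>\<close> are \<open>(feedback_controls \<phi> Y)(i := \<beta>)\<close>, where \<open>Y\<close>
  is the state after the deviation: the other players react to \<open>Y\<close> through their feedback.
  The costs in the definition of an equilibrium presuppose that the state exists, with and without
  the deviation. Existence is demanded explicitly, so that the inequality is never vacuous, and
  the inequality is demanded for all versions of the two states.
\<close>

definition markovian_nash_equilibrium ::
    "'w measure \<Rightarrow> ('n::finite \<Rightarrow> real \<Rightarrow> 'w \<Rightarrow> real) \<Rightarrow> real \<Rightarrow> real \<Rightarrow> real \<Rightarrow> real \<Rightarrow> real \<Rightarrow> real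
      \<Rightarrow> real^'n^'n \<Rightarrow> real^'n \<Rightarrow> ('n \<Rightarrow> real \<Rightarrow> real^'n \<Rightarrow> real) \<Rightarrow> bool" where
  "markovian_nash_equilibrium M W T a q \<epsilon> c \<sigma> L x0 \<phi> \<longleftrightarrow>
     (\<forall>i. markovian_feedback T (\<phi> i)) \<and>
     (\<exists>X. state_process M W T a \<sigma> L x0 (feedback_controls \<phi> X) X) \<and>
     (\<forall>X. state_process M W T a \<sigma> L x0 (feedback_controls \<phi> X) X \<longrightarrow>
        (\<forall>i. feedback_controls \<phi> X i \<in> admissible_controls M W T)) \<and>
     (\<forall>i. \<forall>\<beta> \<in> admissible_controls M W T.
        (\<exists>Y. state_process M W T a \<sigma> L x0 ((feedback_controls \<phi> Y)(i := \<beta>)) Y) \<and>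
        (\<forall>X Y. state_process M W T a \<sigma> L x0 (feedback_controls \<phi> X) X \<longrightarrow>
           state_process M W T a \<sigma> L x0 ((feedback_controls \<phi> Y)(i := \<beta>)) Y \<longrightarrow>
           cost M T q \<epsilon> c L i \<beta> Y \<ge> cost M T q \<epsilon> c L i (feedback_controls \<phi> X i) X))"

definition solves_coupled_riccati ::
    "real \<Rightarrow> real \<Rightarrow> real \<Rightarrow> real \<Rightarrow> real \<Rightarrow> real^'n^'n \<Rightarrow> ('n::finite \<Rightarrow> real \<Rightarrow> real^'n^'n) \<Rightarrow> bool" where
  "solves_coupled_riccati T a q \<epsilon> c L F \<longleftrightarrow>
     (\<forall>i. (\<forall>t\<in>{0..T}. symmetric_matrix (F i t)) \<and>
          F i T = c *\<^sub>R (L ** ee i ** L) \<and>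
          (\<forall>t\<in>{0..T}. \<exists>F'. (F i has_vector_derivative F') (at t within {0..T}) \<and>
             F' + (\<Sum>j\<in>UNIV. (- ((a + q) *\<^sub>R L) - F j t) ** ee j ** F i t)
                + (\<Sum>j\<in>UNIV. F i t ** ee j ** (- ((a + q) *\<^sub>R L) - F j t))
                + (\<epsilon> - q\<^sup>2) *\<^sub>R (L ** ee i ** L)
                + F i t ** ee i ** F i t = 0))"

text \<open>\<open>G\<close> is the profile of the previous stage, and \<open>H\<close> is the new matrix function of player \<open>i\<close>.\<close>

definition solves_best_response_riccati ::
    "real \<Rightarrow> real \<Rightarrow> real \<Rightarrow> real \<Rightarrow> real \<Rightarrow> real^'n^'n \<Rightarrow> ('n::finite \<Rightarrow> real \<Rightarrow> real^'n^'n)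
      \<Rightarrow> 'n \<Rightarrow> (real \<Rightarrow> real^'n^'n) \<Rightarrow> bool" where
  "solves_best_response_riccati T a q \<epsilon> c L G i H \<longleftrightarrow>
     (\<forall>t\<in>{0..T}. symmetric_matrix (H t)) \<and>
     H T = c *\<^sub>R (L ** ee i ** L) \<and>
     (\<forall>t\<in>{0..T}. \<exists>H'. (H has_vector_derivative H') (at t within {0..T}) \<and>
        H' - H t ** ee i ** H t
           + (\<epsilon> - q\<^sup>2) *\<^sub>R (L ** ee i ** L)
           - (a + q) *\<^sub>R (L ** H t) - (a + q) *\<^sub>R (H t ** L)
           - H t ** (\<Sum>j\<in>UNIV - {i}. ee j ** G j t)
           - (\<Sum>j\<in>UNIV - {i}. G j t ** ee j ** H t) = 0)"

definition fictitious_play_from_zero ::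
    "real \<Rightarrow> real \<Rightarrow> real \<Rightarrow> real \<Rightarrow> real \<Rightarrow> real^'n^'n
      \<Rightarrow> (nat \<Rightarrow> 'n::finite \<Rightarrow> real \<Rightarrow> real^'n^'n) \<Rightarrow> bool" where
  "fictitious_play_from_zero T a q \<epsilon> c L F \<longleftrightarrow>
     (\<forall>i. \<forall>t\<in>{0..T}. F 0 i t = 0) \<and>
     (\<forall>k i. solves_best_response_riccati T a q \<epsilon> c L (F k) i (F (Suc k) i))"

definition linear_feedback ::
    "real \<Rightarrow> real^'n^'n \<Rightarrow> ('n::finite \<Rightarrow> real \<Rightarrow> real^'n^'n) \<Rightarrow> 'n \<Rightarrow> real \<Rightarrow> real^'n \<Rightarrow> real" where
  "linear_feedback q L F i t x = - (((F i t + q *\<^sub>R L) *v x) $ i)"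

definition C_L :: "real \<Rightarrow> real \<Rightarrow> real \<Rightarrow> real \<Rightarrow> real \<Rightarrow> real^'n^'n \<Rightarrow> real" where
  "C_L T a q \<epsilon> c L =
     max (100 * T * (c + T * (\<epsilon> - q\<^sup>2)) * (matrix_2norm L)\<^sup>2)
         (2 / ln 2 * (a + q) * T * matrix_2norm L)"

end

theory Submission
  imports Defs
begin

text \<open>
  The proof has two independent parts: convergence of the Riccati matrices, and verification that the
  limit describes an equilibrium.

  Convergence. In reversed time the best-response equation reads \<open>H' = rhs G H\<close> with a quadratic
  right-hand side, and the coupled system is its diagonal \<open>G = H\<close>. So the limit is a fixed point of
  the best-response map. Once all stages are known to stay in one bounded set, an exponentially
  weighted norm shows that the distance to the fixed point is halved by every stage
  (\<open>flow_iterates_converge\<close>). The uniform bound is the place where \<open>C_L \<le> 1\<close> is used, and the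
  difficulty is that this condition does not mention the number of players. The remedy is to
  measure a tuple \<open>(H\<^sub>i)\<close> by the largest 2-norm of its signed combinations (\<open>tuple_bound\<close>). A random-sign
  argument shows that the matrix composed of the \<open>i\<close>-th rows of the \<open>H\<^sub>i\<close>, through which the players
  interact, is bounded by this size without loss (\<open>op_bound_rows\<close>). With it every term of the equation
  has a dimension-free bound (\<open>tuple_bound_rhs\<close>), and a ball with exponentially growing radius is
  invariant under Picard iteration (\<open>tuple_bound_invariant\<close>). This gives existence of all stages and
  of the solution of the coupled system; uniqueness identifies any given sequence of stages with the
  bounded one and provides symmetry of the matrices.

  Verification. Let \<open>X\<close> be the equilibrium state, \<open>Y\<close> the state after a deviation of player \<open>i\<close>, and
  \<open>D = Y - X\<close>. The noise cancels in \<open>D\<close>, so \<open>D\<close> is absolutely continuous. Since \<open>q\<^sup>2 \<le> \<epsilon>\<close>, the cost is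
  convex, and the cost difference is at least the first variation of the cost at \<open>X\<close> in the direction
  of the deviation. The Riccati equation says that \<open>F\<^sub>i X\<close> is the adjoint process
  (\<open>adjoint_identity\<close>), hence the first variation is the stochastic integral of \<open>\<sigma> F\<^sub>i D\<close> against the
  noise. As \<open>F\<^sub>i D\<close> has a derivative \<open>G\<close> in time, integration by parts turns this stochastic integral into
  the Lebesgue integral of \<open>\<sigma> G t \<bullet> (noise T - noise t)\<close> (\<open>pathwise_variation\<close>). Its expectation is zero
  because the increments of the noise after time \<open>t\<close> are independent of the past and centred
  (\<open>martingale_term_zero\<close>). Existence of the states follows from the formula for the variation of
  constants, and their square integrability from a pathwise inequality of Gronwall type.
\<close>

section \<open>Weighted integral inequalities and Picard iteration\<close>

lemma has_integral_exp_0: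
  fixes \<mu> t :: real
  assumes "\<mu> \<noteq> 0" "0 \<le> t"
  shows "((\<lambda>s. exp (\<mu> * s)) has_integral (exp (\<mu> * t) - 1) / \<mu>) {0..t}"
proof -
  have "((\<lambda>s. exp (\<mu> * s)) has_integral exp (\<mu> * t) / \<mu> - exp (\<mu> * 0) / \<mu>) {0..t}"
    by (rule fundamental_theorem_of_calculus)
       (use assms in \<open>auto simp flip: has_real_derivative_iff_has_vector_derivative
          intro!: derivative_eq_intros\<close>)
  then show ?thesis by (simp add: diff_divide_distrib)
qed

text \<open>
  Weighting with \<open>exp (- \<mu> * t)\<close> makes the integral a contraction: where \<open>u t * exp (- \<mu> * t)\<close> is
  maximal, with value \<open>m\<close>, the integral contributes at most \<open>K / \<mu> * m \<le> m / 2\<close>. The case \<open>a = 0\<close> yields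
  uniqueness for integral equations, and a small \<open>a\<close> propagates an error through one stage of an
  iteration. The exponential on the right-hand side lets the weight survive a repeated application.
\<close>

lemma gronwall_weighted:
  fixes u :: "real \<Rightarrow> real"
  assumes cont: "continuous_on {0..T} u"
    and K: "0 \<le> K" "0 < \<mu>" "2 * K \<le> \<mu>" and a: "0 \<le> a"
    and bound: "\<And>t. t \<in> {0..T} \<Longrightarrow> u t \<le> a * exp (\<mu> * t) + K * integral {0..t} u"
    and t: "t \<in> {0..T}"
  shows "u t \<le> 2 * a * exp (\<mu> * t)"
proof -
  define v where "v s = u s * exp (- \<mu> * s)" for s
  have "continuous_on {0..T} v"
    unfolding v_def by (intro continuous_intros cont)
  then obtain m where m: "m \<in> {0..T}" "\<And>s. s \<in> {0..T} \<Longrightarrow> v s \<le> v m"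
    using continuous_attains_sup[of "{0..T}" v] t by fastforce
  have u_le: "u s \<le> v m * exp (\<mu> * s)" if "s \<in> {0..T}" for s
  proof -
    have "u s = v s * exp (\<mu> * s)" by (simp add: v_def exp_minus field_simps)
    also have "\<dots> \<le> v m * exp (\<mu> * s)" using m(2)[OF that] by (intro mult_right_mono) auto
    finally show ?thesis .
  qed
  have "v m \<le> 2 * a"
  proof (cases "v m \<le> 0")
    case True
    then show ?thesis using a by linarith
  next
    case False
    have "integral {0..m} u \<le> v m * ((exp (\<mu> * m) - 1) / \<mu>)"
    proof (rule has_integral_le)
      show "(u has_integral integral {0..m} u) {0..m}"
        using m(1) by (intro integrable_integral integrable_continuous_real continuous_on_subset[OF cont]) auto
      show "((\<lambda>s. v m * exp (\<mu> * s)) has_integral v m * ((exp (\<mu> * m) - 1) / \<mu>)) {0..m}"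
        using m(1) K by (intro has_integral_mult_right has_integral_exp_0) auto
    qed (use u_le m(1) in auto)
    also have "\<dots> \<le> v m * (exp (\<mu> * m) / \<mu>)"
      using False K by (intro mult_left_mono divide_right_mono) auto
    finally have "K * integral {0..m} u \<le> K * (v m * (exp (\<mu> * m) / \<mu>))"
      using K by (intro mult_left_mono) auto
    also have "\<dots> = (K / \<mu>) * (v m * exp (\<mu> * m))" by simp
    also have "\<dots> \<le> 1 / 2 * (v m * exp (\<mu> * m))"
      using False K by (intro mult_right_mono) (auto simp: field_simps)
    finally have "u m \<le> a * exp (\<mu> * m) + 1 / 2 * (v m * exp (\<mu> * m))"
      using bound[OF m(1)] by linarith
    moreover have "u m = v m * exp (\<mu> * m)" by (simp add: v_def exp_minus field_simps)
    ultimately have "(v m / 2) * exp (\<mu> * m) \<le> a * exp (\<mu> * m)" by (simp add: field_simps)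
    then have "v m / 2 \<le> a" by (simp only: mult_le_cancel_right) auto
    then show ?thesis by simp
  qed
  then have "v m * exp (\<mu> * t) \<le> 2 * a * exp (\<mu> * t)" by (intro mult_right_mono) auto
  with u_le[OF t] show ?thesis by linarith
qed

text \<open>
  Picard iteration that never leaves the sets \<open>C t\<close>, so the field \<open>f\<close> has to be Lipschitz on them
  only. A quadratic field is Lipschitz on bounded sets, and invariance excludes blow-up. In the norm with weight \<open>exp (- 2 * K * t)\<close> each step
  halves the distance of consecutive iterates.
\<close>

lemma picard_invariant:
  fixes f :: "real \<Rightarrow> 'a::banach \<Rightarrow> 'a"
  assumes T: "0 \<le> T" and K: "0 < K"
    and closed: "\<And>t. t \<in> {0..T} \<Longrightarrow> closed (C t)"
    and lip: "\<And>t x y. t \<in> {0..T} \<Longrightarrow> x \<in> C t \<Longrightarrow> y \<in> C t \<Longrightarrow> norm (f t x - f t y) \<le> K * norm (x - y)"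
    and cont: "\<And>x. continuous_on {0..T} x \<Longrightarrow> (\<And>t. t \<in> {0..T} \<Longrightarrow> x t \<in> C t) \<Longrightarrow>
                 continuous_on {0..T} (\<lambda>t. f t (x t))"
    and inv: "\<And>x t. continuous_on {0..T} x \<Longrightarrow> (\<And>t. t \<in> {0..T} \<Longrightarrow> x t \<in> C t) \<Longrightarrow> t \<in> {0..T} \<Longrightarrow>
                 z + integral {0..t} (\<lambda>s. f s (x s)) \<in> C t"
    and start: "continuous_on {0..T} x0" "\<And>t. t \<in> {0..T} \<Longrightarrow> x0 t \<in> C t"
  obtains x where "continuous_on {0..T} x" "\<And>t. t \<in> {0..T} \<Longrightarrow> x t \<in> C t"
    "\<And>t. t \<in> {0..T} \<Longrightarrow> x t = z + integral {0..t} (\<lambda>s. f s (x s))"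
proof -
  define P where "P x t = z + integral {0..t} (\<lambda>s. f s (x s))" for x t
  define ok where "ok x \<longleftrightarrow> continuous_on {0..T} x \<and> (\<forall>t\<in>{0..T}. x t \<in> C t)" for x
  have f_cont: "continuous_on {0..T} (\<lambda>t. f t (x t))" if "ok x" for x
    using that cont by (auto simp: ok_def)
  have f_int: "(\<lambda>s. f s (x s)) integrable_on {0..t}" if "ok x" "t \<in> {0..T}" for x t
    using that by (intro integrable_continuous_real continuous_on_subset[OF f_cont]) auto
  have ok_P: "ok (P x)" if "ok x" for x
  proof -
    have "continuous_on {0..T} (P x)"
      unfolding P_def using T by (intro continuous_intros indefinite_integral_continuous_1 f_int that) auto
    then show ?thesis using inv that by (auto simp: ok_def P_def)
  qed
  define \<mu> where "\<mu> = 2 * K"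
  have contract: "norm (P x t - P y t) \<le> (D / 2) * exp (\<mu> * t)"
    if "ok x" "ok y" "t \<in> {0..T}" and D: "\<And>s. s \<in> {0..T} \<Longrightarrow> norm (x s - y s) \<le> D * exp (\<mu> * s)"
    for x y t D
  proof -
    have "0 \<le> D * exp (\<mu> * t)" using D[OF that(3)] norm_ge_zero order_trans by blast
    then have D0: "0 \<le> D" by (simp add: zero_le_mult_iff)
    have "P x t - P y t = integral {0..t} (\<lambda>s. f s (x s) - f s (y s))"
      unfolding P_def using that by (subst integral_diff) (auto intro: f_int)
    also have "norm \<dots> \<le> integral {0..t} (\<lambda>s. K * D * exp (\<mu> * s))"
    proof (rule integral_norm_bound_integral)
      fix s assume s: "s \<in> {0..t}"
      then have s': "s \<in> {0..T}" using that by auto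
      have "norm (f s (x s) - f s (y s)) \<le> K * norm (x s - y s)"
        using that s' by (intro lip) (auto simp: ok_def)
      also have "\<dots> \<le> K * (D * exp (\<mu> * s))" using D[OF s'] K by (intro mult_left_mono) auto
      finally show "norm (f s (x s) - f s (y s)) \<le> K * D * exp (\<mu> * s)" by simp
    next
      show "(\<lambda>s. f s (x s) - f s (y s)) integrable_on {0..t}"
        using that by (intro integrable_diff f_int)
      show "(\<lambda>s. K * D * exp (\<mu> * s)) integrable_on {0..t}"
        by (intro integrable_continuous_real continuous_intros)
    qed
    also have "\<dots> = K * D * ((exp (\<mu> * t) - 1) / \<mu>)"
      using that K by (intro integral_unique has_integral_mult_right has_integral_exp_0) (auto simp: \<mu>_def)
    also have "\<dots> = (D / 2) * (exp (\<mu> * t) - 1)" using K by (simp add: \<mu>_def)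
    also have "\<dots> \<le> (D / 2) * exp (\<mu> * t)" using D0 by (intro mult_left_mono) auto
    finally show ?thesis .
  qed
  define X where "X n = (P ^^ n) x0" for n
  have X_Suc: "X (Suc n) = P (X n)" for n by (simp add: X_def)
  have ok_X: "ok (X n)" for n
    by (induction n) (use start ok_P in \<open>auto simp: X_Suc X_def ok_def\<close>)
  have "continuous_on {0..T} (\<lambda>t. norm (X 1 t - X 0 t))"
    using ok_X by (intro continuous_intros) (auto simp: ok_def)
  then have "\<exists>m\<in>{0..T}. \<forall>t\<in>{0..T}. norm (X 1 t - X 0 t) \<le> norm (X 1 m - X 0 m)"
    using T by (intro continuous_attains_sup) auto
  then obtain m where m: "\<forall>t\<in>{0..T}. norm (X 1 t - X 0 t) \<le> norm (X 1 m - X 0 m)" by blast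
  define D where "D = norm (X 1 m - X 0 m)"
  have D: "norm (X 1 t - X 0 t) \<le> D" if "t \<in> {0..T}" for t
    using m that by (simp add: D_def)
  have D0: "0 \<le> D" by (simp add: D_def)
  have step: "norm (X (Suc n) t - X n t) \<le> D * (1/2)^n * exp (\<mu> * t)" if "t \<in> {0..T}" for n t
    using that
  proof (induction n arbitrary: t)
    case 0
    have "D * 1 \<le> D * exp (\<mu> * t)" using D0 0 K by (intro mult_left_mono) (auto simp: \<mu>_def)
    then show ?case using D[OF 0] by simp
  next
    case (Suc n)
    have "norm (P (X (Suc n)) t - P (X n) t) \<le> (D * (1/2)^n / 2) * exp (\<mu> * t)"
      using Suc by (intro contract ok_X)
    then show ?case by (simp add: X_Suc)
  qed
  define M where "M n = D * exp (\<mu> * T) * (1/2)^n" for n :: nat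
  have stepM: "norm (X (Suc n) t - X n t) \<le> M n" if "t \<in> {0..T}" for n t
  proof -
    have "D * (1/2)^n * exp (\<mu> * t) \<le> D * (1/2)^n * exp (\<mu> * T)"
      using that K D0 by (intro mult_left_mono) (auto simp: \<mu>_def)
    with step[OF that, of n] show ?thesis by (simp add: M_def mult_ac)
  qed
  have sumM: "summable M" unfolding M_def by (intro summable_mult summable_geometric) auto
  define x where "x t = X 0 t + (\<Sum>n. X (Suc n) t - X n t)" for t
  have tele: "X n t = X 0 t + (\<Sum>i<n. X (Suc i) t - X i t)" for n t
    by (induction n) auto
  have "uniform_limit {0..T} (\<lambda>n t. \<Sum>i<n. X (Suc i) t - X i t) (\<lambda>t. \<Sum>n. X (Suc n) t - X n t) sequentially"
    by (rule Weierstrass_m_test[OF _ sumM]) (rule stepM)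
  then have "uniform_limit {0..T} (\<lambda>n t. X 0 t + (\<Sum>i<n. X (Suc i) t - X i t)) x sequentially"
    unfolding x_def by (intro uniform_limit_intros)
  then have ulim: "uniform_limit {0..T} X x sequentially"
    by (simp only: tele[symmetric])
  have lim: "(\<lambda>n. X n t) \<longlonglongrightarrow> x t" if "t \<in> {0..T}" for t
    using tendsto_uniform_limitI[OF ulim that] .
  have "continuous_on {0..T} x"
    using ok_X by (intro uniform_limit_theorem[OF _ ulim]) (auto simp: ok_def)
  moreover have "x t \<in> C t" if "t \<in> {0..T}" for t
    using closed_sequentially[OF closed[OF that] _ lim[OF that]] ok_X that by (auto simp: ok_def)
  ultimately have ok_x: "ok x" by (auto simp: ok_def)
  have "x t = P x t" if t: "t \<in> {0..T}" for t
  proof (rule LIMSEQ_unique)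
    show "(\<lambda>n. X (Suc n) t) \<longlonglongrightarrow> x t" using lim[OF t] by (rule LIMSEQ_Suc)
    show "(\<lambda>n. X (Suc n) t) \<longlonglongrightarrow> P x t"
    proof (rule metric_LIMSEQ_I)
      fix e :: real assume e: "0 < e"
      define d where "d = e / exp (\<mu> * t)"
      have "0 < d" using e by (simp add: d_def)
      then have "\<forall>\<^sub>F n in sequentially. \<forall>s\<in>{0..T}. dist (X n s) (x s) < d"
        using ulim by (auto simp: uniform_limit_iff)
      then obtain n0 where n0: "\<And>n s. n \<ge> n0 \<Longrightarrow> s \<in> {0..T} \<Longrightarrow> dist (X n s) (x s) < d"
        unfolding eventually_sequentially by blast
      have "dist (X (Suc n) t) (P x t) < e" if "n \<ge> n0" for n
      proof -
        have "norm (P (X n) t - P x t) \<le> (d / 2) * exp (\<mu> * t)"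
        proof (rule contract[OF ok_X ok_x t])
          fix s assume s: "s \<in> {0..T}"
          have "d * 1 \<le> d * exp (\<mu> * s)" using s \<open>0 < d\<close> K by (intro mult_left_mono) (auto simp: \<mu>_def)
          with n0[OF that s] show "norm (X n s - x s) \<le> d * exp (\<mu> * s)" by (simp add: dist_norm)
        qed
        also have "\<dots> < e" using e by (simp add: d_def)
        finally show ?thesis by (simp add: X_Suc dist_norm)
      qed
      then show "\<exists>no. \<forall>n\<ge>no. dist (X (Suc n) t) (P x t) < e" by blast
    qed
  qed
  with ok_x show ?thesis by (intro that[of x]) (auto simp: ok_def P_def)
qed

section \<open>Quadratic flows and the iteration of their stages\<close>

text \<open>
  In reversed time both Riccati equations of the game have the form \<open>H' = rhs G H\<close>: the best response
  to the profile \<open>G\<close> of the previous stage, and, on the diagonal \<open>G = H\<close>, the coupled system. A limit of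
  the stages is therefore a fixed point of the best-response map.
\<close>

locale quadratic_flow =
  fixes A :: "'e::banach \<Rightarrow> 'e" and B1 B2 :: "'e \<Rightarrow> 'e \<Rightarrow> 'e" and Q Z :: 'e and T :: real
  assumes T_nonneg: "0 \<le> T"
    and A: "bounded_linear A" and B1: "bounded_bilinear B1" and B2: "bounded_bilinear B2"
begin

definition rhs :: "'e \<Rightarrow> 'e \<Rightarrow> 'e" where
  "rhs G H = Q + A H + B1 G H + B2 H H"

definition flow :: "(real \<Rightarrow> 'e) \<Rightarrow> (real \<Rightarrow> 'e) \<Rightarrow> bool" where
  "flow G H \<longleftrightarrow> continuous_on {0..T} H \<and>
     (\<forall>t\<in>{0..T}. H t = Z + integral {0..t} (\<lambda>s. rhs (G s) (H s)))"

lemma continuous_on_rhs: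
  assumes "continuous_on S G" "continuous_on S H"
  shows "continuous_on S (\<lambda>s. rhs (G s) (H s))"
  unfolding rhs_def
  by (intro continuous_intros assms bounded_linear.continuous_on[OF A]
      bounded_bilinear.continuous_on[OF B1] bounded_bilinear.continuous_on[OF B2])

text \<open>
  Each difference of products splits into two products with one factor \<open>G - G'\<close> or \<open>H - H'\<close>; the other
  factor is bounded by \<open>b\<close>.
\<close>

lemma rhs_lipschitz:
  obtains K where "0 < K"
    "\<And>G G' H H'. norm G \<le> b \<Longrightarrow> norm G' \<le> b \<Longrightarrow> norm H \<le> b \<Longrightarrow> norm H' \<le> b \<Longrightarrow>
       norm (rhs G H - rhs G' H') \<le> K * (norm (G - G') + norm (H - H'))"
proof -
  obtain KA where KA: "0 < KA" "\<And>x. norm (A x) \<le> norm x * KA"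
    using bounded_linear.pos_bounded[OF A] by blast
  obtain K1 where K1: "0 < K1" "\<And>x y. norm (B1 x y) \<le> norm x * norm y * K1"
    using bounded_bilinear.pos_bounded[OF B1] by blast
  obtain K2 where K2: "0 < K2" "\<And>x y. norm (B2 x y) \<le> norm x * norm y * K2"
    using bounded_bilinear.pos_bounded[OF B2] by blast
  define K where "K = KA + 2 * \<bar>b\<bar> * K1 + 2 * \<bar>b\<bar> * K2"
  show thesis
  proof
    show "0 < K" using KA(1) K1(1) K2(1) by (simp add: K_def add_pos_nonneg)
    fix G G' H H' :: 'e
    assume b: "norm G \<le> b" "norm G' \<le> b" "norm H \<le> b" "norm H' \<le> b"
    then have b0: "0 \<le> b" using norm_ge_zero order_trans by blast
    have "rhs G H - rhs G' H' = A (H - H') + (B1 (G - G') H + B1 G' (H - H')) + (B2 (H - H') H + B2 H' (H - H'))"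
      by (simp add: rhs_def linear_diff[OF bounded_linear.linear[OF A]]
          bounded_bilinear.diff_left[OF B1] bounded_bilinear.diff_right[OF B1]
          bounded_bilinear.diff_left[OF B2] bounded_bilinear.diff_right[OF B2])
    also have "norm \<dots> \<le> norm (A (H - H')) + (norm (B1 (G - G') H) + norm (B1 G' (H - H')))
        + (norm (B2 (H - H') H) + norm (B2 H' (H - H')))"
      by (intro norm_triangle_le add_mono order_refl norm_triangle_ineq)
    also have "\<dots> \<le> norm (H - H') * KA + (norm (G - G') * b * K1 + norm (H - H') * b * K1)
        + (norm (H - H') * b * K2 + norm (H - H') * b * K2)"
    proof (intro add_mono)
      show "norm (A (H - H')) \<le> norm (H - H') * KA" by (rule KA)
      show "norm (B1 (G - G') H) \<le> norm (G - G') * b * K1"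
        using b K1 b0 by (intro order_trans[OF K1(2)] mult_right_mono mult_left_mono) auto
      have "norm G' * norm (H - H') * K1 \<le> b * norm (H - H') * K1"
        using b K1 b0 by (intro mult_right_mono) auto
      with K1(2)[of G' "H - H'"] show "norm (B1 G' (H - H')) \<le> norm (H - H') * b * K1"
        by (simp add: mult_ac)
      show "norm (B2 (H - H') H) \<le> norm (H - H') * b * K2"
        using b K2 b0 by (intro order_trans[OF K2(2)] mult_right_mono mult_left_mono) auto
      have "norm H' * norm (H - H') * K2 \<le> b * norm (H - H') * K2"
        using b K2 b0 by (intro mult_right_mono) auto
      with K2(2)[of H' "H - H'"] show "norm (B2 H' (H - H')) \<le> norm (H - H') * b * K2"
        by (simp add: mult_ac)
    qed
    also have "\<dots> \<le> K * (norm (G - G') + norm (H - H'))"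
    proof -
      have "0 \<le> norm (G - G') * (KA + b * K1 + 2 * b * K2) + norm (H - H') * (b * K1)"
        using b0 KA K1 K2 by simp
      then show ?thesis using b0 by (simp add: K_def algebra_simps)
    qed
    finally show "norm (rhs G H - rhs G' H') \<le> K * (norm (G - G') + norm (H - H'))" .
  qed
qed

lemma flow_compare:
  obtains K where "0 < K"
    "\<And>G G' H H' t. flow G H \<Longrightarrow> flow G' H' \<Longrightarrow> continuous_on {0..T} G \<Longrightarrow> continuous_on {0..T} G' \<Longrightarrow>
       (\<And>s. s \<in> {0..T} \<Longrightarrow> norm (G s) \<le> b \<and> norm (G' s) \<le> b \<and> norm (H s) \<le> b \<and> norm (H' s) \<le> b) \<Longrightarrow>
       t \<in> {0..T} \<Longrightarrow>
       norm (H t - H' t) \<le> K * integral {0..t} (\<lambda>s. norm (G s - G' s)) + K * integral {0..t} (\<lambda>s. norm (H s - H' s))"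
proof -
  obtain K where K: "0 < K"
    "\<And>G G' H H'. norm G \<le> b \<Longrightarrow> norm G' \<le> b \<Longrightarrow> norm H \<le> b \<Longrightarrow> norm H' \<le> b \<Longrightarrow>
       norm (rhs G H - rhs G' H') \<le> K * (norm (G - G') + norm (H - H'))"
    using rhs_lipschitz by blast
  show thesis
  proof (rule that[of K], rule K(1))
    fix G G' H H' t
    assume fl: "flow G H" "flow G' H'" and cG: "continuous_on {0..T} G" "continuous_on {0..T} G'"
      and b: "\<And>s. s \<in> {0..T} \<Longrightarrow> norm (G s) \<le> b \<and> norm (G' s) \<le> b \<and> norm (H s) \<le> b \<and> norm (H' s) \<le> b"
      and t: "t \<in> {0..T}"
    have cH: "continuous_on {0..T} H" "continuous_on {0..T} H'" using fl by (auto simp: flow_def)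
    have sub: "{0..t} \<subseteq> {0..T}" using t by auto
    note c = cG[THEN continuous_on_subset, OF sub] cH[THEN continuous_on_subset, OF sub]
    have i1: "(\<lambda>s. rhs (G s) (H s)) integrable_on {0..t}" "(\<lambda>s. rhs (G' s) (H' s)) integrable_on {0..t}"
      by (intro integrable_continuous_real continuous_on_rhs c)+
    have i2: "(\<lambda>s. norm (G s - G' s)) integrable_on {0..t}" "(\<lambda>s. norm (H s - H' s)) integrable_on {0..t}"
      by (intro integrable_continuous_real continuous_intros c)+
    have eq: "H t - H' t = integral {0..t} (\<lambda>s. rhs (G s) (H s) - rhs (G' s) (H' s))"
      using fl t by (simp add: flow_def integral_diff i1)
    have "norm (H t - H' t) \<le> integral {0..t} (\<lambda>s. K * (norm (G s - G' s) + norm (H s - H' s)))"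
      unfolding eq
    proof (rule integral_norm_bound_integral)
      show "(\<lambda>s. rhs (G s) (H s) - rhs (G' s) (H' s)) integrable_on {0..t}"
        by (intro integrable_diff i1)
      show "(\<lambda>s. K * (norm (G s - G' s) + norm (H s - H' s))) integrable_on {0..t}"
        by (intro integrable_continuous_real continuous_intros c)
    next
      fix s assume "s \<in> {0..t}"
      then show "norm (rhs (G s) (H s) - rhs (G' s) (H' s)) \<le> K * (norm (G s - G' s) + norm (H s - H' s))"
        using b[of s] sub by (intro K(2)) auto
    qed
    also have "\<dots> = K * integral {0..t} (\<lambda>s. norm (G s - G' s) + norm (H s - H' s))"
      by (rule integral_mult_right)
    also have "\<dots> = K * integral {0..t} (\<lambda>s. norm (G s - G' s)) + K * integral {0..t} (\<lambda>s. norm (H s - H' s))"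
      by (simp only: integral_add[OF i2] distrib_left)
    finally show "norm (H t - H' t) \<le>
        K * integral {0..t} (\<lambda>s. norm (G s - G' s)) + K * integral {0..t} (\<lambda>s. norm (H s - H' s))" .
  qed
qed

lemma continuous_on_bound:
  assumes "continuous_on {0..T} (x :: real \<Rightarrow> 'e)"
  shows "\<exists>b. \<forall>t\<in>{0..T}. norm (x t) \<le> b"
  using compact_imp_bounded[OF compact_continuous_image[OF assms compact_Icc]]
  by (auto simp: bounded_iff)

text \<open>
  The hypothesis \<open>le\<close> covers the two cases of interest at once: a common driver \<open>G = G'\<close>, and the diagonal
  \<open>G = H\<close>, \<open>G' = H'\<close>. In both cases the difference of the solutions satisfies a homogeneous integral
  inequality, whose constant comes from the bounds of the continuous functions on the compact interval.
\<close>

lemma flow_eq_of_driver_le: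
  assumes fl: "flow G H" "flow G' H'" and cG: "continuous_on {0..T} G" "continuous_on {0..T} G'"
    and le: "\<And>s. s \<in> {0..T} \<Longrightarrow> norm (G s - G' s) \<le> norm (H s - H' s)"
    and t: "t \<in> {0..T}"
  shows "H t = H' t"
proof -
  have cH: "continuous_on {0..T} H" "continuous_on {0..T} H'" using fl by (auto simp: flow_def)
  obtain b1 b2 b3 b4 where
    "\<forall>t\<in>{0..T}. norm (G t) \<le> b1" "\<forall>t\<in>{0..T}. norm (G' t) \<le> b2"
    "\<forall>t\<in>{0..T}. norm (H t) \<le> b3" "\<forall>t\<in>{0..T}. norm (H' t) \<le> b4"
    using continuous_on_bound cG cH by meson
  moreover define b where "b = max (max b1 b2) (max b3 b4)"
  then have "b1 \<le> b" "b2 \<le> b" "b3 \<le> b" "b4 \<le> b" by simp_all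
  ultimately have b: "norm (G s) \<le> b \<and> norm (G' s) \<le> b \<and> norm (H s) \<le> b \<and> norm (H' s) \<le> b"
    if "s \<in> {0..T}" for s
    using that by (meson order_trans)
  obtain K where K: "0 < K" "\<And>t. t \<in> {0..T} \<Longrightarrow> norm (H t - H' t) \<le>
      K * integral {0..t} (\<lambda>s. norm (G s - G' s)) + K * integral {0..t} (\<lambda>s. norm (H s - H' s))"
    by (rule flow_compare[of b]) (use fl cG b in blast)
  have "norm (H t - H' t) \<le> 2 * 0 * exp (4 * K * t)"
  proof (rule gronwall_weighted[where K = "2 * K" and T = T])
    show "continuous_on {0..T} (\<lambda>t. norm (H t - H' t))" by (intro continuous_intros cH)
    fix r assume r: "r \<in> {0..T}"
    have sub: "{0..r} \<subseteq> {0..T}" using r by auto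
    note c = cG[THEN continuous_on_subset, OF sub] cH[THEN continuous_on_subset, OF sub]
    have "integral {0..r} (\<lambda>s. norm (G s - G' s)) \<le> integral {0..r} (\<lambda>s. norm (H s - H' s))"
      by (intro integral_le integrable_continuous_real continuous_intros c le) (use r in auto)
    then have "K * integral {0..r} (\<lambda>s. norm (G s - G' s)) \<le> K * integral {0..r} (\<lambda>s. norm (H s - H' s))"
      using K by (intro mult_left_mono) auto
    with K(2)[OF r] show "norm (H r - H' r) \<le> 0 * exp (4 * K * r) + 2 * K * integral {0..r} (\<lambda>s. norm (H s - H' s))"
      by simp
  qed (use K t in auto)
  then show ?thesis by simp
qed

lemma flow_unique:
  assumes "flow G H" "flow G H'" "continuous_on {0..T} G" "t \<in> {0..T}"
  shows "H t = H' t"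
  using flow_eq_of_driver_le[OF assms(1,2,3,3) _ assms(4)] by simp

lemma diagonal_flow_unique:
  assumes "flow H H" "flow H' H'" "t \<in> {0..T}"
  shows "H t = H' t"
  using flow_eq_of_driver_le[OF assms(1,2) _ _ _ assms(3)] assms by (simp add: flow_def)

text \<open>
  The stages are compared with the diagonal flow, which is the stage driven by itself. In the norm with
  weight \<open>exp (- 4 * K * t)\<close> the distance to it halves from one stage to the next. The length of the
  interval influences the weight only, so convergence follows as soon as a uniform bound \<open>b\<close> is known.
\<close>

lemma flow_iterates_converge:
  assumes fl: "\<And>k. flow (F k) (F (Suc k))" and lim: "flow Finf Finf"
    and c0: "continuous_on {0..T} (F 0)"
    and b: "\<And>k t. t \<in> {0..T} \<Longrightarrow> norm (F k t) \<le> b" "\<And>t. t \<in> {0..T} \<Longrightarrow> norm (Finf t) \<le> b"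
    and t: "t \<in> {0..T}"
  shows "(\<lambda>k. F k t) \<longlonglongrightarrow> Finf t"
proof -
  have cF: "continuous_on {0..T} (F k)" for k
    using fl c0 by (cases k) (auto simp: flow_def)
  have cI: "continuous_on {0..T} Finf" using lim by (auto simp: flow_def)
  obtain K where K: "0 < K" "\<And>k t. t \<in> {0..T} \<Longrightarrow> norm (F (Suc k) t - Finf t) \<le>
      K * integral {0..t} (\<lambda>s. norm (F k s - Finf s)) + K * integral {0..t} (\<lambda>s. norm (F (Suc k) s - Finf s))"
    by (rule flow_compare[of b]) (use fl lim cF cI b in blast)
  define \<mu> where "\<mu> = 4 * K"
  define D where "D = 2 * b"
  have D0: "0 \<le> D" using b(2)[OF t] norm_ge_zero[of "Finf t"] unfolding D_def by linarith
  have est: "norm (F k s - Finf s) \<le> D * (1/2)^k * exp (\<mu> * s)" if "s \<in> {0..T}" for k s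
    using that
  proof (induction k arbitrary: s)
    case 0
    have "norm (F 0 s - Finf s) \<le> D"
      using norm_triangle_ineq4[of "F 0 s" "Finf s"] b(1)[OF 0, of 0] b(2)[OF 0] unfolding D_def by linarith
    also have "D * 1 \<le> D * exp (\<mu> * s)" using D0 0 K by (intro mult_left_mono) (auto simp: \<mu>_def)
    then have "D \<le> D * exp (\<mu> * s)" by simp
    finally show ?case by simp
  next
    case (Suc k)
    define Dk where "Dk = D * (1/2)^k"
    have Dk0: "0 \<le> Dk" using D0 by (simp add: Dk_def)
    have "norm (F (Suc k) s - Finf s) \<le> 2 * (Dk / 4) * exp (\<mu> * s)"
    proof (rule gronwall_weighted[where K = K and T = T])
      show "continuous_on {0..T} (\<lambda>s. norm (F (Suc k) s - Finf s))" by (intro continuous_intros cF cI)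
      fix r assume r: "r \<in> {0..T}"
      have sub: "{0..r} \<subseteq> {0..T}" using r by auto
      note c = cF[THEN continuous_on_subset, OF sub] cI[THEN continuous_on_subset, OF sub]
      have "integral {0..r} (\<lambda>s. norm (F k s - Finf s)) \<le> integral {0..r} (\<lambda>s. Dk * exp (\<mu> * s))"
        by (intro integral_le integrable_continuous_real continuous_intros c)
           (use r Suc.IH in \<open>auto simp: Dk_def\<close>)
      also have "\<dots> = Dk * ((exp (\<mu> * r) - 1) / \<mu>)"
        using r K by (intro integral_unique has_integral_mult_right has_integral_exp_0) (auto simp: \<mu>_def)
      also have "\<dots> \<le> Dk * (exp (\<mu> * r) / \<mu>)"
        using Dk0 K by (intro mult_left_mono divide_right_mono) (auto simp: \<mu>_def)
      finally have "K * integral {0..r} (\<lambda>s. norm (F k s - Finf s)) \<le> K * (Dk * (exp (\<mu> * r) / \<mu>))"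
        using K by (intro mult_left_mono) auto
      also have "\<dots> = Dk / 4 * exp (\<mu> * r)" using K by (simp add: \<mu>_def)
      finally show "norm (F (Suc k) r - Finf r) \<le>
          Dk / 4 * exp (\<mu> * r) + K * integral {0..r} (\<lambda>s. norm (F (Suc k) s - Finf s))"
        using K(2)[OF r, of k] by linarith
    qed (use K Suc.prems Dk0 in \<open>auto simp: \<mu>_def\<close>)
    then show ?case by (simp add: Dk_def)
  qed
  have "(\<lambda>k. D * (1/2)^k * exp (\<mu> * t)) \<longlonglongrightarrow> D * 0 * exp (\<mu> * t)"
    by (intro tendsto_intros LIMSEQ_power_zero) auto
  then have "(\<lambda>k. D * (1/2)^k * exp (\<mu> * t)) \<longlonglongrightarrow> 0" by simp
  then have "(\<lambda>k. F k t - Finf t) \<longlonglongrightarrow> 0"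
    by (rule Lim_null_comparison[OF always_eventually[OF allI[OF est[OF t]]]])
  then show ?thesis by (rule LIM_zero_cancel)
qed

text \<open>
  The map \<open>g\<close> selects the driver: the constant map \<open>g t x = G t\<close> gives a stage, and \<open>g t x = x\<close> the
  diagonal flow.
\<close>

lemma invariant_flow_exists:
  assumes closed: "\<And>t. t \<in> {0..T} \<Longrightarrow> closed (C t)"
    and b: "\<And>t x. t \<in> {0..T} \<Longrightarrow> x \<in> C t \<Longrightarrow> norm x \<le> b"
    and start: "\<And>t. t \<in> {0..T} \<Longrightarrow> x0 \<in> C t"
    and g: "\<And>t x. t \<in> {0..T} \<Longrightarrow> x \<in> C t \<Longrightarrow> g t x \<in> C t"
      "\<And>t x y. t \<in> {0..T} \<Longrightarrow> norm (g t x - g t y) \<le> norm (x - y)"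
      "\<And>x. continuous_on {0..T} x \<Longrightarrow> continuous_on {0..T} (\<lambda>t. g t (x t))"
    and inv: "\<And>H t. continuous_on {0..T} H \<Longrightarrow> (\<And>t. t \<in> {0..T} \<Longrightarrow> H t \<in> C t) \<Longrightarrow> t \<in> {0..T} \<Longrightarrow>
                 Z + integral {0..t} (\<lambda>s. rhs (g s (H s)) (H s)) \<in> C t"
  obtains H where "flow (\<lambda>t. g t (H t)) H" "\<And>t. t \<in> {0..T} \<Longrightarrow> H t \<in> C t"
proof -
  obtain K where K: "0 < K"
    "\<And>G G' H H'. norm G \<le> b \<Longrightarrow> norm G' \<le> b \<Longrightarrow> norm H \<le> b \<Longrightarrow> norm H' \<le> b \<Longrightarrow>
       norm (rhs G H - rhs G' H') \<le> K * (norm (G - G') + norm (H - H'))"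
    using rhs_lipschitz by blast
  obtain H where "continuous_on {0..T} H" "\<And>t. t \<in> {0..T} \<Longrightarrow> H t \<in> C t"
    "\<And>t. t \<in> {0..T} \<Longrightarrow> H t = Z + integral {0..t} (\<lambda>s. rhs (g s (H s)) (H s))"
  proof (rule picard_invariant[where T = T and K = "2 * K" and C = C and f = "\<lambda>s x. rhs (g s x) x"
        and z = Z and ?x0.0 = "\<lambda>_. x0"])
    fix t x y assume t: "t \<in> {0..T}" and x: "x \<in> C t" and y: "y \<in> C t"
    have "norm (rhs (g t x) x - rhs (g t y) y) \<le> K * (norm (g t x - g t y) + norm (x - y))"
      by (intro K(2) b[OF t] g(1)[OF t] x y)
    also have "\<dots> \<le> K * (norm (x - y) + norm (x - y))"
      using g(2)[OF t, of x y] K(1) by (intro mult_left_mono add_right_mono) auto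
    finally show "norm (rhs (g t x) x - rhs (g t y) y) \<le> 2 * K * norm (x - y)" by simp
  next
    show "0 < 2 * K" using K(1) by simp
  next
    fix H :: "real \<Rightarrow> 'e" assume "continuous_on {0..T} H"
    then show "continuous_on {0..T} (\<lambda>t. rhs (g t (H t)) (H t))" by (intro continuous_on_rhs g(3))
  next
    fix H :: "real \<Rightarrow> 'e" and t assume "continuous_on {0..T} H" "\<And>t. t \<in> {0..T} \<Longrightarrow> H t \<in> C t" "t \<in> {0..T}"
    then show "Z + integral {0..t} (\<lambda>s. rhs (g s (H s)) (H s)) \<in> C t" by (rule inv)
  next
    show "continuous_on {0..T} (\<lambda>_. x0)" by (rule continuous_on_const)
  qed (use T_nonneg closed start in blast)+
  then show thesis by (intro that) (auto simp: flow_def)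
qed

lemma flow_iff_derivative:
  assumes G: "continuous_on {0..T} G"
  shows "flow G H \<longleftrightarrow> H 0 = Z \<and>
    (\<forall>t\<in>{0..T}. (H has_vector_derivative rhs (G t) (H t)) (at t within {0..T}))"
    (is "?L \<longleftrightarrow> ?R")
proof
  assume L: ?L
  then have c: "continuous_on {0..T} (\<lambda>s. rhs (G s) (H s))"
    using G by (auto simp: flow_def intro: continuous_on_rhs)
  have "(H has_vector_derivative rhs (G t) (H t)) (at t within {0..T})" if t: "t \<in> {0..T}" for t
  proof (rule has_vector_derivative_transform[OF t])
    show "H x = Z + integral {0..x} (\<lambda>s. rhs (G s) (H s))" if "x \<in> {0..T}" for x
      using L that by (auto simp: flow_def)
    show "((\<lambda>x. Z + integral {0..x} (\<lambda>s. rhs (G s) (H s))) has_vector_derivative rhs (G t) (H t)) (at t within {0..T})"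
      using has_vector_derivative_add[OF has_vector_derivative_const integral_has_vector_derivative[OF c t], of Z]
      by simp
  qed
  moreover have "H 0 = Z + integral {0..0} (\<lambda>s. rhs (G s) (H s))"
    using L T_nonneg unfolding flow_def by (metis atLeastAtMost_iff order_refl)
  ultimately show ?R by simp
next
  assume R: ?R
  have "continuous_on {0..T} H"
    using R by (auto intro!: continuous_on_vector_derivative)
  moreover have "H t = Z + integral {0..t} (\<lambda>s. rhs (G s) (H s))" if t: "t \<in> {0..T}" for t
  proof -
    have "((\<lambda>s. rhs (G s) (H s)) has_integral H t - H 0) {0..t}"
    proof (rule fundamental_theorem_of_calculus)
      show "0 \<le> t" using t by simp
      fix x assume "x \<in> {0..t}"
      then have "x \<in> {0..T}" using t by simp
      then have "(H has_vector_derivative rhs (G x) (H x)) (at x within {0..T})" using R by blast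
      then show "(H has_vector_derivative rhs (G x) (H x)) (at x within {0..t})"
        by (rule has_vector_derivative_within_subset) (use t in auto)
    qed
    then have "integral {0..t} (\<lambda>s. rhs (G s) (H s)) = H t - H 0" by (rule integral_unique)
    moreover have "H 0 = Z" using R by blast
    ultimately show ?thesis by simp
  qed
  ultimately show ?L by (simp add: flow_def)
qed

end

section \<open>A dimension-free size for tuples of matrices\<close>

lemma ee_mult_vec: "ee i *v (y :: real^'n) = (y $ i) *\<^sub>R axis i 1"
  by (simp add: vec_eq_iff ee_def matrix_matrix_mult_def matrix_vector_mult_def columnvector_def
      rowvector_def axis_def if_distrib[where f = "\<lambda>x. x * _"] if_distrib[where f = "\<lambda>x. _ * x"] sum.delta cong: if_cong)

lemma transpose_ee: "transpose (ee i) = ee i"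
  by (simp add: vec_eq_iff ee_def matrix_matrix_mult_def transpose_def columnvector_def
      rowvector_def axis_def)

lemma inner_mult_ee: "x \<bullet> (ee i *v y) = x $ i * (y :: real^'n) $ i"
  by (simp add: ee_mult_vec inner_axis)

lemma inner_matrix_vector: "(x :: real^'n) \<bullet> (A *v y) = (transpose A *v x) \<bullet> y"
  by (metis dot_lmul_matrix transpose_matrix_vector)

lemma matrix_vector_mult_sum: "(\<Sum>i\<in>I. A i) *v (y :: real^'n) = (\<Sum>i\<in>I. A i *v y)"
  by (induction I rule: infinite_finite_induct) (auto simp: matrix_vector_mult_add_rdistrib)

text \<open>
  An upper bound for the 2-norm as a bound on the bilinear form. The condition is linear in the matrix
  and symmetric under transposition.
\<close>

definition op_bound :: "real \<Rightarrow> real^'n^'n \<Rightarrow> bool" where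
  "op_bound b B \<longleftrightarrow> (\<forall>x y. x \<bullet> (B *v y) \<le> b * norm x * norm y)"

lemma op_bound_norm:
  assumes "op_bound b B" "0 \<le> b" shows "norm (B *v y) \<le> b * norm y"
proof (cases "B *v y = 0")
  case False
  have "norm (B *v y) * norm (B *v y) \<le> norm (B *v y) * (b * norm y)"
    using assms(1)[unfolded op_bound_def, rule_format, of "B *v y" y]
    by (simp add: power2_norm_eq_inner[symmetric] power2_eq_square mult_ac)
  then show ?thesis using False by (simp add: mult_le_cancel_left)
qed (use assms in simp)

lemma op_bound_transpose: "op_bound b B \<Longrightarrow> op_bound b (transpose B)"
  unfolding op_bound_def by (metis inner_commute inner_matrix_vector mult.assoc mult.commute transpose_transpose)

lemma op_bound_2norm: "op_bound (matrix_2norm A) (A :: real^'n^'n)"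
  unfolding op_bound_def
proof (intro allI)
  fix x y :: "real^'n"
  have "x \<bullet> (A *v y) \<le> norm x * norm (A *v y)" by (rule norm_cauchy_schwarz)
  also have "\<dots> \<le> norm x * (matrix_2norm A * norm y)"
    unfolding matrix_2norm_def by (intro mult_left_mono onorm matrix_vector_mul_bounded_linear) auto
  finally show "x \<bullet> (A *v y) \<le> matrix_2norm A * norm x * norm y" by (simp add: mult_ac)
qed

lemma matrix_2norm_nonneg: "0 \<le> matrix_2norm A"
  unfolding matrix_2norm_def by (intro onorm_pos_le matrix_vector_mul_bounded_linear)

definition signed_form :: "('n \<Rightarrow> real) \<Rightarrow> real^'n \<Rightarrow> real^'n \<Rightarrow> real^'n^'n^'n \<Rightarrow> real" where
  "signed_form \<theta> x y H = (\<Sum>i\<in>UNIV. \<theta> i * (x \<bullet> (H $ i *v y)))"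

text \<open>
  The least such \<open>r\<close> is the largest 2-norm of the signed combinations \<open>\<Sum>\<^sub>i \<theta>\<^sub>i H\<^sub>i\<close> with \<open>\<bar>\<theta>\<^sub>i\<bar> \<le> 1\<close>. This size of
  a tuple is what makes the smallness condition independent of the number of players. The maximum of the
  norms of the \<open>H\<^sub>i\<close> would not do: in the Riccati equations the players interact through the matrix whose
  \<open>i\<close>-th row is the \<open>i\<close>-th row of \<open>H\<^sub>i\<close>, and the norm of that matrix can exceed the maximum by a factor
  growing with the number of players. Being a supremum of linear functionals, the size is also compatible
  with integration.
\<close>

definition tuple_bound :: "real \<Rightarrow> real^'n^'n^'n \<Rightarrow> bool" where
  "tuple_bound r H \<longleftrightarrow>
     (\<forall>\<theta> x y. (\<forall>i. \<bar>\<theta> i\<bar> \<le> 1) \<longrightarrow> signed_form \<theta> x y H \<le> r * norm x * norm y)"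

lemma linear_signed_form: "linear (signed_form \<theta> x y)"
  by (rule linearI) (auto simp: signed_form_def matrix_vector_mult_add_rdistrib inner_add_right
      distrib_left sum.distrib scaleR_matrix_vector_assoc[symmetric] sum_distrib_left mult_ac)

lemma bounded_linear_signed_form: "bounded_linear (signed_form \<theta> x y)"
  using linear_signed_form linear_conv_bounded_linear by blast

lemma tuple_bound_add:
  "tuple_bound r H \<Longrightarrow> tuple_bound s G \<Longrightarrow> tuple_bound (r + s) (H + G)"
  unfolding tuple_bound_def
  by (auto simp: linear_add[OF linear_signed_form] distrib_right intro!: add_mono)

lemma tuple_bound_uminus: "tuple_bound r (H :: real^'n^'n^'n) \<Longrightarrow> tuple_bound r (- H)"
  unfolding tuple_bound_def
proof (intro allI impI)
  fix \<theta> :: "'n \<Rightarrow> real" and x y :: "real^'n" assume H: "\<forall>\<theta> x y. (\<forall>i. \<bar>\<theta> i\<bar> \<le> 1) \<longrightarrow> signed_form \<theta> x y H \<le> r * norm x * norm y"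
    and \<theta>: "\<forall>i. \<bar>\<theta> i\<bar> \<le> (1::real)"
  have "signed_form (\<lambda>i. - \<theta> i) x y H \<le> r * norm x * norm y"
    using H \<theta> by (auto simp del: mult_minus_left)
  moreover have "signed_form (\<lambda>i. - \<theta> i) x y H = signed_form \<theta> x y (- H)"
    by (simp add: linear_neg[OF linear_signed_form]) (simp add: signed_form_def sum_negf)
  ultimately show "signed_form \<theta> x y (- H) \<le> r * norm x * norm y" by simp
qed

lemma tuple_bound_scale: "0 \<le> c \<Longrightarrow> tuple_bound r H \<Longrightarrow> tuple_bound (c * r) (c *\<^sub>R H)"
  unfolding tuple_bound_def
  by (auto simp: linear_scale[OF linear_signed_form] mult.assoc intro!: mult_left_mono)

lemma tuple_bound_mono: "tuple_bound r H \<Longrightarrow> r \<le> s \<Longrightarrow> tuple_bound s H"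
  unfolding tuple_bound_def by (meson mult_right_mono norm_ge_zero order_trans)

lemma tuple_bound_transpose: "tuple_bound r (H :: real^'n^'n^'n) \<Longrightarrow> tuple_bound r (\<chi> i. transpose (H $ i))"
  unfolding tuple_bound_def
proof (intro allI impI)
  fix \<theta> :: "'n \<Rightarrow> real" and x y :: "real^'n" assume H: "\<forall>\<theta> x y. (\<forall>i. \<bar>\<theta> i\<bar> \<le> 1) \<longrightarrow> signed_form \<theta> x y H \<le> r * norm x * norm y"
    and \<theta>: "\<forall>i. \<bar>\<theta> i\<bar> \<le> (1::real)"
  have "signed_form \<theta> x y (\<chi> i. transpose (H $ i)) = signed_form \<theta> y x H"
    by (simp add: signed_form_def inner_matrix_vector inner_commute transpose_transpose)
  moreover have "signed_form \<theta> y x H \<le> r * norm y * norm x" using H \<theta> by blast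
  ultimately show "signed_form \<theta> x y (\<chi> i. transpose (H $ i)) \<le> r * norm x * norm y"
    by (simp add: mult_ac)
qed

lemma tuple_bound_mult_right:
  assumes "tuple_bound r (H :: real^'n^'n^'n)" "op_bound b B" "0 \<le> r" "0 \<le> b"
  shows "tuple_bound (r * b) (\<chi> i. H $ i ** B)"
  unfolding tuple_bound_def
proof (intro allI impI)
  fix \<theta> :: "'n \<Rightarrow> real" and x y :: "real^'n" assume \<theta>: "\<forall>i. \<bar>\<theta> i\<bar> \<le> (1::real)"
  have "signed_form \<theta> x y (\<chi> i. H $ i ** B) = signed_form \<theta> x (B *v y) H"
    by (simp add: signed_form_def matrix_vector_mul_assoc)
  also have "\<dots> \<le> r * norm x * norm (B *v y)" using assms(1) \<theta> by (auto simp: tuple_bound_def)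
  also have "\<dots> \<le> r * norm x * (b * norm y)"
    using assms by (intro mult_left_mono op_bound_norm) auto
  finally show "signed_form \<theta> x y (\<chi> i. H $ i ** B) \<le> r * b * norm x * norm y" by (simp add: mult_ac)
qed

lemma tuple_bound_mult_left:
  assumes "tuple_bound r (H :: real^'n^'n^'n)" "op_bound b B" "0 \<le> r" "0 \<le> b"
  shows "tuple_bound (r * b) (\<chi> i. B ** H $ i)"
  using tuple_bound_transpose[OF tuple_bound_mult_right[OF tuple_bound_transpose[OF assms(1)]
      op_bound_transpose[OF assms(2)] assms(3,4)]]
  by (simp add: matrix_transpose_mul transpose_transpose)

text \<open>
  The sum of \<open>\<theta>\<^sub>i \<theta>\<^sub>j b\<^sub>i\<^sub>j\<close> over random signs has the diagonal sum as its mean, so some choice of signs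
  reaches at least the mean. The signs are chosen one after the other: the terms that involve a new index
  are linear in its sign.
\<close>

lemma signs_off_diagonal:
  fixes b :: "'n \<Rightarrow> 'n \<Rightarrow> real"
  assumes "finite S"
  shows "\<exists>\<theta>. (\<forall>i. \<bar>\<theta> i\<bar> = 1) \<and> (\<Sum>i\<in>S. b i i) \<le> (\<Sum>i\<in>S. \<Sum>j\<in>S. \<theta> i * \<theta> j * b i j)"
  using assms
proof (induction S rule: finite_induct)
  case empty
  show ?case by (intro exI[of _ "\<lambda>_. 1"]) auto
next
  case (insert k S)
  then obtain \<theta> where \<theta>: "\<forall>i. \<bar>\<theta> i\<bar> = (1::real)"
    "(\<Sum>i\<in>S. b i i) \<le> (\<Sum>i\<in>S. \<Sum>j\<in>S. \<theta> i * \<theta> j * b i j)" by blast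
  \<comment> \<open>The terms that involve the new index \<open>k\<close> off the diagonal are its sign times \<open>m\<close>.\<close>
  define m where "m = (\<Sum>i\<in>S. \<theta> i * (b i k + b k i))"
  define s :: real where "s = (if 0 \<le> m then 1 else - 1)"
  define \<theta>' where "\<theta>' = \<theta>(k := s)"
  have s: "\<bar>s\<bar> = 1" "s * s = 1" "0 \<le> s * m" by (auto simp: s_def)
  have old: "\<theta>' i = \<theta> i" if "i \<in> S" for i using that insert by (auto simp: \<theta>'_def)
  have "(\<Sum>i\<in>insert k S. \<Sum>j\<in>insert k S. \<theta>' i * \<theta>' j * b i j)
      = s * s * b k k + (\<Sum>j\<in>S. s * \<theta> j * b k j) + (\<Sum>i\<in>S. \<theta> i * s * b i k + (\<Sum>j\<in>S. \<theta> i * \<theta> j * b i j))"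
    using insert by (simp add: old cong: sum.cong) (simp add: \<theta>'_def)
  also have "\<dots> = b k k + s * m + (\<Sum>i\<in>S. \<Sum>j\<in>S. \<theta> i * \<theta> j * b i j)"
    by (simp add: s m_def sum.distrib sum_distrib_left algebra_simps)
  finally have "(\<Sum>i\<in>insert k S. b i i) \<le> (\<Sum>i\<in>insert k S. \<Sum>j\<in>insert k S. \<theta>' i * \<theta>' j * b i j)"
    using \<theta>(2) s insert by simp
  moreover have "\<forall>i. \<bar>\<theta>' i\<bar> = 1" using \<theta> s by (auto simp: \<theta>'_def)
  ultimately show ?case by blast
qed

text \<open>
  The matrix that collects the \<open>j\<close>-th row of the \<open>j\<close>-th component is bounded by the size of the tuple,
  with no loss in the dimension. Flipping the signs of the coordinates of \<open>x\<close> does not change its norm,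
  and the signs can be chosen such that the off-diagonal terms of the signed combination help.
\<close>

lemma op_bound_rows:
  assumes H: "tuple_bound r (H :: real^'n^'n^'n)"
  shows "op_bound r (\<Sum>j\<in>UNIV. ee j ** H $ j)"
  unfolding op_bound_def
proof (intro allI)
  fix x y :: "real^'n"
  define b where "b i j = x $ i * (H $ j *v y) $ i" for i j
  obtain \<theta> where \<theta>: "\<forall>i. \<bar>\<theta> i\<bar> = (1::real)" "(\<Sum>i\<in>UNIV. b i i) \<le> (\<Sum>i\<in>UNIV. \<Sum>j\<in>UNIV. \<theta> i * \<theta> j * b i j)"
    using signs_off_diagonal[of UNIV b] by auto
  define x' :: "real^'n" where "x' = (\<chi> i. \<theta> i * x $ i)"
  have "\<theta> i * \<theta> i = 1" for i
    using \<theta>(1)[rule_format, of i] by (metis abs_mult_self_eq mult_1)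
  then have "x' \<bullet> x' = x \<bullet> x"
    by (simp add: inner_vec_def x'_def algebra_simps) (simp add: mult.assoc[symmetric])
  then have nx: "norm x' = norm x" by (simp add: norm_eq_sqrt_inner)
  have "x \<bullet> ((\<Sum>j\<in>UNIV. ee j ** H $ j) *v y) = (\<Sum>i\<in>UNIV. b i i)"
    by (simp add: matrix_vector_mult_sum matrix_vector_mul_assoc[symmetric] inner_sum_right inner_mult_ee b_def)
  also have "\<dots> \<le> (\<Sum>i\<in>UNIV. \<Sum>j\<in>UNIV. \<theta> i * \<theta> j * b i j)" by (rule \<theta>(2))
  also have "\<dots> = (\<Sum>j\<in>UNIV. \<Sum>i\<in>UNIV. \<theta> i * \<theta> j * b i j)" by (rule sum.swap)
  also have "\<dots> = signed_form \<theta> x' y H"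
    by (simp add: signed_form_def inner_vec_def b_def x'_def sum_distrib_left mult_ac)
  also have "\<dots> \<le> r * norm x' * norm y" using H \<theta>(1) by (auto simp: tuple_bound_def)
  finally show "x \<bullet> ((\<Sum>j\<in>UNIV. ee j ** H $ j) *v y) \<le> r * norm x * norm y" by (simp add: nx)
qed

lemma op_bound_columns:
  assumes H: "tuple_bound r (H :: real^'n^'n^'n)"
  shows "op_bound r (\<Sum>j\<in>UNIV. H $ j ** ee j)"
proof -
  have tr_sum: "transpose (\<Sum>j\<in>S. A j) = (\<Sum>j\<in>S. transpose (A j))" for S and A :: "'n \<Rightarrow> real^'n^'n"
    by (simp add: vec_eq_iff transpose_def)
  have "transpose (\<Sum>j\<in>UNIV. ee j ** (\<chi> i. transpose (H $ i)) $ j) = (\<Sum>j\<in>UNIV. H $ j ** ee j)"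
    by (simp add: tr_sum matrix_transpose_mul transpose_transpose transpose_ee)
  then show ?thesis
    using op_bound_transpose[OF op_bound_rows[OF tuple_bound_transpose[OF H]]] by simp
qed

lemma sum_weighted_le_norms:
  fixes u v :: "real^'n"
  assumes "\<forall>i. \<bar>\<theta> i\<bar> \<le> 1"
  shows "(\<Sum>i\<in>UNIV. \<theta> i * (u $ i * v $ i)) \<le> norm u * norm v"
proof -
  have "(\<Sum>i\<in>UNIV. \<theta> i * (u $ i * v $ i)) = (\<chi> i. \<theta> i * u $ i) \<bullet> v"
    by (simp add: inner_vec_def mult_ac)
  also have "\<dots> \<le> norm (\<chi> i. \<theta> i * u $ i) * norm v" by (rule norm_cauchy_schwarz)
  also have "norm (\<chi> i. \<theta> i * u $ i) \<le> norm u"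
    using assms by (intro norm_le_componentwise_cart) (auto simp: abs_mult mult_left_le_one_le)
  finally show ?thesis by (simp add: mult_right_mono)
qed

text \<open>
  The functional form of the left-hand side allows rewriting under a binder.
\<close>

lemma row_vector: "(\<Sum>j\<in>UNIV. ee j ** h j) *v y = (\<chi> i. (h i *v (y::real^'n)) $ i)"
  by (simp add: matrix_vector_mult_sum matrix_vector_mul_assoc[symmetric] ee_mult_vec vec_eq_iff
      axis_def if_distrib[where f = "\<lambda>x. _ * x"] sum.delta cong: if_cong)

text \<open>
  A signed combination of \<open>G\<^sub>i e\<^sub>i e\<^sub>i\<^sup>T H\<^sub>i\<close> pairs the vector of the \<open>i\<close>-th entries of \<open>G\<^sub>i\<^sup>T x\<close> with that of
  the \<open>i\<close>-th entries of \<open>H\<^sub>i y\<close>. Both vectors are images under collected rows, and the weights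
  \<open>\<bar>\<theta>\<^sub>i\<bar> \<le> 1\<close> do not increase the norm.
\<close>

lemma tuple_bound_rank_one_product:
  assumes G: "tuple_bound r (G :: real^'n^'n^'n)" and H: "tuple_bound s H" and "0 \<le> r" "0 \<le> s"
  shows "tuple_bound (r * s) (\<chi> i. G $ i ** ee i ** H $ i)"
  unfolding tuple_bound_def
proof (intro allI impI)
  fix \<theta> :: "'n \<Rightarrow> real" and x y :: "real^'n" assume \<theta>: "\<forall>i. \<bar>\<theta> i\<bar> \<le> (1::real)"
  define u :: "real^'n" where "u = (\<chi> i. (transpose (G $ i) *v x) $ i)"
  define v :: "real^'n" where "v = (\<chi> i. (H $ i *v y) $ i)"
  have "norm u \<le> r * norm x"
    using op_bound_norm[OF op_bound_rows[OF tuple_bound_transpose[OF G]] \<open>0 \<le> r\<close>, of x]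
    by (simp add: row_vector u_def del: transpose_matrix_vector)
  moreover have "norm v \<le> s * norm y"
    using op_bound_norm[OF op_bound_rows[OF H] \<open>0 \<le> s\<close>, of y] by (simp add: row_vector v_def)
  ultimately have "norm u * norm v \<le> (r * norm x) * (s * norm y)"
    using assms by (intro mult_mono) auto
  moreover have "signed_form \<theta> x y (\<chi> i. G $ i ** ee i ** H $ i) = (\<Sum>i\<in>UNIV. \<theta> i * (u $ i * v $ i))"
    by (simp add: signed_form_def matrix_vector_mul_assoc[symmetric] u_def v_def
        inner_matrix_vector[of x "G $ _"] inner_mult_ee del: transpose_matrix_vector)
  ultimately show "signed_form \<theta> x y (\<chi> i. G $ i ** ee i ** H $ i) \<le> r * s * norm x * norm y"
    using sum_weighted_le_norms[OF \<theta>, of u v] by (simp add: mult_ac)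
qed

lemma tuple_bound_sandwich:
  assumes L: "op_bound l (L :: real^'n^'n)" and "0 \<le> l"
  shows "tuple_bound (l\<^sup>2) (\<chi> i. L ** ee i ** L)"
  unfolding tuple_bound_def
proof (intro allI impI)
  fix \<theta> :: "'n \<Rightarrow> real" and x y :: "real^'n" assume \<theta>: "\<forall>i. \<bar>\<theta> i\<bar> \<le> (1::real)"
  have "norm (transpose L *v x) * norm (L *v y) \<le> (l * norm x) * (l * norm y)"
    using assms op_bound_transpose[OF L] by (intro mult_mono op_bound_norm) auto
  moreover have "signed_form \<theta> x y (\<chi> i. L ** ee i ** L)
      = (\<Sum>i\<in>UNIV. \<theta> i * ((transpose L *v x) $ i * (L *v y) $ i))"
    by (simp add: signed_form_def matrix_vector_mul_assoc[symmetric]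
        inner_matrix_vector[of x L] inner_mult_ee del: transpose_matrix_vector)
  ultimately show "signed_form \<theta> x y (\<chi> i. L ** ee i ** L) \<le> l\<^sup>2 * norm x * norm y"
    using sum_weighted_le_norms[OF \<theta>, of "transpose L *v x" "L *v y"]
    by (simp add: mult_ac power2_eq_square)
qed

lemma closed_tuple_bound: "closed {H. tuple_bound r H}"
  unfolding tuple_bound_def
  by (intro closed_Collect_all closed_Collect_imp open_Collect_const closed_Collect_le
      continuous_on_const linear_continuous_on bounded_linear_signed_form)

text \<open>
  A crude comparison with the Euclidean norm, for the Lipschitz and convergence estimates, whose constants
  may depend on the dimension.
\<close>

lemma tuple_bound_norm:
  assumes "tuple_bound r (H :: real^'n^'n^'n)"
  shows "norm H \<le> real CARD('n) ^ 3 * r"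
proof -
  have comp: "\<bar>H $ i $ j $ k\<bar> \<le> r" for i j k
  proof -
    define s :: real where "s = sgn (H $ i $ j $ k)"
    have "signed_form (\<lambda>l. if l = i then s else 0) (axis j 1) (axis k 1) H = s * H $ i $ j $ k"
      by (simp add: signed_form_def if_distrib[where f = "\<lambda>x. x * _"] inner_axis'
          matrix_vector_mult_basis column_def cong: if_cong)
    moreover have "\<forall>l. \<bar>if l = i then s else 0\<bar> \<le> 1" by (auto simp: s_def abs_sgn_eq)
    ultimately have "s * H $ i $ j $ k \<le> r"
      using assms[unfolded tuple_bound_def, rule_format, of "\<lambda>l. if l = i then s else 0" "axis j 1" "axis k 1"]
      by (auto simp: norm_axis_1)
    then show ?thesis by (simp add: s_def sgn_mult_self_eq mult.commute abs_sgn)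
  qed
  have "norm H \<le> (\<Sum>i\<in>UNIV. norm (H $ i))"
    unfolding norm_vec_def[of H] by (rule L2_set_le_sum) auto
  also have "\<dots> \<le> (\<Sum>i\<in>(UNIV :: 'n set). \<Sum>j\<in>(UNIV :: 'n set). \<Sum>k\<in>(UNIV :: 'n set). r)"
  proof (intro sum_mono)
    fix i :: 'n
    have "norm (H $ i) \<le> (\<Sum>j\<in>UNIV. norm (H $ i $ j))"
      unfolding norm_vec_def[of "H $ i"] by (rule L2_set_le_sum) auto
    also have "\<dots> \<le> (\<Sum>j\<in>UNIV. \<Sum>k\<in>UNIV. \<bar>H $ i $ j $ k\<bar>)"
      by (intro sum_mono norm_le_l1_cart)
    also have "\<dots> \<le> (\<Sum>j\<in>(UNIV :: 'n set). \<Sum>k\<in>(UNIV :: 'n set). r)"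
      by (intro sum_mono comp)
    finally show "norm (H $ i) \<le> \<dots>" .
  qed
  also have "\<dots> = real CARD('n) ^ 3 * r" by (simp add: power3_eq_cube)
  finally show ?thesis .
qed

text \<open>
  The bound is a family of linear inequalities, and each of them can be integrated.
\<close>

lemma tuple_bound_integral:
  fixes g :: "real \<Rightarrow> real^'n^'n^'n"
  assumes g: "continuous_on {0..t} g" and \<rho>: "continuous_on {0..t} \<rho>"
    and le: "\<And>s. s \<in> {0..t} \<Longrightarrow> tuple_bound (\<rho> s) (g s)"
  shows "tuple_bound (integral {0..t} \<rho>) (integral {0..t} g)"
  unfolding tuple_bound_def
proof (intro allI impI)
  fix \<theta> :: "'n \<Rightarrow> real" and x y :: "real^'n" assume \<theta>: "\<forall>i. \<bar>\<theta> i\<bar> \<le> (1::real)"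
  have gi: "g integrable_on {0..t}" using g by (rule integrable_continuous_real)
  have "signed_form \<theta> x y (integral {0..t} g) = integral {0..t} (signed_form \<theta> x y \<circ> g)"
    using integral_linear[OF gi bounded_linear_signed_form] by simp
  also have "\<dots> \<le> integral {0..t} (\<lambda>s. \<rho> s * (norm x * norm y))"
  proof (rule integral_le)
    show "(signed_form \<theta> x y \<circ> g) integrable_on {0..t}"
      by (rule integrable_linear[OF gi bounded_linear_signed_form])
    show "(\<lambda>s. \<rho> s * (norm x * norm y)) integrable_on {0..t}"
      by (intro integrable_continuous_real continuous_intros \<rho>)
  qed (use le \<theta> in \<open>auto simp: tuple_bound_def mult_ac\<close>)
  finally show "signed_form \<theta> x y (integral {0..t} g) \<le> integral {0..t} \<rho> * norm x * norm y"
    by (simp add: mult.assoc)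
qed

section \<open>The Riccati equations of the game as quadratic flows\<close>

lemma matrix_mult_scaleR_left: "(k *\<^sub>R (A :: real^'m^'n)) ** (B :: real^'p^'m) = k *\<^sub>R (A ** B)"
  by (simp add: vec_eq_iff matrix_matrix_mult_def sum_distrib_left mult_ac)

lemma matrix_mult_scaleR_right: "(A :: real^'m^'n) ** (k *\<^sub>R (B :: real^'p^'m)) = k *\<^sub>R (A ** B)"
  by (simp add: vec_eq_iff matrix_matrix_mult_def sum_distrib_left mult_ac)

lemma matrix_mult_add_left: "((A :: real^'m^'n) + C) ** (B :: real^'p^'m) = A ** B + C ** B"
  by (simp add: vec_eq_iff matrix_matrix_mult_def sum.distrib algebra_simps)

lemma matrix_mult_sum_right: "(A :: real^'m^'n) ** (\<Sum>j\<in>J. B j :: real^'p^'m) = (\<Sum>j\<in>J. A ** B j)"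
  by (induction J rule: infinite_finite_induct) (auto simp: matrix_add_ldistrib)

lemma matrix_mult_sum_left: "(\<Sum>j\<in>J. B j :: real^'m^'n) ** (A :: real^'p^'m) = (\<Sum>j\<in>J. B j ** A)"
  by (induction J rule: infinite_finite_induct) (auto simp: matrix_mult_add_left)

lemma matrix_mult_minus_left: "(- (A :: real^'m^'n)) ** (B :: real^'p^'m) = - (A ** B)"
  by (simp add: vec_eq_iff matrix_matrix_mult_def sum_negf)

lemma matrix_mult_minus_right: "(A :: real^'m^'n) ** (- (B :: real^'p^'m)) = - (A ** B)"
  by (simp add: vec_eq_iff matrix_matrix_mult_def sum_negf)

lemma matrix_mult_diff_left: "((A :: real^'m^'n) - C) ** (B :: real^'p^'m) = A ** B - C ** B"
  by (simp add: vec_eq_iff matrix_matrix_mult_def sum_subtractf algebra_simps)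

lemma matrix_mult_diff_right: "(B :: real^'m^'n) ** ((A :: real^'p^'m) - C) = B ** A - B ** C"
  by (simp add: vec_eq_iff matrix_matrix_mult_def sum_subtractf algebra_simps)

lemmas matrix_bilinear = matrix_add_ldistrib matrix_mult_add_left matrix_mult_scaleR_left
  matrix_mult_scaleR_right matrix_mult_minus_left matrix_mult_minus_right
  matrix_mult_diff_left matrix_mult_diff_right

lemma sum_ee: "(\<Sum>j\<in>UNIV. ee j) = (mat 1 :: real^'n^'n)"
  by (simp add: matrix_eq matrix_vector_mult_sum ee_mult_vec vec_eq_iff axis_def
      if_distrib[where f = "\<lambda>x. _ * x"] sum.delta cong: if_cong)

lemma transpose_sum: "transpose (\<Sum>j\<in>S. A j :: real^'m^'n) = (\<Sum>j\<in>S. transpose (A j))"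
  by (simp add: vec_eq_iff transpose_def)

lemma has_vector_derivative_vec_lambda:
  fixes f :: "'n::finite \<Rightarrow> real \<Rightarrow> 'a::euclidean_space"
  assumes "\<And>i. (f i has_vector_derivative f' i) F"
  shows "((\<lambda>t. \<chi> i. f i t) has_vector_derivative (\<chi> i. f' i)) F"
proof -
  have lin: "bounded_linear (axis i :: 'a \<Rightarrow> 'a^'n)" for i
    unfolding linear_conv_bounded_linear[symmetric]
    by (rule linearI) (auto simp: axis_def vec_eq_iff)
  have eq: "(\<chi> i. g i) = (\<Sum>i\<in>UNIV. axis i (g i))" for g :: "'n \<Rightarrow> 'a"
    by (simp add: vec_eq_iff axis_def sum.delta)
  have "((\<lambda>t. \<Sum>i\<in>UNIV. axis i (f i t)) has_vector_derivative (\<Sum>i\<in>UNIV. axis i (f' i))) F"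
    by (intro has_vector_derivative_sum bounded_linear.has_vector_derivative[OF lin] assms)
  then show ?thesis unfolding eq .
qed

lemma has_vector_derivative_reverse:
  fixes f :: "real \<Rightarrow> 'a::real_normed_vector"
  assumes "(f has_vector_derivative f') (at (T - t) within {0..T})"
  shows "((\<lambda>s. f (T - s)) has_vector_derivative - f') (at t within {0..T})"
proof -
  have "((\<lambda>s. T - s) has_vector_derivative - 1) (at t within {0..T})"
    by (auto intro!: derivative_eq_intros)
  moreover have "(f has_vector_derivative f') (at (T - t) within (\<lambda>s. T - s) ` {0..T})"
    using assms by simp
  ultimately show ?thesis
    using vector_diff_chain_within[of "\<lambda>s. T - s" "-1" t "{0..T}" f f'] by (simp add: o_def)
qed

locale graph_riccati =
  fixes L :: "real^'n^'n" and T a q \<epsilon> c :: real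
  assumes L_sym: "transpose L = L"
    and T_pos: "0 < T" and a_nonneg: "0 \<le> a" and q_nonneg: "0 \<le> q" and c_nonneg: "0 \<le> c"
    and q_le: "q\<^sup>2 \<le> \<epsilon>" and small: "C_L T a q \<epsilon> c L \<le> 1"
begin

definition drift_part :: "real^'n^'n^'n \<Rightarrow> real^'n^'n^'n" where
  "drift_part H = (\<chi> i. - ((a + q) *\<^sub>R (L ** H $ i)) - (a + q) *\<^sub>R (H $ i ** L))"

definition cross_part :: "real^'n^'n^'n \<Rightarrow> real^'n^'n^'n \<Rightarrow> real^'n^'n^'n" where
  "cross_part G H = (\<chi> i. - (H $ i ** (\<Sum>j\<in>UNIV - {i}. ee j ** G $ j))
     - (\<Sum>j\<in>UNIV - {i}. G $ j ** ee j ** H $ i))"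

definition own_part :: "real^'n^'n^'n \<Rightarrow> real^'n^'n^'n \<Rightarrow> real^'n^'n^'n" where
  "own_part G H = (\<chi> i. - (G $ i ** ee i ** H $ i))"

definition running :: "real^'n^'n^'n" where
  "running = (\<epsilon> - q\<^sup>2) *\<^sub>R (\<chi> i. L ** ee i ** L)"

definition terminal :: "real^'n^'n^'n" where
  "terminal = c *\<^sub>R (\<chi> i. L ** ee i ** L)"

lemma bounded_linear_drift_part: "bounded_linear drift_part"
  unfolding linear_conv_bounded_linear[symmetric]
  by (rule linearI) (auto simp: drift_part_def vec_eq_iff matrix_bilinear algebra_simps)

lemma bounded_bilinear_cross_part: "bounded_bilinear cross_part"
  unfolding bilinear_conv_bounded_bilinear[symmetric] bilinear_def
proof (intro conjI allI)
  show "linear (cross_part G)" for G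
    by (rule linearI) (simp_all add: cross_part_def vec_eq_iff matrix_bilinear
        sum.distrib scaleR_sum_right[symmetric] sum_distrib_left algebra_simps)
  show "linear (\<lambda>G. cross_part G H)" for H
    by (rule linearI) (simp_all add: cross_part_def vec_eq_iff matrix_bilinear
        sum.distrib scaleR_sum_right[symmetric] sum_distrib_left algebra_simps)
qed

lemma bounded_bilinear_own_part: "bounded_bilinear own_part"
  unfolding bilinear_conv_bounded_bilinear[symmetric] bilinear_def
proof (intro conjI allI)
  show "linear (own_part G)" for G
    by (rule linearI) (simp_all add: own_part_def vec_eq_iff matrix_bilinear algebra_simps)
  show "linear (\<lambda>G. own_part G H)" for H
    by (rule linearI) (simp_all add: own_part_def vec_eq_iff matrix_bilinear algebra_simps)
qed

sublocale quadratic_flow drift_part cross_part own_part running terminal T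
  by (intro quadratic_flow.intro bounded_linear_drift_part bounded_bilinear_cross_part
      bounded_bilinear_own_part less_imp_le[OF T_pos])

abbreviation ell :: real where "ell \<equiv> matrix_2norm L"

text \<open>
  The terms \<open>L H\<^sub>i + H\<^sub>i L\<close> let the size grow at most at the exponential rate \<open>rate\<close>. The condition
  \<open>C_L \<le> 1\<close> says that this growth is at most a factor \<open>2\<close> over \<open>[0, T]\<close>, and that terminal and running cost
  together are at most half of \<open>radius\<close>.
\<close>

definition rate :: real where "rate = 2 * (a + q) * ell"

definition radius :: real where "radius = 1 / (50 * T)"

lemma ell_nonneg: "0 \<le> ell" by (rule matrix_2norm_nonneg)

lemma rate_nonneg: "0 \<le> rate"
  using a_nonneg q_nonneg ell_nonneg by (simp add: rate_def)

lemma radius_pos: "0 < radius" using T_pos by (simp add: radius_def)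

lemma exp_rate_le: assumes "t \<in> {0..T}" shows "exp (rate * t) \<le> 2"
proof -
  have "2 / ln 2 * (a + q) * T * ell \<le> 1" using small by (simp add: C_L_def)
  then have "rate * T \<le> ln 2" by (simp add: rate_def field_simps)
  moreover have "rate * t \<le> rate * T" using assms rate_nonneg by (intro mult_left_mono) auto
  ultimately have "exp (rate * t) \<le> exp (ln 2)" by (subst exp_le_cancel_iff) linarith
  then show ?thesis by simp
qed

text \<open>
  The number \<open>20\<close> is the coefficient \<open>5\<close> of the quadratic terms, see \<open>tuple_bound_rhs\<close>, times the square
  of the growth factor \<open>2\<close>. The inequality reads \<open>1/100 + 20/2500 \<le> 1/50\<close> after multiplication by \<open>T\<close>.
\<close>

lemma size_le: "c * ell\<^sup>2 + T * ((\<epsilon> - q\<^sup>2) * ell\<^sup>2 + 20 * radius\<^sup>2) \<le> radius"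
proof -
  have "100 * T * (c + T * (\<epsilon> - q\<^sup>2)) * ell\<^sup>2 \<le> 1" using small by (simp add: C_L_def)
  then have "(c + T * (\<epsilon> - q\<^sup>2)) * ell\<^sup>2 \<le> 1 / (100 * T)" using T_pos by (simp add: field_simps)
  moreover have "T * (20 * radius\<^sup>2) = 1 / (125 * T)"
    using T_pos by (simp add: radius_def power2_eq_square)
  moreover have "1 / (100 * T) + 1 / (125 * T) \<le> radius" using T_pos by (simp add: radius_def field_simps)
  ultimately show ?thesis by (simp add: algebra_simps)
qed

text \<open>
  The sums over the other players are full sums minus the own term. Each full sum is a multiplication by
  collected rows or columns, and each own term is a rank-one product; each of these four terms has size
  at most \<open>g * h\<close>.
\<close>

lemma tuple_bound_rhs:
  assumes G: "tuple_bound g G" and H: "tuple_bound h H" and "0 \<le> g" "0 \<le> h"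
  shows "tuple_bound ((\<epsilon> - q\<^sup>2) * ell\<^sup>2 + rate * h + 4 * g * h + h * h) (rhs G H)"
proof -
  have eq: "rhs G H = running
      + (- ((a + q) *\<^sub>R (\<chi> i. L ** H $ i)) + - ((a + q) *\<^sub>R (\<chi> i. H $ i ** L)))
      + ((- (\<chi> i. H $ i ** (\<Sum>j\<in>UNIV. ee j ** G $ j)) + (\<chi> i. H $ i ** ee i ** G $ i))
         + (- (\<chi> i. (\<Sum>j\<in>UNIV. G $ j ** ee j) ** H $ i) + (\<chi> i. G $ i ** ee i ** H $ i)))
      + (- (\<chi> i. H $ i ** ee i ** H $ i))"
    unfolding rhs_def drift_part_def cross_part_def own_part_def
    by (simp add: vec_eq_iff[of "_ + _"] sum_diff1 matrix_mult_sum_left[symmetric] matrix_bilinear matrix_mul_assoc)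
  have "tuple_bound ((\<epsilon> - q\<^sup>2) * ell\<^sup>2 + ((a + q) * (h * ell) + (a + q) * (h * ell))
      + ((h * g + h * g) + (h * g + g * h)) + h * h) (rhs G H)"
    unfolding eq
    unfolding running_def
    using assms ell_nonneg a_nonneg q_nonneg q_le
    by (intro tuple_bound_add tuple_bound_uminus tuple_bound_scale tuple_bound_mult_left
        tuple_bound_mult_right tuple_bound_rank_one_product tuple_bound_sandwich
        op_bound_rows op_bound_columns op_bound_2norm G H) auto
  then show ?thesis by (simp add: rate_def algebra_simps)
qed

text \<open>
  The set of tuples of size at most \<open>radius * exp (rate * t)\<close> is invariant under Picard iteration. The
  weight absorbs the linear terms exactly, since \<open>radius * exp (rate * t)\<close> is an antiderivative of the
  bound \<open>rate * radius * exp (rate * t)\<close> for them. The size stays at most \<open>2 * radius\<close>, so the quadratic terms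
  fit into the slack that \<open>size_le\<close> provides.
\<close>

lemma tuple_bound_invariant:
  assumes G: "continuous_on {0..T} G" "\<And>t. t \<in> {0..T} \<Longrightarrow> tuple_bound (radius * exp (rate * t)) (G t)"
    and H: "continuous_on {0..T} H" "\<And>t. t \<in> {0..T} \<Longrightarrow> tuple_bound (radius * exp (rate * t)) (H t)"
    and t: "t \<in> {0..T}"
  shows "tuple_bound (radius * exp (rate * t)) (terminal + integral {0..t} (\<lambda>s. rhs (G s) (H s)))"
proof -
  define k where "k = (\<epsilon> - q\<^sup>2) * ell\<^sup>2 + 20 * radius\<^sup>2"
  \<comment> \<open>The size of the right-hand side, with the quadratic terms bounded by their maximum.\<close>
  define \<rho> where "\<rho> s = k + radius * (rate * exp (rate * s))" for s
  have k0: "0 \<le> k" using q_le by (simp add: k_def)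
  have sub: "{0..t} \<subseteq> {0..T}" using t by auto
  have "tuple_bound (integral {0..t} \<rho>) (integral {0..t} (\<lambda>s. rhs (G s) (H s)))"
  proof (rule tuple_bound_integral)
    show "continuous_on {0..t} (\<lambda>s. rhs (G s) (H s))"
      by (intro continuous_on_rhs continuous_on_subset[OF G(1) sub] continuous_on_subset[OF H(1) sub])
    show "continuous_on {0..t} \<rho>" unfolding \<rho>_def by (intro continuous_intros)
    fix s assume "s \<in> {0..t}"
    then have s: "s \<in> {0..T}" using sub by auto
    define w where "w = exp (rate * s)"
    have w: "0 \<le> w" "w \<le> 2" using exp_rate_le[OF s] by (auto simp: w_def)
    have "w * w \<le> 2 * 2" using w by (intro mult_mono) auto
    then have "radius\<^sup>2 * (5 * (w * w)) \<le> radius\<^sup>2 * (5 * (2 * 2))" by (intro mult_left_mono) auto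
    moreover have "\<rho> s = k + radius * (rate * w)" by (simp add: \<rho>_def w_def)
    ultimately have le: "(\<epsilon> - q\<^sup>2) * ell\<^sup>2 + rate * (radius * w) + 4 * (radius * w) * (radius * w)
        + (radius * w) * (radius * w) \<le> \<rho> s"
      by (simp add: k_def power2_eq_square algebra_simps)
    show "tuple_bound (\<rho> s) (rhs (G s) (H s))"
      by (rule tuple_bound_mono[OF tuple_bound_rhs le])
         (use G(2)[OF s] H(2)[OF s] w radius_pos in \<open>auto simp: w_def\<close>)
  qed
  moreover have "tuple_bound (c * ell\<^sup>2) terminal"
    unfolding terminal_def
    by (intro tuple_bound_scale tuple_bound_sandwich op_bound_2norm c_nonneg ell_nonneg)
  ultimately have "tuple_bound (c * ell\<^sup>2 + integral {0..t} \<rho>)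
      (terminal + integral {0..t} (\<lambda>s. rhs (G s) (H s)))" by (intro tuple_bound_add)
  moreover have "c * ell\<^sup>2 + integral {0..t} \<rho> \<le> radius * exp (rate * t)"
  proof -
    have "(\<rho> has_integral (k * t + radius * exp (rate * t)) - (k * 0 + radius * exp (rate * 0))) {0..t}"
      unfolding \<rho>_def
      by (rule fundamental_theorem_of_calculus)
         (use t in \<open>auto simp flip: has_real_derivative_iff_has_vector_derivative intro!: derivative_eq_intros\<close>)
    then have "integral {0..t} \<rho> = k * t + radius * exp (rate * t) - radius"
      by (simp add: integral_unique)
    moreover have "k * t \<le> T * k" using mult_right_mono[of t T k] t k0 by (simp add: mult.commute)
    ultimately show ?thesis using size_le by (simp add: k_def)
  qed
  ultimately show ?thesis by (rule tuple_bound_mono)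
qed

lemma norm_le_of_tuple_bound:
  assumes "t \<in> {0..T}" "tuple_bound (radius * exp (rate * t)) (H :: real^'n^'n^'n)"
  shows "norm H \<le> real CARD('n) ^ 3 * (radius * 2)"
  by (rule tuple_bound_norm, rule tuple_bound_mono[OF assms(2)])
     (use exp_rate_le[OF assms(1)] radius_pos in \<open>auto intro: mult_left_mono\<close>)

lemma tuple_bound_zero: "0 \<le> r \<Longrightarrow> tuple_bound r 0"
  by (simp add: tuple_bound_def linear_0[OF linear_signed_form])

lemma bounded_flow_exists:
  assumes g: "\<And>t x. t \<in> {0..T} \<Longrightarrow> tuple_bound (radius * exp (rate * t)) x \<Longrightarrow>
                tuple_bound (radius * exp (rate * t)) (g t x)"
      "\<And>t x y. t \<in> {0..T} \<Longrightarrow> norm (g t x - g t y) \<le> norm (x - y)"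
      "\<And>x. continuous_on {0..T} x \<Longrightarrow> continuous_on {0..T} (\<lambda>t. g t (x t))"
  obtains H where "flow (\<lambda>t. g t (H t)) H"
    "\<And>t. t \<in> {0..T} \<Longrightarrow> tuple_bound (radius * exp (rate * t)) (H t)"
proof -
  define C where "C t = {H :: real^'n^'n^'n. tuple_bound (radius * exp (rate * t)) H}" for t
  obtain H where "flow (\<lambda>t. g t (H t)) H" "\<And>t. t \<in> {0..T} \<Longrightarrow> H t \<in> C t"
  proof (rule invariant_flow_exists[where C = C and b = "real CARD('n) ^ 3 * (radius * 2)"
        and g = g and ?x0.0 = 0])
    show "closed (C t)" for t unfolding C_def by (rule closed_tuple_bound)
    show "0 \<in> C t" for t using radius_pos by (simp add: C_def tuple_bound_zero)
    show "norm x \<le> real CARD('n) ^ 3 * (radius * 2)" if "t \<in> {0..T}" "x \<in> C t" for t x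
      using that by (auto simp: C_def intro: norm_le_of_tuple_bound)
  next
    fix H :: "real \<Rightarrow> real^'n^'n^'n" and t
    assume "continuous_on {0..T} H" "\<And>t. t \<in> {0..T} \<Longrightarrow> H t \<in> C t" "t \<in> {0..T}"
    then show "terminal + integral {0..t} (\<lambda>s. rhs (g s (H s)) (H s)) \<in> C t"
      using tuple_bound_invariant[of "\<lambda>t. g t (H t)" H t] g by (simp add: C_def)
  qed (use g in \<open>auto simp: C_def\<close>)
  then show thesis by (intro that) (auto simp: C_def)
qed

text \<open>
  Symmetry of the solutions is not built into the iteration. It follows from uniqueness, because
  transposition of all components maps solutions to solutions.
\<close>

definition tr :: "real^'n^'n^'n \<Rightarrow> real^'n^'n^'n" where
  "tr H = (\<chi> i. transpose (H $ i))"

lemma bounded_linear_tr: "bounded_linear tr"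
  unfolding linear_conv_bounded_linear[symmetric]
  by (rule linearI) (auto simp: tr_def vec_eq_iff transpose_def)

lemma tr_rhs: "tr (rhs G H) = rhs (tr G) (tr H)"
proof -
  have t: "transpose (A + B) = transpose A + transpose B" "transpose (A - B) = transpose A - transpose B"
    "transpose (- A) = - transpose A" "transpose (k *\<^sub>R A) = k *\<^sub>R transpose A"
    for A B :: "real^'n^'n" and k :: real
    by (auto simp: transpose_def vec_eq_iff)
  have r: "running $ i = (\<epsilon> - q\<^sup>2) *\<^sub>R (L ** ee i ** L)" for i by (simp add: running_def)
  show ?thesis
    unfolding vec_eq_iff[of "tr _"]
    by (simp add: tr_def rhs_def drift_part_def cross_part_def own_part_def r t
        matrix_transpose_mul transpose_ee L_sym transpose_sum matrix_mul_assoc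
        matrix_mult_sum_left matrix_mult_sum_right)
qed

lemma tr_terminal: "tr terminal = terminal"
  by (simp add: tr_def terminal_def transpose_scalar matrix_transpose_mul
      transpose_ee L_sym matrix_mul_assoc) (simp add: vec_eq_iff)

lemma tr_flow:
  assumes "flow G H" "continuous_on {0..T} G"
  shows "flow (\<lambda>t. tr (G t)) (\<lambda>t. tr (H t))"
proof -
  have c: "continuous_on {0..T} (\<lambda>t. tr (G t))"
    by (rule bounded_linear.continuous_on[OF bounded_linear_tr assms(2)])
  have H: "H 0 = terminal" "\<forall>t\<in>{0..T}. (H has_vector_derivative rhs (G t) (H t)) (at t within {0..T})"
    using assms flow_iff_derivative by blast+
  show ?thesis
    unfolding flow_iff_derivative[OF c]
  proof (intro conjI ballI)
    show "tr (H 0) = terminal" by (simp add: H(1) tr_terminal)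
    fix t assume "t \<in> {0..T}"
    then have "(H has_vector_derivative rhs (G t) (H t)) (at t within {0..T})" using H(2) by blast
    then show "((\<lambda>t. tr (H t)) has_vector_derivative rhs (tr (G t)) (tr (H t))) (at t within {0..T})"
      unfolding tr_rhs[symmetric] by (rule bounded_linear.has_vector_derivative[OF bounded_linear_tr])
  qed
qed

lemma flow_cong:
  assumes "flow G H" "\<And>t. t \<in> {0..T} \<Longrightarrow> G t = G' t" "\<And>t. t \<in> {0..T} \<Longrightarrow> H t = H' t"
  shows "flow G' H'"
proof -
  have "continuous_on {0..T} H" using assms(1) unfolding flow_def by blast
  then have "continuous_on {0..T} H'" by (rule continuous_on_eq) (rule assms(3))
  moreover have "H' t = terminal + integral {0..t} (\<lambda>s. rhs (G' s) (H' s))" if t: "t \<in> {0..T}" for t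
  proof -
    have "integral {0..t} (\<lambda>s. rhs (G s) (H s)) = integral {0..t} (\<lambda>s. rhs (G' s) (H' s))"
      by (rule integral_cong) (use assms t in auto)
    moreover have "H t = terminal + integral {0..t} (\<lambda>s. rhs (G s) (H s))"
      using assms(1) t unfolding flow_def by blast
    ultimately show ?thesis using assms(3)[OF t] by simp
  qed
  ultimately show ?thesis unfolding flow_def by blast
qed

lemma transpose_fixed_stage:
  assumes "flow G H" "continuous_on {0..T} G" "\<And>t. t \<in> {0..T} \<Longrightarrow> tr (G t) = G t" "t \<in> {0..T}"
  shows "tr (H t) = H t"
proof (rule flow_unique[OF _ assms(1,2,4)])
  show "flow G (\<lambda>t. tr (H t))"
    by (rule flow_cong[OF tr_flow[OF assms(1,2)]]) (use assms(3) in auto)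
qed

lemma transpose_fixed_equilibrium:
  assumes "flow H H" "t \<in> {0..T}"
  shows "tr (H t) = H t"
proof (rule diagonal_flow_unique[OF _ assms])
  show "flow (\<lambda>t. tr (H t)) (\<lambda>t. tr (H t))"
    by (rule tr_flow[OF assms(1)]) (use assms(1) in \<open>simp add: flow_def\<close>)
qed

text \<open>
  Time reversal turns the terminal conditions of the Riccati equations into initial conditions.
\<close>

definition profile :: "('n \<Rightarrow> real \<Rightarrow> real^'n^'n) \<Rightarrow> real \<Rightarrow> real^'n^'n^'n" where
  "profile F s = (\<chi> i. F i (T - s))"

lemma profile_derivative:
  assumes s: "s \<in> {0..T}"
  shows "(profile H has_vector_derivative D) (at s within {0..T}) \<longleftrightarrow>
    (\<forall>i. (H i has_vector_derivative - (D $ i)) (at (T - s) within {0..T}))"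
proof
  assume P: "(profile H has_vector_derivative D) (at s within {0..T})"
  show "\<forall>i. (H i has_vector_derivative - (D $ i)) (at (T - s) within {0..T})"
  proof
    fix i
    have "((\<lambda>s. profile H s $ i) has_vector_derivative D $ i) (at s within {0..T})"
      by (rule bounded_linear.has_vector_derivative[OF bounded_linear_vec_nth P])
    then have "((\<lambda>s. H i (T - s)) has_vector_derivative D $ i) (at (T - (T - s)) within {0..T})"
      by (simp add: profile_def)
    from has_vector_derivative_reverse[OF this]
    show "(H i has_vector_derivative - (D $ i)) (at (T - s) within {0..T})" by simp
  qed
next
  assume "\<forall>i. (H i has_vector_derivative - (D $ i)) (at (T - s) within {0..T})"
  then have "((\<lambda>s. H i (T - s)) has_vector_derivative - (- (D $ i))) (at s within {0..T})" for i
    by (intro has_vector_derivative_reverse) blast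
  then have "((\<lambda>s. \<chi> i. H i (T - s)) has_vector_derivative (\<chi> i. - (- (D $ i)))) (at s within {0..T})"
    by (rule has_vector_derivative_vec_lambda)
  then show "(profile H has_vector_derivative D) (at s within {0..T})"
    by (simp add: profile_def[abs_def])
qed

lemma rhs_component:
  "rhs G H $ i = (\<epsilon> - q\<^sup>2) *\<^sub>R (L ** ee i ** L) - (a + q) *\<^sub>R (L ** H $ i) - (a + q) *\<^sub>R (H $ i ** L)
     - H $ i ** (\<Sum>j\<in>UNIV - {i}. ee j ** G $ j) - (\<Sum>j\<in>UNIV - {i}. G $ j ** ee j ** H $ i)
     - H $ i ** ee i ** H $ i"
proof -
  have r: "running $ i = (\<epsilon> - q\<^sup>2) *\<^sub>R (L ** ee i ** L)" by (simp add: running_def)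
  show ?thesis
    by (simp add: rhs_def drift_part_def cross_part_def own_part_def r)
qed

lemma reverse_interval: "(\<forall>t\<in>{0..T}. P (T - t)) \<longleftrightarrow> (\<forall>t\<in>{0..T}. P t)"
proof
  assume P: "\<forall>t\<in>{0..T}. P (T - t)"
  show "\<forall>t\<in>{0..T}. P t"
  proof
    fix t assume "t \<in> {0..T}"
    then have "T - t \<in> {0..T}" by auto
    with P have "P (T - (T - t))" by blast
    then show "P t" by simp
  qed
qed auto

lemma profile_terminal: "profile H 0 = terminal \<longleftrightarrow> (\<forall>i. H i T = c *\<^sub>R (L ** ee i ** L))"
  by (simp add: profile_def terminal_def vec_eq_iff[of "\<chi> i. H i T"])

lemma best_response_iff_flow:
  assumes G: "continuous_on {0..T} (profile G)"
  shows "(\<forall>i. solves_best_response_riccati T a q \<epsilon> c L G i (H i)) \<longleftrightarrow>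
    (\<forall>i. \<forall>t\<in>{0..T}. symmetric_matrix (H i t)) \<and> flow (profile G) (profile H)"
proof -
  have eq: "(\<exists>H'. (H i has_vector_derivative H') (at t within {0..T}) \<and>
        H' - H i t ** ee i ** H i t + (\<epsilon> - q\<^sup>2) *\<^sub>R (L ** ee i ** L)
           - (a + q) *\<^sub>R (L ** H i t) - (a + q) *\<^sub>R (H i t ** L)
           - H i t ** (\<Sum>j\<in>UNIV - {i}. ee j ** G j t)
           - (\<Sum>j\<in>UNIV - {i}. G j t ** ee j ** H i t) = 0)
     \<longleftrightarrow> (H i has_vector_derivative - (rhs (profile G (T - t)) (profile H (T - t)) $ i)) (at t within {0..T})"
    for i t
  proof -
    have "(H' - H i t ** ee i ** H i t + (\<epsilon> - q\<^sup>2) *\<^sub>R (L ** ee i ** L)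
           - (a + q) *\<^sub>R (L ** H i t) - (a + q) *\<^sub>R (H i t ** L)
           - H i t ** (\<Sum>j\<in>UNIV - {i}. ee j ** G j t)
           - (\<Sum>j\<in>UNIV - {i}. G j t ** ee j ** H i t) = 0)
      \<longleftrightarrow> H' = - (rhs (profile G (T - t)) (profile H (T - t)) $ i)" for H'
      unfolding rhs_component by (auto simp: profile_def algebra_simps)
    then show ?thesis by auto
  qed
  have "flow (profile G) (profile H) \<longleftrightarrow> profile H 0 = terminal \<and>
     (\<forall>t\<in>{0..T}. (profile H has_vector_derivative rhs (profile G t) (profile H t)) (at t within {0..T}))"
    by (rule flow_iff_derivative[OF G])
  also have "\<dots> \<longleftrightarrow> profile H 0 = terminal \<and>
     (\<forall>t\<in>{0..T}. \<forall>i. (H i has_vector_derivative - (rhs (profile G t) (profile H t) $ i)) (at (T - t) within {0..T}))"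
    by (simp only: profile_derivative cong: ball_cong)
  also have "\<dots> \<longleftrightarrow> profile H 0 = terminal \<and>
     (\<forall>t\<in>{0..T}. \<forall>i. (H i has_vector_derivative - (rhs (profile G (T - t)) (profile H (T - t)) $ i)) (at t within {0..T}))"
    by (subst reverse_interval[symmetric]) simp
  finally show ?thesis
    unfolding solves_best_response_riccati_def eq profile_terminal by blast
qed

text \<open>
  Separating the own term \<open>F\<^sub>i e\<^sub>i e\<^sub>i\<^sup>T F\<^sub>i\<close> from the two sums over all players shows that the coupled system
  is the best-response equation for \<open>G = H = F\<close>. Since the vectors \<open>e\<^sub>j\<close> form a basis, the sums over \<open>j\<close>
  of the terms with \<open>L\<close> are multiples of \<open>L F\<^sub>i\<close> and \<open>F\<^sub>i L\<close>.
\<close>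

lemma coupled_iff_flow:
  "solves_coupled_riccati T a q \<epsilon> c L F \<longleftrightarrow>
    (\<forall>i. \<forall>t\<in>{0..T}. symmetric_matrix (F i t)) \<and> flow (profile F) (profile F)"
proof -
  have eq: "(\<exists>F'. (F i has_vector_derivative F') (at t within {0..T}) \<and>
             F' + (\<Sum>j\<in>UNIV. (- ((a + q) *\<^sub>R L) - F j t) ** ee j ** F i t)
                + (\<Sum>j\<in>UNIV. F i t ** ee j ** (- ((a + q) *\<^sub>R L) - F j t))
                + (\<epsilon> - q\<^sup>2) *\<^sub>R (L ** ee i ** L)
                + F i t ** ee i ** F i t = 0)
     \<longleftrightarrow> (F i has_vector_derivative - (rhs (profile F (T - t)) (profile F (T - t)) $ i)) (at t within {0..T})"
    for i t
  proof -
    have s1: "(\<Sum>j\<in>UNIV. (- ((a + q) *\<^sub>R L) - F j t) ** ee j ** F i t)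
        = - ((a + q) *\<^sub>R (L ** F i t)) - (\<Sum>j\<in>UNIV - {i}. F j t ** ee j ** F i t) - F i t ** ee i ** F i t"
    proof -
      have "(\<Sum>j\<in>UNIV. (- ((a + q) *\<^sub>R L) - F j t) ** ee j ** F i t)
          = - ((a + q) *\<^sub>R (\<Sum>j\<in>UNIV. L ** ee j ** F i t)) - (\<Sum>j\<in>UNIV. F j t ** ee j ** F i t)"
        by (simp add: matrix_bilinear sum_subtractf sum_negf scaleR_sum_right)
      also have "(\<Sum>j\<in>UNIV. L ** ee j ** F i t) = L ** F i t"
        by (simp add: matrix_mult_sum_left[symmetric] matrix_mult_sum_right[symmetric] sum_ee)
      finally show ?thesis by (simp add: sum.remove[of UNIV i])
    qed
    have s2: "(\<Sum>j\<in>UNIV. F i t ** ee j ** (- ((a + q) *\<^sub>R L) - F j t))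
        = - ((a + q) *\<^sub>R (F i t ** L)) - F i t ** (\<Sum>j\<in>UNIV - {i}. ee j ** F j t) - F i t ** ee i ** F i t"
    proof -
      have "(\<Sum>j\<in>UNIV. F i t ** ee j ** (- ((a + q) *\<^sub>R L) - F j t))
          = - ((a + q) *\<^sub>R (\<Sum>j\<in>UNIV. F i t ** ee j ** L)) - (\<Sum>j\<in>UNIV. F i t ** ee j ** F j t)"
        by (simp add: matrix_bilinear sum_subtractf sum_negf scaleR_sum_right)
      also have "(\<Sum>j\<in>UNIV. F i t ** ee j ** L) = F i t ** L"
        by (simp add: matrix_mult_sum_left[symmetric] matrix_mult_sum_right[symmetric] sum_ee)
      finally show ?thesis by (simp add: sum.remove[of UNIV i] matrix_mult_sum_right matrix_mul_assoc)
    qed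
    have "(F' + (\<Sum>j\<in>UNIV. (- ((a + q) *\<^sub>R L) - F j t) ** ee j ** F i t)
                + (\<Sum>j\<in>UNIV. F i t ** ee j ** (- ((a + q) *\<^sub>R L) - F j t))
                + (\<epsilon> - q\<^sup>2) *\<^sub>R (L ** ee i ** L)
                + F i t ** ee i ** F i t = 0)
      \<longleftrightarrow> F' = - (rhs (profile F (T - t)) (profile F (T - t)) $ i)" for F'
      unfolding rhs_component s1 s2 by (auto simp: profile_def algebra_simps)
    then show ?thesis by auto
  qed
  have *: "solves_coupled_riccati T a q \<epsilon> c L F \<longleftrightarrow> 
    (\<forall>i. \<forall>t\<in>{0..T}. symmetric_matrix (F i t)) \<and> profile F 0 = terminal \<and>
    (\<forall>t\<in>{0..T}. \<forall>i. (F i has_vector_derivative - (rhs (profile F (T - t)) (profile F (T - t)) $ i)) (at t within {0..T}))"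
    unfolding solves_coupled_riccati_def eq profile_terminal by blast
  have "(\<forall>t\<in>{0..T}. \<forall>i. (F i has_vector_derivative - (rhs (profile F (T - t)) (profile F (T - t)) $ i)) (at t within {0..T}))
    \<longleftrightarrow> (\<forall>t\<in>{0..T}. \<forall>i. (F i has_vector_derivative - (rhs (profile F t) (profile F t) $ i)) (at (T - t) within {0..T}))"
    by (subst reverse_interval[symmetric]) simp
  also have "\<dots> \<longleftrightarrow> (\<forall>t\<in>{0..T}. (profile F has_vector_derivative rhs (profile F t) (profile F t)) (at t within {0..T}))"
    by (simp only: profile_derivative cong: ball_cong)
  finally have d: "(\<forall>t\<in>{0..T}. \<forall>i. (F i has_vector_derivative - (rhs (profile F (T - t)) (profile F (T - t)) $ i)) (at t within {0..T}))
    \<longleftrightarrow> (\<forall>t\<in>{0..T}. (profile F has_vector_derivative rhs (profile F t) (profile F t)) (at t within {0..T}))" .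
  have "flow (profile F) (profile F) \<longleftrightarrow> profile F 0 = terminal \<and>
     (\<forall>t\<in>{0..T}. (profile F has_vector_derivative rhs (profile F t) (profile F t)) (at t within {0..T}))"
  proof (cases "continuous_on {0..T} (profile F)")
    case True
    then show ?thesis by (rule flow_iff_derivative)
  next
    case False
    moreover have "continuous_on {0..T} (profile F)"
      if "\<forall>t\<in>{0..T}. (profile F has_vector_derivative rhs (profile F t) (profile F t)) (at t within {0..T})"
      using that by (auto intro: continuous_on_vector_derivative)
    ultimately show ?thesis unfolding flow_def by blast
  qed
  with * d show ?thesis by blast
qed

lemma transpose_fixed_iff: "tr H = H \<longleftrightarrow> (\<forall>i. symmetric_matrix (H $ i))"
  by (simp add: tr_def symmetric_matrix_def vec_eq_iff[of "\<chi> i. transpose (H $ i)"])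

lemma fictitious_flows_exist:
  obtains \<Phi> where "\<Phi> 0 = (\<lambda>_. 0)" "\<And>k. flow (\<Phi> k) (\<Phi> (Suc k))" "\<And>k. continuous_on {0..T} (\<Phi> k)"
    "\<And>k t. t \<in> {0..T} \<Longrightarrow> tuple_bound (radius * exp (rate * t)) (\<Phi> k t)"
    "\<And>k t. t \<in> {0..T} \<Longrightarrow> tr (\<Phi> k t) = \<Phi> k t"
proof -
  define ok where "ok x \<longleftrightarrow> continuous_on {0..T} x \<and>
    (\<forall>t\<in>{0..T}. tuple_bound (radius * exp (rate * t)) (x t)) \<and> (\<forall>t\<in>{0..T}. tr (x t) = x t)"
    for x :: "real \<Rightarrow> real^'n^'n^'n"
  have z: "ok (\<lambda>_. 0)"
    using radius_pos linear_0[OF bounded_linear.linear[OF bounded_linear_tr]]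
    by (simp add: ok_def tuple_bound_zero)
  have step: "\<exists>y. ok y \<and> flow x y" if x: "ok x" for x
  proof -
    have c: "continuous_on {0..T} x" using x by (simp add: ok_def)
    have b: "\<And>t. t \<in> {0..T} \<Longrightarrow> tuple_bound (radius * exp (rate * t)) (x t)" using x by (simp add: ok_def)
    obtain y where y: "flow x y" "\<And>t. t \<in> {0..T} \<Longrightarrow> tuple_bound (radius * exp (rate * t)) (y t)"
      using bounded_flow_exists[of "\<lambda>t _. x t"] c b by auto
    moreover have "tr (y t) = y t" if "t \<in> {0..T}" for t
      using transpose_fixed_stage[OF y(1) c _ that] x by (simp add: ok_def)
    moreover have "continuous_on {0..T} y" using y(1) by (simp add: flow_def)
    ultimately show ?thesis by (auto simp: ok_def)
  qed
  \<comment> \<open>The condition at \<open>k = 0\<close> fixes the starting point of the sequence.\<close>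
  have "\<exists>\<Phi>. \<forall>k. (ok (\<Phi> k) \<and> (k = 0 \<longrightarrow> \<Phi> k = (\<lambda>_. 0))) \<and> flow (\<Phi> k) (\<Phi> (Suc k))"
    by (rule dependent_nat_choice) (use z step in auto)
  then obtain \<Phi> where "\<And>k. (ok (\<Phi> k) \<and> (k = 0 \<longrightarrow> \<Phi> k = (\<lambda>_. 0))) \<and> flow (\<Phi> k) (\<Phi> (Suc k))"
    by blast
  then show thesis by (intro that[of \<Phi>]) (auto simp: ok_def)
qed

lemma fictitious_play_exists: "\<exists>F. fictitious_play_from_zero T a q \<epsilon> c L F"
proof -
  obtain \<Phi> where \<Phi>: "\<Phi> 0 = (\<lambda>_. 0)" "\<And>k. flow (\<Phi> k) (\<Phi> (Suc k))" "\<And>k. continuous_on {0..T} (\<Phi> k)"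
    "\<And>k t. t \<in> {0..T} \<Longrightarrow> tr (\<Phi> k t) = \<Phi> k t"
    using fictitious_flows_exist by metis
  define F where "F k i t = \<Phi> k (T - t) $ i" for k i t
  have p: "profile (F k) = \<Phi> k" for k by (rule ext) (simp add: profile_def F_def)
  have "symmetric_matrix (F k i t)" if "t \<in> {0..T}" for k i t
    using \<Phi>(4)[of "T - t" k] that by (auto simp: transpose_fixed_iff F_def)
  then have "\<forall>i. solves_best_response_riccati T a q \<epsilon> c L (F k) i (F (Suc k) i)" for k
    using \<Phi>(2,3) best_response_iff_flow[of "F k" "F (Suc k)"] by (simp add: p)
  moreover have "F 0 i t = 0" for i t by (simp add: F_def \<Phi>)
  ultimately have "fictitious_play_from_zero T a q \<epsilon> c L F"
    unfolding fictitious_play_from_zero_def by blast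
  then show ?thesis by blast
qed

text \<open>
  Uniqueness at every stage identifies an arbitrary solution of the fictitious-play equations with the
  bounded one that Picard iteration produces, so the uniform bound holds for it as well.
\<close>

lemma fictitious_play_converges:
  obtains Finf where "solves_coupled_riccati T a q \<epsilon> c L Finf"
    "\<And>G i t. solves_coupled_riccati T a q \<epsilon> c L G \<Longrightarrow> t \<in> {0..T} \<Longrightarrow> G i t = Finf i t"
    "\<And>F i t. fictitious_play_from_zero T a q \<epsilon> c L F \<Longrightarrow> t \<in> {0..T} \<Longrightarrow> (\<lambda>k. F k i t) \<longlonglongrightarrow> Finf i t"
proof -
  obtain \<Phi> where \<Phi>: "\<Phi> 0 = (\<lambda>_. 0)" "\<And>k. flow (\<Phi> k) (\<Phi> (Suc k))" "\<And>k. continuous_on {0..T} (\<Phi> k)"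
    "\<And>k t. t \<in> {0..T} \<Longrightarrow> tuple_bound (radius * exp (rate * t)) (\<Phi> k t)"
    using fictitious_flows_exist by metis
  obtain H where H: "flow H H" "\<And>t. t \<in> {0..T} \<Longrightarrow> tuple_bound (radius * exp (rate * t)) (H t)"
    using bounded_flow_exists[of "\<lambda>_ x. x"] by auto
  define Finf where "Finf i t = H (T - t) $ i" for i t
  have p: "profile Finf = H" by (rule ext) (simp add: profile_def Finf_def)
  have conv: "(\<lambda>k. \<Phi> k t) \<longlonglongrightarrow> H t" if t: "t \<in> {0..T}" for t
    by (rule flow_iterates_converge[where F = \<Phi> and b = "real CARD('n) ^ 3 * (radius * 2)"])
       (use \<Phi> H t norm_le_of_tuple_bound in auto)
  show thesis
  proof (rule that[of Finf])
    have "symmetric_matrix (Finf i t)" if "t \<in> {0..T}" for i t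
      using transpose_fixed_equilibrium[OF H(1), of "T - t"] that by (auto simp: transpose_fixed_iff Finf_def)
    then show "solves_coupled_riccati T a q \<epsilon> c L Finf"
      unfolding coupled_iff_flow p using H(1) by blast
  next
    fix G i t assume "solves_coupled_riccati T a q \<epsilon> c L G" and t: "t \<in> {0..T}"
    then have "flow (profile G) (profile G)" unfolding coupled_iff_flow by blast
    then have "profile G (T - t) = H (T - t)" using diagonal_flow_unique[OF _ H(1)] t by auto
    then have "profile G (T - t) $ i = H (T - t) $ i" by simp
    then show "G i t = Finf i t" by (simp add: profile_def Finf_def)
  next
    fix F :: "nat \<Rightarrow> 'n \<Rightarrow> real \<Rightarrow> real^'n^'n" and i t
    assume F: "fictitious_play_from_zero T a q \<epsilon> c L F" and t: "t \<in> {0..T}"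
    have br: "\<forall>i. solves_best_response_riccati T a q \<epsilon> c L (F k) i (F (Suc k) i)" for k
      using F by (simp add: fictitious_play_from_zero_def)
    have eq: "profile (F k) s = \<Phi> k s" if "s \<in> {0..T}" for k s
      using that
    proof (induction k arbitrary: s)
      case 0
      then have "T - s \<in> {0..T}" by auto
      then have "F 0 i (T - s) = 0" for i using F unfolding fictitious_play_from_zero_def by blast
      then show ?case by (simp add: profile_def \<Phi>(1) vec_eq_iff)
    next
      case (Suc k)
      have "continuous_on {0..T} (profile (F k))"
        by (rule continuous_on_eq[OF \<Phi>(3)[of k]]) (use Suc.IH in auto)
      then have "flow (profile (F k)) (profile (F (Suc k)))"
        using br best_response_iff_flow by blast
      then have "flow (\<Phi> k) (profile (F (Suc k)))" by (rule flow_cong) (use Suc.IH in auto)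
      then show ?case using flow_unique[OF _ \<Phi>(2,3) Suc.prems] by blast
    qed
    have t': "T - t \<in> {0..T}" using t by auto
    have "(\<lambda>k. \<Phi> k (T - t) $ i) \<longlonglongrightarrow> H (T - t) $ i" by (intro tendsto_vec_nth conv t')
    moreover have "\<Phi> k (T - t) $ i = F k i t" for k
      using eq[OF t', of k] by (simp add: profile_def vec_eq_iff[of "\<chi> i. F k i t"])
    ultimately show "(\<lambda>k. F k i t) \<longlonglongrightarrow> Finf i t" by (simp add: Finf_def)
  qed
qed

end

section \<open>Integration by parts without continuity\<close>

lemma set_integrable_scaleR_bounded_bilinear:
  fixes pr :: "'a::{banach,second_countable_topology} \<Rightarrow> 'b::{banach,second_countable_topology} \<Rightarrow> 'c::{banach,second_countable_topology}"
  assumes "bounded_bilinear pr"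
  shows "pr (indicator A x *\<^sub>R u) v = indicator A x *\<^sub>R pr u v" "pr u (indicator A x *\<^sub>R v) = indicator A x *\<^sub>R pr u v"
  using assms by (auto simp: indicator_def bounded_bilinear.zero_left bounded_bilinear.zero_right)

lemma bounded_bilinear_measurable:
  fixes pr :: "'a::{banach,second_countable_topology} \<Rightarrow> 'b::{banach,second_countable_topology} \<Rightarrow> 'c::{banach,second_countable_topology}"
  assumes "bounded_bilinear pr" "f \<in> borel_measurable M" "g \<in> borel_measurable M"
  shows "(\<lambda>x. pr (f x) (g x)) \<in> borel_measurable M"
  using assms(2,3)
  by (rule borel_measurable_continuous_Pair)
     (intro bounded_bilinear.continuous_on[OF assms(1)] continuous_intros)

text \<open>
  Fubini's theorem for \<open>pr (f r) (g s)\<close> on the plane, cut along the diagonal: one half is integrated over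
  \<open>s\<close> first, the other half over \<open>r\<close> first.
\<close>

lemma integration_by_parts_lborel:
  fixes pr :: "'a::{banach,second_countable_topology} \<Rightarrow> 'b::{banach,second_countable_topology} \<Rightarrow> 'c::{banach,second_countable_topology}"
    and f :: "real \<Rightarrow> 'a" and g :: "real \<Rightarrow> 'b"
  assumes pr: "bounded_bilinear pr" and f: "integrable lborel f" and g: "integrable lborel g"
  shows "integrable lborel (\<lambda>r. pr (f r) (LBINT s:{..r}. g s))"
    and "integrable lborel (\<lambda>s. pr (LBINT r:{..s}. f r) (g s))"
    and "pr (\<integral>r. f r \<partial>lborel) (\<integral>s. g s \<partial>lborel) =
      (\<integral>r. pr (f r) (LBINT s:{..r}. g s) \<partial>lborel) + (\<integral>s. pr (LBINT r:{..s}. f r) (g s) \<partial>lborel)"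
proof -
  obtain K where K: "0 < K" "\<And>x y. norm (pr x y) \<le> norm x * norm y * K"
    using bounded_bilinear.pos_bounded[OF pr] by blast
  have [measurable]: "f \<in> borel_measurable borel" "g \<in> borel_measurable borel" using f g by auto
  define k where "k = (\<lambda>(r, s). pr (f r) (g s))"
  have km: "k \<in> borel_measurable (lborel \<Otimes>\<^sub>M lborel)"
    unfolding k_def split_beta by (intro bounded_bilinear_measurable[OF pr]) auto
  have pr_int_right: "(\<integral>s. pr x (h s) \<partial>lborel) = pr x (\<integral>s. h s \<partial>lborel)" "integrable lborel (\<lambda>s. pr x (h s))"
    if "integrable lborel h" for x h
    using integral_bounded_linear[OF bounded_bilinear.bounded_linear_right[OF pr] that]
      integrable_bounded_linear[OF bounded_bilinear.bounded_linear_right[OF pr] that] by auto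
  have pr_int_left: "(\<integral>s. pr (h s) x \<partial>lborel) = pr (\<integral>s. h s \<partial>lborel) x" "integrable lborel (\<lambda>s. pr (h s) x)"
    if "integrable lborel h" for x h
    using integral_bounded_linear[OF bounded_bilinear.bounded_linear_left[OF pr] that]
      integrable_bounded_linear[OF bounded_bilinear.bounded_linear_left[OF pr] that] by auto
  have ki: "integrable (lborel \<Otimes>\<^sub>M lborel) k"
  proof (rule lborel_pair.Fubini_integrable[OF km])
    show "AE r in lborel. integrable lborel (\<lambda>s. k (r, s))"
      using pr_int_right(2)[OF g] by (simp add: k_def)
    have "integrable lborel (\<lambda>r. norm (f r) * ((\<integral>s. norm (g s) \<partial>lborel) * K))"
      using f by (intro integrable_mult_left integrable_norm)
    then show "integrable lborel (\<lambda>r. \<integral>s. norm (k (r, s)) \<partial>lborel)"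
    proof (rule Bochner_Integration.integrable_bound)
      show "(\<lambda>r. \<integral>s. norm (k (r, s)) \<partial>lborel) \<in> borel_measurable lborel"
        using km by (intro lborel.borel_measurable_lebesgue_integral) (simp add: split_beta)
      show "AE r in lborel. norm (\<integral>s. norm (k (r, s)) \<partial>lborel) \<le>
          norm (norm (f r) * ((\<integral>s. norm (g s) \<partial>lborel) * K))"
      proof (rule AE_I2)
        fix r
        have "(\<integral>s. norm (k (r, s)) \<partial>lborel) \<le> (\<integral>s. norm (f r) * (norm (g s) * K) \<partial>lborel)"
        proof (rule integral_mono)
          show "integrable lborel (\<lambda>s. norm (k (r, s)))"
            unfolding k_def by (simp add: pr_int_right(2)[OF g])
          show "integrable lborel (\<lambda>s. norm (f r) * (norm (g s) * K))" using g by simp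
        qed (use K in \<open>auto simp: k_def mult.assoc[symmetric]\<close>)
        also have "\<dots> = norm (f r) * ((\<integral>s. norm (g s) \<partial>lborel) * K)" by simp
        finally show "norm (\<integral>s. norm (k (r, s)) \<partial>lborel) \<le>
          norm (norm (f r) * ((\<integral>s. norm (g s) \<partial>lborel) * K))"
          by (simp add: integral_nonneg_AE)
      qed
    qed
  qed
  have m1: "{p :: real \<times> real. snd p \<le> fst p} \<in> sets (lborel \<Otimes>\<^sub>M lborel)"
  proof -
    have "{p \<in> space (lborel \<Otimes>\<^sub>M lborel). snd p \<le> (fst p :: real)} \<in> sets (lborel \<Otimes>\<^sub>M lborel)"
      by measurable
    then show ?thesis by (simp add: space_pair_measure)
  qed
  \<comment> \<open>The two halves of the plane, with the diagonal in the first one.\<close>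
  define k1 where "k1 p = indicator {p. snd p \<le> fst p} p *\<^sub>R k p" for p
  define k2 where "k2 p = indicator (- {p. snd p \<le> fst p}) p *\<^sub>R k p" for p
  have m2: "- {p :: real \<times> real. snd p \<le> fst p} \<in> sets (lborel \<Otimes>\<^sub>M lborel)"
    using sets.compl_sets[OF m1] by (simp add: space_pair_measure Compl_eq_Diff_UNIV)
  have k1i: "integrable (lborel \<Otimes>\<^sub>M lborel) k1" unfolding k1_def
    by (rule integrable_mult_indicator[OF m1 ki])
  have k2i: "integrable (lborel \<Otimes>\<^sub>M lborel) k2" unfolding k2_def
    by (rule integrable_mult_indicator[OF m2 ki])
  have sum: "k p = k1 p + k2 p" for p by (auto simp: k1_def k2_def indicator_def)
  have in1: "(\<integral>s. k1 (r, s) \<partial>lborel) = pr (f r) (LBINT s:{..r}. g s)" for r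
  proof -
    have "k1 (r, s) = pr (f r) (indicator {..r} s *\<^sub>R g s)" for s
      by (auto simp: k1_def k_def indicator_def bounded_bilinear.zero_right[OF pr])
    then show ?thesis
      by (simp add: pr_int_right(1) integrable_mult_indicator g set_lebesgue_integral_def)
  qed
  have in2: "(\<integral>r. k2 (r, s) \<partial>lborel) = pr (LBINT r:{..s}. f r) (g s)" for s
  proof -
    have "k2 (r, s) = pr (indicator {..<s} r *\<^sub>R f r) (g s)" for r
      by (auto simp: k2_def k_def indicator_def bounded_bilinear.zero_left[OF pr])
    then have "(\<integral>r. k2 (r, s) \<partial>lborel) = pr (LBINT r:{..<s}. f r) (g s)"
      by (simp add: pr_int_left(1) integrable_mult_indicator f set_lebesgue_integral_def)
    \<comment> \<open>A single point is a null set.\<close>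
    also have "(LBINT r:{..<s}. f r) = (LBINT r:{..s}. f r)"
      unfolding set_lebesgue_integral_def
    proof (rule integral_cong_AE)
      show "AE x in lborel. indicator {..<s} x *\<^sub>R f x = indicator {..s} x *\<^sub>R f x"
        using AE_lborel_singleton[of s] by eventually_elim (auto simp: indicator_def)
    qed auto
    finally show ?thesis .
  qed
  show "integrable lborel (\<lambda>r. pr (f r) (LBINT s:{..r}. g s))"
    using lborel_pair.integrable_fst[of "\<lambda>r s. k1 (r, s)"] k1i by (simp add: in1 split_beta)
  show "integrable lborel (\<lambda>s. pr (LBINT r:{..s}. f r) (g s))"
    using lborel_pair.integrable_snd[of "\<lambda>r s. k2 (r, s)"] k2i by (simp add: in2 split_beta)
  have "pr (\<integral>r. f r \<partial>lborel) (\<integral>s. g s \<partial>lborel) = (\<integral>r. (\<integral>s. k (r, s) \<partial>lborel) \<partial>lborel)"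
    by (simp add: k_def pr_int_right(1)[OF g] pr_int_left(1)[OF f])
  also have "\<dots> = (\<integral>p. k p \<partial>(lborel \<Otimes>\<^sub>M lborel))"
    using lborel_pair.integral_fst'[OF ki] by simp
  also have "\<dots> = (\<integral>p. k1 p \<partial>(lborel \<Otimes>\<^sub>M lborel)) + (\<integral>p. k2 p \<partial>(lborel \<Otimes>\<^sub>M lborel))"
    unfolding sum by (rule Bochner_Integration.integral_add[OF k1i k2i])
  also have "(\<integral>p. k1 p \<partial>(lborel \<Otimes>\<^sub>M lborel)) = (\<integral>r. pr (f r) (LBINT s:{..r}. g s) \<partial>lborel)"
    using lborel_pair.integral_fst'[OF k1i] by (simp add: in1)
  also have "(\<integral>p. k2 p \<partial>(lborel \<Otimes>\<^sub>M lborel)) = (\<integral>s. pr (LBINT r:{..s}. f r) (g s) \<partial>lborel)"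
    using lborel_pair.integral_snd[of "\<lambda>r s. k2 (r, s)"] k2i by (simp add: in2 split_beta)
  finally show "pr (\<integral>r. f r \<partial>lborel) (\<integral>s. g s \<partial>lborel) =
      (\<integral>r. pr (f r) (LBINT s:{..r}. g s) \<partial>lborel) + (\<integral>s. pr (LBINT r:{..s}. f r) (g s) \<partial>lborel)" .
qed

text \<open>
  The states are absolutely continuous in time, up to the noise, but controls are merely integrable. The
  relation to the derivative is therefore kept in integrated form.
\<close>

definition primitive_on :: "real \<Rightarrow> (real \<Rightarrow> 'a::{banach,second_countable_topology}) \<Rightarrow> (real \<Rightarrow> 'a) \<Rightarrow> bool" where
  "primitive_on T u u' \<longleftrightarrow> set_integrable lborel {0..T} u' \<and>
     (\<forall>t\<in>{0..T}. u t = u 0 + (LBINT s:{0..t}. u' s))"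

lemma primitive_onD:
  assumes "primitive_on T u u'" "t \<in> {0..T}"
  shows "set_integrable lborel {0..t} u'" "(LBINT s:{0..t}. u' s) = u t - u 0"
proof -
  have "set_integrable lborel {0..T} u'" using assms(1) unfolding primitive_on_def by blast
  then show "set_integrable lborel {0..t} u'" by (rule set_integrable_subset) (use assms(2) in auto)
  have "u t = u 0 + (LBINT s:{0..t}. u' s)" using assms unfolding primitive_on_def by blast
  then show "(LBINT s:{0..t}. u' s) = u t - u 0" by (metis add_diff_cancel_left')
qed

lemma set_integrable_bilinear_const:
  fixes pr :: "'a::{banach,second_countable_topology} \<Rightarrow> 'b::{banach,second_countable_topology} \<Rightarrow> 'c::{banach,second_countable_topology}"
  assumes "bounded_bilinear pr"
  shows "set_integrable N A f \<Longrightarrow> set_integrable N A (\<lambda>s. pr (f s) x)"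
    "set_integrable N A f \<Longrightarrow> (\<integral>s\<in>A. pr (f s) x \<partial>N) = pr (\<integral>s\<in>A. f s \<partial>N) x"
    "set_integrable N A g \<Longrightarrow> set_integrable N A (\<lambda>s. pr y (g s))"
    "set_integrable N A g \<Longrightarrow> (\<integral>s\<in>A. pr y (g s) \<partial>N) = pr y (\<integral>s\<in>A. g s \<partial>N)"
  using integral_bounded_linear[OF bounded_bilinear.bounded_linear_left[OF assms], of N "\<lambda>s. indicator A s *\<^sub>R f s"]
    integrable_bounded_linear[OF bounded_bilinear.bounded_linear_left[OF assms], of N "\<lambda>s. indicator A s *\<^sub>R f s"]
    integral_bounded_linear[OF bounded_bilinear.bounded_linear_right[OF assms], of N "\<lambda>s. indicator A s *\<^sub>R g s"]
    integrable_bounded_linear[OF bounded_bilinear.bounded_linear_right[OF assms], of N "\<lambda>s. indicator A s *\<^sub>R g s"]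
  by (auto simp: set_integrable_def set_lebesgue_integral_def set_integrable_scaleR_bounded_bilinear[OF assms])

text \<open>
  The product rule for arbitrary bilinear products. It takes the place of the Ito formula for the products of
  the verification argument: the noise is additive and cancels in differences of states, so these products
  have no quadratic covariation.
\<close>

lemma primitive_on_product:
  fixes pr :: "'a::{banach,second_countable_topology} \<Rightarrow> 'b::{banach,second_countable_topology} \<Rightarrow> 'c::{banach,second_countable_topology}"
  assumes pr: "bounded_bilinear pr" and u: "primitive_on T u u'" and v: "primitive_on T v v'"
  shows "primitive_on T (\<lambda>t. pr (u t) (v t)) (\<lambda>t. pr (u' t) (v t) + pr (u t) (v' t))"
proof -
  note add = bounded_bilinear.add_left[OF pr] bounded_bilinear.add_right[OF pr]
  have main: "set_integrable lborel {0..t} (\<lambda>s. pr (u' s) (v s) + pr (u s) (v' s)) \<and>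
     pr (u t) (v t) = pr (u 0) (v 0) + (LBINT s:{0..t}. pr (u' s) (v s) + pr (u s) (v' s))"
    if t: "t \<in> {0..T}" for t
  proof -
    define f where "f s = indicator {0..t} s *\<^sub>R u' s" for s
    define g where "g s = indicator {0..t} s *\<^sub>R v' s" for s
    have ui: "set_integrable lborel {0..t} u'" and vi: "set_integrable lborel {0..t} v'"
      using primitive_onD(1)[OF u t] primitive_onD(1)[OF v t] .
    have f: "integrable lborel f" and g: "integrable lborel g"
      using ui vi unfolding f_def g_def set_integrable_def by auto
    note parts = integration_by_parts_lborel[OF pr f g]
    have F: "(LBINT r:{..s}. f r) = u s - u 0" and G: "(LBINT r:{..s}. g r) = v s - v 0" if s: "s \<in> {0..t}" for s
    proof -
      have "(LBINT r:{..s}. f r) = (LBINT r:{0..s}. u' r)"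
        unfolding set_lebesgue_integral_def f_def
        by (rule Bochner_Integration.integral_cong) (use s in \<open>auto simp: indicator_def\<close>)
      also have "\<dots> = u s - u 0" by (rule primitive_onD(2)[OF u]) (use s t in auto)
      finally show "(LBINT r:{..s}. f r) = u s - u 0" .
      have "(LBINT r:{..s}. g r) = (LBINT r:{0..s}. v' r)"
        unfolding set_lebesgue_integral_def g_def
        by (rule Bochner_Integration.integral_cong) (use s in \<open>auto simp: indicator_def\<close>)
      also have "\<dots> = v s - v 0" by (rule primitive_onD(2)[OF v]) (use s t in auto)
      finally show "(LBINT r:{..s}. g r) = v s - v 0" .
    qed
    have e1: "(\<lambda>r. pr (f r) (LBINT s:{..r}. g s)) = (\<lambda>r. indicator {0..t} r *\<^sub>R pr (u' r) (v r - v 0))"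
    proof
      fix r show "pr (f r) (LBINT s:{..r}. g s) = indicator {0..t} r *\<^sub>R pr (u' r) (v r - v 0)"
        by (cases "r \<in> {0..t}") (simp_all add: f_def G bounded_bilinear.zero_left[OF pr])
    qed
    have e2: "(\<lambda>s. pr (LBINT r:{..s}. f r) (g s)) = (\<lambda>s. indicator {0..t} s *\<^sub>R pr (u s - u 0) (v' s))"
    proof
      fix s show "pr (LBINT r:{..s}. f r) (g s) = indicator {0..t} s *\<^sub>R pr (u s - u 0) (v' s)"
        by (cases "s \<in> {0..t}") (simp_all add: g_def F bounded_bilinear.zero_right[OF pr])
    qed
    have i1: "set_integrable lborel {0..t} (\<lambda>r. pr (u' r) (v r - v 0))"
      using parts(1) unfolding e1 set_integrable_def .
    have i2: "set_integrable lborel {0..t} (\<lambda>s. pr (u s - u 0) (v' s))"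
      using parts(2) unfolding e2 set_integrable_def .
    have i3: "set_integrable lborel {0..t} (\<lambda>s. pr (u' s) (v 0))"
      and i4: "set_integrable lborel {0..t} (\<lambda>s. pr (u 0) (v' s))"
      by (rule set_integrable_bilinear_const[OF pr] ui vi)+
    have split: "pr (u' s) (v s) + pr (u s) (v' s)
      = (pr (u' s) (v s - v 0) + pr (u s - u 0) (v' s)) + (pr (u' s) (v 0) + pr (u 0) (v' s))" for s
      by (simp add: bounded_bilinear.diff_left[OF pr] bounded_bilinear.diff_right[OF pr])
    have ut: "(LBINT s:{0..t}. u' s) = u t - u 0" and vt: "(LBINT s:{0..t}. v' s) = v t - v 0"
      using primitive_onD(2)[OF u t] primitive_onD(2)[OF v t] .
    then have If: "(\<integral>r. f r \<partial>lborel) = u t - u 0" and Ig: "(\<integral>r. g r \<partial>lborel) = v t - v 0"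
      unfolding f_def g_def set_lebesgue_integral_def by auto
    have "(LBINT s:{0..t}. pr (u' s) (v s) + pr (u s) (v' s)) =
       ((LBINT s:{0..t}. pr (u' s) (v s - v 0)) + (LBINT s:{0..t}. pr (u s - u 0) (v' s)))
       + ((LBINT s:{0..t}. pr (u' s) (v 0)) + (LBINT s:{0..t}. pr (u 0) (v' s)))"
      unfolding split by (simp add: set_integral_add i1 i2 i3 i4)
    also have "(LBINT s:{0..t}. pr (u' s) (v s - v 0)) + (LBINT s:{0..t}. pr (u s - u 0) (v' s)) = pr (u t - u 0) (v t - v 0)"
      using parts(3)[unfolded e1 e2 If Ig] by (simp add: set_lebesgue_integral_def)
    also have "(LBINT s:{0..t}. pr (u' s) (v 0)) = pr (u t - u 0) (v 0)"
      using set_integrable_bilinear_const(2)[OF pr ui] ut by simp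
    also have "(LBINT s:{0..t}. pr (u 0) (v' s)) = pr (u 0) (v t - v 0)"
      using set_integrable_bilinear_const(4)[OF pr vi] vt by simp
    also have "pr (u t - u 0) (v t - v 0) + (pr (u t - u 0) (v 0) + pr (u 0) (v t - v 0)) = pr (u t) (v t) - pr (u 0) (v 0)"
      by (simp add: bounded_bilinear.diff_left[OF pr] bounded_bilinear.diff_right[OF pr])
    finally have "(LBINT s:{0..t}. pr (u' s) (v s) + pr (u s) (v' s)) = pr (u t) (v t) - pr (u 0) (v 0)" .
    moreover have "set_integrable lborel {0..t} (\<lambda>s. pr (u' s) (v s) + pr (u s) (v' s))"
      unfolding split by (intro set_integral_add i1 i2 i3 i4)
    ultimately show ?thesis by simp
  qed
  show ?thesis
  proof (cases "0 \<le> T")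
    case True
    then have "T \<in> {0..T}" by simp
    note main[THEN conjunct1, OF this] main[THEN conjunct2]
    then show ?thesis unfolding primitive_on_def by blast
  next
    case False
    then have "{0..T} = {}" by simp
    then show ?thesis unfolding primitive_on_def by (simp add: set_integrable_def)
  qed
qed

lemma primitive_on_C1:
  fixes u :: "real \<Rightarrow> 'a::euclidean_space"
  assumes u: "\<And>t. t \<in> {0..T} \<Longrightarrow> (u has_vector_derivative u' t) (at t within {0..T})"
    and u': "continuous_on {0..T} u'"
  shows "primitive_on T u u'"
  unfolding primitive_on_def
proof (intro conjI ballI)
  show i: "set_integrable lborel {0..T} u'"
    unfolding set_integrable_def by (rule borel_integrable_compact[OF compact_Icc u'])
  fix t assume t: "t \<in> {0..T}"
  have it: "set_integrable lborel {0..t} u'" using t by (intro set_integrable_subset[OF i]) auto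
  have "(u' has_integral u t - u 0) {0..t}"
    using t by (intro fundamental_theorem_of_calculus has_vector_derivative_within_subset[OF u]) auto
  then show "u t = u 0 + (LBINT s:{0..t}. u' s)"
    by (simp add: set_borel_integral_eq_integral(2)[OF it] integral_unique)
qed

lemma primitive_on_continuous:
  fixes u :: "real \<Rightarrow> 'a::euclidean_space"
  assumes "primitive_on T u u'" shows "continuous_on {0..T} u"
proof -
  have i: "set_integrable lborel {0..T} u'" using assms unfolding primitive_on_def by blast
  have "continuous_on {0..T} (\<lambda>t. u 0 + integral {0..t} u')"
    by (intro continuous_intros indefinite_integral_continuous_1 set_borel_integral_eq_integral(1)[OF i])
  then show ?thesis
  proof (rule continuous_on_eq)
    fix t assume t: "t \<in> {0..T}"
    show "u 0 + integral {0..t} u' = u t"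
      using primitive_onD[OF assms t] by (simp add: set_borel_integral_eq_integral(2))
  qed
qed

text \<open>
  The variance of \<open>f\<close> under the uniform distribution on \<open>[0, T]\<close> is nonnegative.
\<close>

lemma square_integral_le:
  fixes f :: "real \<Rightarrow> real"
  assumes T: "0 < T" and f: "set_integrable lborel {0..T} f" and f2: "set_integrable lborel {0..T} (\<lambda>s. (f s)\<^sup>2)"
  shows "(LBINT s:{0..T}. f s)\<^sup>2 \<le> T * (LBINT s:{0..T}. (f s)\<^sup>2)"
proof -
  define m where "m = (LBINT s:{0..T}. f s) / T"
  have c: "set_integrable lborel {0..T} (\<lambda>s. m\<^sup>2)"
    unfolding set_integrable_def by (rule borel_integrable_compact) (auto intro: continuous_intros)
  have cT: "(LBINT s:{0..T}. m\<^sup>2) = T * m\<^sup>2"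
    using T by (simp add: set_lebesgue_integral_def)
  have nn: "0 \<le> (f s)\<^sup>2 - (2 * m) * f s + m\<^sup>2" for s
    using zero_le_power2[of "f s - m"] by (simp add: power2_diff mult_ac)
  have "0 \<le> (LBINT s:{0..T}. (f s)\<^sup>2 - (2 * m) * f s + m\<^sup>2)"
    unfolding set_lebesgue_integral_def
    by (intro integral_nonneg_AE AE_I2) (simp only: scaleR_nonneg_nonneg indicator_pos_le nn)
  also have "\<dots> = (LBINT s:{0..T}. (f s)\<^sup>2) - (2 * m) * (LBINT s:{0..T}. f s) + (LBINT s:{0..T}. m\<^sup>2)"
    using f f2 c by (subst set_integral_add, auto simp: set_integral_diff)
  finally have "0 \<le> (LBINT s:{0..T}. (f s)\<^sup>2) - (2 * m) * (m * T) + T * m\<^sup>2"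
    using T by (simp add: cT) (simp add: m_def)
  then have "T * (m\<^sup>2 * T) \<le> T * (LBINT s:{0..T}. (f s)\<^sup>2)"
    using T by (intro mult_left_mono) (auto simp: power2_eq_square algebra_simps)
  moreover have "(LBINT s:{0..T}. f s) = m * T" using T by (simp add: m_def)
  ultimately show ?thesis by (simp add: power2_eq_square mult_ac)
qed

section \<open>Increments of the noise are independent of the past\<close>

locale brownian_family = prob_space M for M :: "'w measure" +
  fixes W :: "'n::finite \<Rightarrow> real \<Rightarrow> 'w \<Rightarrow> real"
  assumes ibm: "independent_brownian_motions M W"
begin

abbreviation "FF \<equiv> generated_filtration M W"

lemma bm: "brownian_motion M (W j)"
  using ibm by (simp add: independent_brownian_motions_def)

lemma W_rv: "0 \<le> t \<Longrightarrow> W j t \<in> borel_measurable M"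
  using bm[of j] by (simp add: brownian_motion_def)

lemma W_0: "\<omega> \<in> space M \<Longrightarrow> W j 0 \<omega> = 0"
  using bm[of j] by (simp add: brownian_motion_def)

lemma W_cont: "\<omega> \<in> space M \<Longrightarrow> continuous_on {0..} (\<lambda>t. W j t \<omega>)"
  using bm[of j] by (simp add: brownian_motion_def)

lemma W_normal: "0 \<le> s \<Longrightarrow> s < t \<Longrightarrow>
    distributed M lborel (\<lambda>\<omega>. W j t \<omega> - W j s \<omega>) (normal_density 0 (sqrt (t - s)))"
  using bm[of j] by (simp add: brownian_motion_def)

lemma W_indep_increments: "0 \<le> \<tau> 0 \<Longrightarrow> mono \<tau> \<Longrightarrow>
    indep_vars (\<lambda>_. borel) (\<lambda>k \<omega>. W j (\<tau> (Suc k)) \<omega> - W j (\<tau> k) \<omega>) {..<m}"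
  using bm[of j] unfolding brownian_motion_def by blast

lemma increment_integrable:
  assumes "0 \<le> s" "s \<le> t"
  shows "integrable M (\<lambda>\<omega>. (W j t \<omega> - W j s \<omega>)\<^sup>2)" "(\<integral>\<omega>. (W j t \<omega> - W j s \<omega>)\<^sup>2 \<partial>M) = t - s"
    "integrable M (\<lambda>\<omega>. W j t \<omega> - W j s \<omega>)" "(\<integral>\<omega>. W j t \<omega> - W j s \<omega> \<partial>M) = 0"
proof -
  have "integrable M (\<lambda>\<omega>. (W j t \<omega> - W j s \<omega>)\<^sup>2) \<and> (\<integral>\<omega>. (W j t \<omega> - W j s \<omega>)\<^sup>2 \<partial>M) = t - s \<and>
      integrable M (\<lambda>\<omega>. W j t \<omega> - W j s \<omega>) \<and> (\<integral>\<omega>. W j t \<omega> - W j s \<omega> \<partial>M) = 0"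
  proof (cases "s = t")
    case False
    then have st: "s < t" using assms by simp
    have pos: "0 < sqrt (t - s)" using st by simp
    note D = W_normal[OF assms(1) st, of j]
    have E: "expectation (\<lambda>\<omega>. W j t \<omega> - W j s \<omega>) = 0"
      by (rule normal_distributed_expectation[OF pos D])
    have V: "variance (\<lambda>\<omega>. W j t \<omega> - W j s \<omega>) = (sqrt (t - s))\<^sup>2"
      by (rule normal_distributed_variance[OF pos D])
    have "(\<integral>\<omega>. (W j t \<omega> - W j s \<omega>)\<^sup>2 \<partial>M) = t - s"
      using V st by (simp add: E)
    moreover from this have i2: "integrable M (\<lambda>\<omega>. (W j t \<omega> - W j s \<omega>)\<^sup>2)"
      using st not_integrable_integral_eq by fastforce
    moreover have "integrable M (\<lambda>\<omega>. W j t \<omega> - W j s \<omega>)"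
      by (rule square_integrable_imp_integrable[OF _ i2])
         (use assms W_rv in \<open>auto intro!: borel_measurable_diff\<close>)
    ultimately show ?thesis using E by simp
  qed simp
  then show "integrable M (\<lambda>\<omega>. (W j t \<omega> - W j s \<omega>)\<^sup>2)" "(\<integral>\<omega>. (W j t \<omega> - W j s \<omega>)\<^sup>2 \<partial>M) = t - s"
    "integrable M (\<lambda>\<omega>. W j t \<omega> - W j s \<omega>)" "(\<integral>\<omega>. W j t \<omega> - W j s \<omega> \<partial>M) = 0" by auto
qed

text \<open>
  A generator of the information that is contained in the path of a single player up to time \<open>t\<close>.
\<close>

definition past_gen :: "real \<Rightarrow> 'n \<Rightarrow> 'w set set" where
  "past_gen t k = {W k s -` B \<inter> space M | s B. s \<in> {0..t} \<and> B \<in> sets borel}"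

lemma FF_gen_eq: "{W j s -` B \<inter> space M | j s B. s \<in> {0..t} \<and> B \<in> sets borel} = (\<Union>k. past_gen t k)"
  by (auto simp: past_gen_def)

lemma past_gen_events: "past_gen t k \<subseteq> events"
  using W_rv by (auto simp: past_gen_def)

lemma past_gen_Pow: "(\<Union>k. past_gen t k) \<subseteq> Pow (space M)"
  by (auto simp: past_gen_def)

lemma space_FF [simp]: "space (FF t) = space M"
  unfolding generated_filtration_def FF_gen_eq by (rule space_measure_of[OF past_gen_Pow])

lemma sets_FF: "sets (FF t) = sigma_sets (space M) (\<Union>k. past_gen t k)"
  unfolding generated_filtration_def FF_gen_eq by (rule sets_measure_of[OF past_gen_Pow])

lemma sets_FF_subset: "sets (FF t) \<subseteq> events"
  unfolding sets_FF using past_gen_events by (intro sets.sigma_sets_subset) auto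

lemma W_FF: "s \<in> {0..t} \<Longrightarrow> W j s \<in> borel_measurable (FF t)"
proof (rule measurableI)
  fix B :: "real set" assume s: "s \<in> {0..t}" and B: "B \<in> sets borel"
  then have "W j s -` B \<inter> space M \<in> (\<Union>k. past_gen t k)" by (auto simp: past_gen_def)
  then show "W j s -` B \<inter> space (FF t) \<in> sets (FF t)" unfolding sets_FF by auto
qed auto

lemma id_M_FF: "(\<lambda>\<omega>. \<omega>) \<in> measurable M (FF t)"
proof (rule measurableI)
  fix A assume A: "A \<in> sets (FF t)"
  then have "A \<in> events" using sets_FF_subset by blast
  moreover from this have "(\<lambda>\<omega>. \<omega>) -` A \<inter> space M = A" using sets.sets_into_space by blast
  ultimately show "(\<lambda>\<omega>. \<omega>) -` A \<inter> space M \<in> events" by simp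
qed simp

lemma FF_measurable_M: "f \<in> measurable (FF t) N \<Longrightarrow> f \<in> measurable M N"
  using measurable_compose[OF id_M_FF] .

text \<open>
  Sorting the finitely many observation times together with \<open>0\<close>, \<open>t\<close> and \<open>u\<close> turns every observed value into a
  sum of increments that precede the last one.
\<close>

lemma increment_indep_finite:
  assumes "0 \<le> t" "t < u" and S: "finite S" "S \<subseteq> {0..t}"
    and A: "\<And>s. A s \<in> sets borel" and C: "C \<in> sets borel"
  shows "prob ({\<omega> \<in> space M. W j u \<omega> - W j t \<omega> \<in> C} \<inter> {\<omega> \<in> space M. \<forall>s\<in>S. W j s \<omega> \<in> A s}) =
    prob {\<omega> \<in> space M. W j u \<omega> - W j t \<omega> \<in> C} * prob {\<omega> \<in> space M. \<forall>s\<in>S. W j s \<omega> \<in> A s}"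
proof -
  define R where "R = insert 0 (insert t S)"
  define l where "l = sorted_list_of_set R"
  have R: "finite R" "R \<subseteq> {0..t}" using S assms(1) by (auto simp: R_def)
  have l: "sorted l" "distinct l" "set l = R" using R by (auto simp: l_def)
  define n where "n = length l - 1"
  have len: "length l = Suc n"
  proof -
    have "l \<noteq> []" using l(3) by (auto simp: R_def)
    then show ?thesis by (simp add: n_def)
  qed
  \<comment> \<open>The increment from step \<open>n\<close> to step \<open>Suc n\<close> is the one from \<open>t\<close> to \<open>u\<close>.\<close>
  define \<tau> where "\<tau> k = (if k \<le> n then l ! k else u)" for k
  have in_R: "l ! k \<in> {0..t}" if "k \<le> n" for k
    using that len l(3) R nth_mem[of k l] by (metis le_imp_less_Suc subsetD)
  have first: "\<tau> 0 = 0"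
  proof -
    have "0 \<in> set l" using l by (simp add: R_def)
    then obtain k where k: "k \<le> n" "l ! k = 0" using len by (metis in_set_conv_nth less_Suc_eq_le)
    have "l ! 0 \<le> l ! k" using l(1) k(1) len by (intro sorted_nth_mono) auto
    with k in_R[of 0] show ?thesis by (auto simp: \<tau>_def)
  qed
  have last: "\<tau> n = t"
  proof -
    have "t \<in> set l" using l by (simp add: R_def)
    then obtain k where k: "k \<le> n" "l ! k = t" using len by (metis in_set_conv_nth less_Suc_eq_le)
    have "l ! k \<le> l ! n" using l(1) k(1) len by (intro sorted_nth_mono) auto
    with k in_R[of n] show ?thesis by (auto simp: \<tau>_def)
  qed
  have "mono \<tau>"
  proof (rule monoI)
    fix a b :: nat assume ab: "a \<le> b"
    show "\<tau> a \<le> \<tau> b"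
    proof (cases "b \<le> n")
      case True
      then show ?thesis using ab l(1) len by (auto simp: \<tau>_def intro!: sorted_nth_mono)
    next
      case False
      then show ?thesis using in_R[of a] assms(2) by (auto simp: \<tau>_def)
    qed
  qed
  define inc where "inc k \<omega> = W j (\<tau> (Suc k)) \<omega> - W j (\<tau> k) \<omega>" for k \<omega>
  have ind: "indep_vars (\<lambda>_. borel) inc {..<Suc n}"
    unfolding inc_def[abs_def] by (rule W_indep_increments) (use first \<open>mono \<tau>\<close> in auto)
  have iv: "indep_var (PiM {n} (\<lambda>_. borel)) (\<lambda>\<omega>. restrict (\<lambda>i. inc i \<omega>) {n})
      (PiM {..<n} (\<lambda>_. borel)) (\<lambda>\<omega>. restrict (\<lambda>i. inc i \<omega>) {..<n})"
    by (rule indep_var_restrict[OF ind]) auto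
  have "\<exists>k\<le>n. l ! k = s" if "s \<in> S" for s
  proof -
    have "s \<in> set l" using l that by (simp add: R_def)
    then show ?thesis using len by (metis in_set_conv_nth less_Suc_eq_le)
  qed
  then obtain idx where idx: "\<And>s. s \<in> S \<Longrightarrow> idx s \<le> n \<and> l ! idx s = s" by metis
  have tele: "W j (\<tau> k) \<omega> = (\<Sum>i<k. inc i \<omega>)" if "\<omega> \<in> space M" for k \<omega>
    using that by (induction k) (auto simp: first W_0 inc_def)
  define Q where "Q = {y \<in> space (PiM {..<n} (\<lambda>_. borel :: real measure)). \<forall>s\<in>S. (\<Sum>i<idx s. y i) \<in> A s}"
  have Q: "Q \<in> sets (PiM {..<n} (\<lambda>_. borel))"
    unfolding Q_def
  proof (rule sets.sets_Collect_finite_All[OF _ S(1)], goal_cases)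
    case (1 s)
    have "(\<lambda>y. \<Sum>i<idx s. y i) \<in> borel_measurable (PiM {..<n} (\<lambda>_. borel :: real measure))"
      using idx[OF 1] by (intro borel_measurable_sum measurable_component_singleton) auto
    from measurable_sets[OF this A[of s]] show ?case
      by (auto simp: vimage_def Int_def conj_commute)
  qed
  define P where "P = {y \<in> space (PiM {n} (\<lambda>_. borel :: real measure)). y n \<in> C}"
  have P: "P \<in> sets (PiM {n} (\<lambda>_. borel))"
  proof -
    have "(\<lambda>y. y n) \<in> borel_measurable (PiM {n} (\<lambda>_. borel :: real measure))"
      by (intro measurable_component_singleton) auto
    from measurable_sets[OF this C] show ?thesis
      unfolding P_def by (auto simp: vimage_def Int_def conj_commute)
  qed
  have preP: "(\<lambda>\<omega>. restrict (\<lambda>i. inc i \<omega>) {n}) -` P \<inter> space M = {\<omega> \<in> space M. W j u \<omega> - W j t \<omega> \<in> C}"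
    using last by (auto simp: P_def space_PiM inc_def \<tau>_def)
  have preQ: "(\<lambda>\<omega>. restrict (\<lambda>i. inc i \<omega>) {..<n}) -` Q \<inter> space M = {\<omega> \<in> space M. \<forall>s\<in>S. W j s \<omega> \<in> A s}"
  proof -
    have "(\<Sum>i<idx s. restrict (\<lambda>i. inc i \<omega>) {..<n} i) = W j s \<omega>" if "\<omega> \<in> space M" "s \<in> S" for \<omega> s
    proof -
      have "(\<Sum>i<idx s. restrict (\<lambda>i. inc i \<omega>) {..<n} i) = (\<Sum>i<idx s. inc i \<omega>)"
        using idx[OF that(2)] by (intro sum.cong) auto
      also have "\<dots> = W j (\<tau> (idx s)) \<omega>" using tele[OF that(1)] by simp
      also have "\<tau> (idx s) = s" using idx[OF that(2)] by (simp add: \<tau>_def)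
      finally show ?thesis .
    qed
    then show ?thesis by (auto simp: Q_def space_PiM)
  qed
  have "prob ((\<lambda>x. (restrict (\<lambda>i. inc i x) {n}, restrict (\<lambda>i. inc i x) {..<n})) -` (P \<times> Q) \<inter> space M) =
     prob {\<omega> \<in> space M. W j u \<omega> - W j t \<omega> \<in> C} * prob {\<omega> \<in> space M. \<forall>s\<in>S. W j s \<omega> \<in> A s}"
    using indep_varD[OF iv P Q] by (simp only: preP preQ)
  moreover have "(\<lambda>x. (restrict (\<lambda>i. inc i x) {n}, restrict (\<lambda>i. inc i x) {..<n})) -` (P \<times> Q) \<inter> space M
     = {\<omega> \<in> space M. W j u \<omega> - W j t \<omega> \<in> C} \<inter> {\<omega> \<in> space M. \<forall>s\<in>S. W j s \<omega> \<in> A s}"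
    using preP preQ by blast
  ultimately show ?thesis by simp
qed

definition increment_events :: "'n \<Rightarrow> real \<Rightarrow> real \<Rightarrow> 'w set set" where
  "increment_events j t u = {(\<lambda>\<omega>. W j u \<omega> - W j t \<omega>) -` C \<inter> space M | C. C \<in> sets borel}"

lemma increment_rv: "0 \<le> t \<Longrightarrow> t \<le> u \<Longrightarrow> (\<lambda>\<omega>. W j u \<omega> - W j t \<omega>) \<in> borel_measurable M"
  by (intro borel_measurable_diff W_rv) auto

lemma Int_stable_increment_events: "Int_stable (increment_events j t u)"
  unfolding Int_stable_def increment_events_def
proof clarsimp
  fix C D :: "real set" assume "C \<in> sets borel" "D \<in> sets borel"
  then show "\<exists>E. (\<lambda>\<omega>. W j u \<omega> - W j t \<omega>) -` C \<inter> space M \<inter> ((\<lambda>\<omega>. W j u \<omega> - W j t \<omega>) -` D \<inter> space M) =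
     (\<lambda>\<omega>. W j u \<omega> - W j t \<omega>) -` E \<inter> space M \<and> E \<in> sets borel"
    by (intro exI[of _ "C \<inter> D"]) auto
qed

text \<open>
  Finite-dimensional cylinder events of the past form a generator that is closed under intersection, so
  independence extends from them to the generated sigma-algebra.
\<close>

lemma increment_indep_own_past:
  assumes "0 \<le> t" "t < u"
  shows "indep_set (increment_events j t u) (sigma_sets (space M) (past_gen t j))"
proof -
  define cylinders where "cylinders = {{\<omega> \<in> space M. \<forall>s\<in>S. W j s \<omega> \<in> A s} | S A. finite S \<and> S \<subseteq> {0..t} \<and> (\<forall>s. A s \<in> sets borel)}"
  have incev: "increment_events j t u \<subseteq> events"
    using increment_rv[of t u j] assms by (auto simp: increment_events_def)
  have cyl_ev: "cylinders \<subseteq> events"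
  proof
    fix X assume "X \<in> cylinders"
    then obtain S A where X: "X = {\<omega> \<in> space M. \<forall>s\<in>S. W j s \<omega> \<in> A s}" "finite S" "S \<subseteq> {0..t}" "\<forall>s. A s \<in> sets borel"
      by (auto simp: cylinders_def)
    show "X \<in> events" unfolding X(1)
    proof (rule sets.sets_Collect_finite_All[OF _ X(2)], goal_cases)
      case (1 s)
      then have "W j s \<in> borel_measurable M" using X(3) by (intro W_rv) auto
      from measurable_sets[OF this, of "A s"] X(4) show ?case
        by (auto simp: vimage_def Int_def conj_commute)
    qed
  qed
  have "indep_set (increment_events j t u) cylinders"
  proof (rule indep_setI[OF incev cyl_ev])
    fix a b assume "a \<in> increment_events j t u" "b \<in> cylinders"
    then obtain C S A where *: "a = (\<lambda>\<omega>. W j u \<omega> - W j t \<omega>) -` C \<inter> space M" "C \<in> sets borel"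
      "b = {\<omega> \<in> space M. \<forall>s\<in>S. W j s \<omega> \<in> A s}" "finite S" "S \<subseteq> {0..t}" "\<forall>s. A s \<in> sets borel"
      by (auto simp: cylinders_def increment_events_def)
    have "a = {\<omega> \<in> space M. W j u \<omega> - W j t \<omega> \<in> C}" using *(1) by auto
    then show "prob (a \<inter> b) = prob a * prob b"
      using increment_indep_finite[OF assms *(4,5), of A C j] * by simp
  qed
  moreover have "Int_stable cylinders"
    unfolding Int_stable_def
  proof (intro ballI)
    fix X Y assume "X \<in> cylinders" "Y \<in> cylinders"
    then obtain S A S' A' where X: "X = {\<omega> \<in> space M. \<forall>s\<in>S. W j s \<omega> \<in> A s}" "finite S" "S \<subseteq> {0..t}" "\<forall>s. A s \<in> sets borel"
      and Y: "Y = {\<omega> \<in> space M. \<forall>s\<in>S'. W j s \<omega> \<in> A' s}" "finite S'" "S' \<subseteq> {0..t}" "\<forall>s. A' s \<in> sets borel"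
      unfolding cylinders_def by blast
    define D where "D s = (if s \<in> S then A s else UNIV) \<inter> (if s \<in> S' then A' s else UNIV)" for s
    have "X \<inter> Y = {\<omega> \<in> space M. \<forall>s\<in>S \<union> S'. W j s \<omega> \<in> D s}"
      unfolding X(1) Y(1) D_def by auto
    moreover have "\<forall>s. D s \<in> sets borel" using X(4) Y(4) by (auto simp: D_def)
    ultimately show "X \<inter> Y \<in> cylinders"
      unfolding cylinders_def using X Y by (intro CollectI exI[of _ "S \<union> S'"] exI[of _ D]) auto
  qed
  ultimately have "indep_set (sigma_sets (space M) (increment_events j t u)) (sigma_sets (space M) cylinders)"
    using Int_stable_increment_events by (intro indep_set_sigma_sets)
  moreover have "increment_events j t u \<subseteq> sigma_sets (space M) (increment_events j t u)" by auto
  moreover have "sigma_sets (space M) (past_gen t j) \<subseteq> sigma_sets (space M) cylinders"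
  proof (rule sigma_sets_mono')
    show "past_gen t j \<subseteq> cylinders"
    proof
      fix X assume "X \<in> past_gen t j"
      then obtain s B where "X = W j s -` B \<inter> space M" "s \<in> {0..t}" "B \<in> sets borel"
        by (auto simp: past_gen_def)
      then show "X \<in> cylinders" unfolding cylinders_def
        by (intro CollectI exI[of _ "{s}"] exI[of _ "\<lambda>_. B"]) auto
    qed
  qed
  ultimately show ?thesis unfolding indep_sets2_eq by blast
qed

lemma players_indep:
  assumes U: "\<And>k. U k \<in> sigma_sets (space M) {W k s -` B \<inter> space M | s B. 0 \<le> s \<and> B \<in> sets borel}"
  shows "prob (\<Inter>k. U k) = (\<Prod>k\<in>UNIV. prob (U k))"
proof -
  define path where "path k = (\<lambda>\<omega>. \<lambda>t\<in>{0..}. W k t \<omega>)" for k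
  have iv: "indep_vars (\<lambda>_. Pi\<^sub>M {0..} (\<lambda>_. borel)) path UNIV"
    using ibm unfolding independent_brownian_motions_def path_def by blast
  have ind: "indep_sets (\<lambda>k. sigma_sets (space M) {path k -` A \<inter> space M | A. A \<in> sets (Pi\<^sub>M {0..} (\<lambda>_. borel))}) UNIV"
    using iv unfolding indep_vars_def by blast
  have "sigma_sets (space M) {W k s -` B \<inter> space M | s B. 0 \<le> s \<and> B \<in> sets borel}
     \<subseteq> sigma_sets (space M) {path k -` A \<inter> space M | A. A \<in> sets (Pi\<^sub>M {0..} (\<lambda>_. borel))}" for k
  proof (rule sigma_sets_mono', safe)
    fix s :: real and B :: "real set" assume s: "0 \<le> s" and B: "B \<in> sets borel"
    define A where "A = (\<lambda>y. y s) -` B \<inter> space (Pi\<^sub>M {0..} (\<lambda>_. borel :: real measure))"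
    have "A \<in> sets (Pi\<^sub>M {0..} (\<lambda>_. borel))"
    proof -
      have "(\<lambda>y. y s) \<in> borel_measurable (Pi\<^sub>M {0..} (\<lambda>_. borel :: real measure))"
        using s by (intro measurable_component_singleton) simp
      from measurable_sets[OF this B] show ?thesis unfolding A_def .
    qed
    moreover have "W k s -` B \<inter> space M = path k -` A \<inter> space M"
      using s by (auto simp: A_def path_def space_PiM)
    ultimately show "\<exists>A. W k s -` B \<inter> space M = path k -` A \<inter> space M \<and> A \<in> sets (Pi\<^sub>M {0..} (\<lambda>_. borel))"
      by blast
  qed
  then show ?thesis using U by (intro indep_setsD[OF ind]) auto
qed

text \<open>
  Intersections of one past event per player generate the joint past. For such an intersection the
  increment of player \<open>j\<close> concerns the path of \<open>j\<close> only: independence of the players factors out all other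
  events, and independence of increments deals with the event of player \<open>j\<close>.
\<close>

lemma increment_indep_past:
  assumes tu: "0 \<le> t" "t < u"
  shows "indep_set (increment_events j t u) (sets (FF t))"
proof -
  define SA where "SA k = sigma_sets (space M) (past_gen t k)" for k
  define cylinders where "cylinders = {\<Inter>k. A k | A. \<forall>k. A k \<in> SA k}"
  define Big where "Big k = {W k s -` B \<inter> space M | s B. 0 \<le> s \<and> B \<in> sets borel}" for k
  have Bev: "Big k \<subseteq> Pow (space M)" for k by (auto simp: Big_def)
  have sa: "sigma_algebra (space M) (SA k)" for k
    unfolding SA_def by (rule sigma_algebra_sigma_sets) (auto simp: past_gen_def)
  have sb: "sigma_algebra (space M) (sigma_sets (space M) (Big k))" for k
    by (rule sigma_algebra_sigma_sets[OF Bev])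
  have SA_ev: "SA k \<subseteq> events" for k
    unfolding SA_def by (rule sets.sigma_sets_subset[OF past_gen_events])
  have SA_Big: "SA k \<subseteq> sigma_sets (space M) (Big k)" for k
    unfolding SA_def by (rule sigma_sets_mono') (auto simp: past_gen_def Big_def)
  have inc_Big: "increment_events j t u \<subseteq> sigma_sets (space M) (Big j)"
  proof
    fix X assume "X \<in> increment_events j t u"
    then obtain C where X: "X = (\<lambda>\<omega>. W j u \<omega> - W j t \<omega>) -` C \<inter> space M" "C \<in> sets borel"
      by (auto simp: increment_events_def)
    have m: "W j s \<in> borel_measurable (sigma (space M) (Big j))" if "0 \<le> s" for s
    proof (rule measurableI)
      fix B :: "real set" assume "B \<in> sets borel"
      then have "W j s -` B \<inter> space M \<in> Big j" using that by (auto simp: Big_def)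
      then show "W j s -` B \<inter> space (sigma (space M) (Big j)) \<in> sets (sigma (space M) (Big j))"
        using Bev[of j] by (simp add: space_measure_of)
    qed auto
    have "(\<lambda>\<omega>. W j u \<omega> - W j t \<omega>) \<in> borel_measurable (sigma (space M) (Big j))"
      using tu by (intro borel_measurable_diff m) auto
    from measurable_sets[OF this X(2)] show "X \<in> sigma_sets (space M) (Big j)"
      using Bev[of j] X(1) by (simp add: space_measure_of)
  qed
  have incev: "increment_events j t u \<subseteq> events"
    using increment_rv[of t u j] tu by (auto simp: increment_events_def)
  have cyl_ev: "cylinders \<subseteq> events"
  proof
    fix X assume "X \<in> cylinders"
    then obtain A where X: "X = (\<Inter>k. A k)" "\<forall>k. A k \<in> SA k" by (auto simp: cylinders_def)
    show "X \<in> events" unfolding X(1) using X(2) SA_ev by (intro sets.finite_INT) auto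
  qed
  have "indep_set (increment_events j t u) cylinders"
  proof (rule indep_setI[OF incev cyl_ev])
    fix a b assume a: "a \<in> increment_events j t u" and "b \<in> cylinders"
    then obtain A where b: "b = (\<Inter>k. A k)" "\<forall>k. A k \<in> SA k" by (auto simp: cylinders_def)
    have own: "prob (a \<inter> A j) = prob a * prob (A j)"
      using indep_setD[OF increment_indep_own_past[OF tu] a] b(2) by (simp add: SA_def)
    define U where "U k = (if k = j then a \<inter> A j else A k)" for k
    have "U k \<in> sigma_sets (space M) (Big k)" for k
    proof (cases "k = j")
      case True
      interpret sigma_algebra "space M" "sigma_sets (space M) (Big j)" by (rule sb)
      show ?thesis using True a inc_Big SA_Big[of j] b(2) by (auto simp: U_def)
    next
      case False
      then show ?thesis using SA_Big[of k] b(2) by (auto simp: U_def)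
    qed
    then have "prob (\<Inter>k. U k) = (\<Prod>k\<in>UNIV. prob (U k))"
      unfolding Big_def by (rule players_indep)
    also have "\<dots> = prob (U j) * (\<Prod>k\<in>UNIV - {j}. prob (U k))" by (rule prod.remove) auto
    also have "(\<Prod>k\<in>UNIV - {j}. prob (U k)) = (\<Prod>k\<in>UNIV - {j}. prob (A k))"
      by (rule prod.cong) (auto simp: U_def)
    also have "prob (U j) * (\<Prod>k\<in>UNIV - {j}. prob (A k)) = prob a * (\<Prod>k\<in>UNIV. prob (A k))"
      by (simp add: U_def own prod.remove[of UNIV j "\<lambda>k. prob (A k)"])
    also have "(\<Prod>k\<in>UNIV. prob (A k)) = prob b"
    proof -
      have "A k \<in> sigma_sets (space M) (Big k)" for k using SA_Big[of k] b(2) by auto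
      then show ?thesis unfolding b(1) Big_def by (rule players_indep[symmetric])
    qed
    also have "(\<Inter>k. U k) = a \<inter> b" by (auto simp: U_def b(1) split: if_splits)
    finally show "prob (a \<inter> b) = prob a * prob b" .
  qed
  moreover have "Int_stable cylinders"
    unfolding Int_stable_def
  proof (intro ballI)
    fix X Y assume "X \<in> cylinders" "Y \<in> cylinders"
    then obtain A A' where X: "X = (\<Inter>k. A k)" "\<forall>k. A k \<in> SA k" and Y: "Y = (\<Inter>k. A' k)" "\<forall>k. A' k \<in> SA k"
      by (auto simp: cylinders_def)
    have "A k \<inter> A' k \<in> SA k" for k
    proof -
      interpret sigma_algebra "space M" "SA k" by (rule sa)
      show ?thesis using X(2) Y(2) by auto
    qed
    moreover have "X \<inter> Y = (\<Inter>k. A k \<inter> A' k)" using X(1) Y(1) by auto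
    ultimately show "X \<inter> Y \<in> cylinders" unfolding cylinders_def by (intro CollectI exI[of _ "\<lambda>k. A k \<inter> A' k"]) auto
  qed
  ultimately have "indep_set (sigma_sets (space M) (increment_events j t u)) (sigma_sets (space M) cylinders)"
    using Int_stable_increment_events by (intro indep_set_sigma_sets)
  moreover have "increment_events j t u \<subseteq> sigma_sets (space M) (increment_events j t u)" by auto
  moreover have "sets (FF t) \<subseteq> sigma_sets (space M) cylinders"
    unfolding sets_FF
  proof (rule sigma_sets_mono', rule UN_least)
    fix k show "past_gen t k \<subseteq> cylinders"
    proof
      fix X assume X: "X \<in> past_gen t k"
      define A where "A i = (if i = k then X else space M)" for i
      have "A i \<in> SA i" for i using X sigma_sets_top[of "space M" "past_gen t i"] by (auto simp: A_def SA_def)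
      moreover have "X = (\<Inter>i. A i)" using X by (auto simp: A_def past_gen_def split: if_splits)
      ultimately show "X \<in> cylinders" unfolding cylinders_def by blast
    qed
  qed
  ultimately show ?thesis unfolding indep_sets2_eq by blast
qed

text \<open>
  The form in which independence of the increments enters the verification argument: it makes the
  stochastic term of the cost difference vanish in expectation.
\<close>

lemma increment_orthogonal_past:
  assumes tu: "0 \<le> t" "t \<le> u" and g: "g \<in> borel_measurable (FF t)" "integrable M g"
  shows "integrable M (\<lambda>\<omega>. (W j u \<omega> - W j t \<omega>) * g \<omega>)"
    "(\<integral>\<omega>. (W j u \<omega> - W j t \<omega>) * g \<omega> \<partial>M) = 0"
proof -
  have "integrable M (\<lambda>\<omega>. (W j u \<omega> - W j t \<omega>) * g \<omega>) \<and> (\<integral>\<omega>. (W j u \<omega> - W j t \<omega>) * g \<omega> \<partial>M) = 0"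
  proof (cases "t = u")
  case False
  then have tu': "t < u" using tu by simp
  have "indep_var borel (\<lambda>\<omega>. W j u \<omega> - W j t \<omega>) borel g"
    unfolding indep_var_eq
  proof (intro conjI)
    show "(\<lambda>\<omega>. W j u \<omega> - W j t \<omega>) \<in> borel_measurable M" by (rule increment_rv[OF tu])
    show "g \<in> borel_measurable M" using g(2) by auto
    have gsub: "{g -` A \<inter> space M | A. A \<in> sets borel} \<subseteq> sets (FF t)"
      using measurable_sets[OF g(1)] by auto
    have "indep_set (increment_events j t u) {g -` A \<inter> space M | A. A \<in> sets borel}"
      using increment_indep_past[OF tu(1) tu', of j] gsub unfolding indep_sets2_eq by blast
    moreover have "Int_stable {g -` A \<inter> space M | A. A \<in> sets borel}"
      unfolding Int_stable_def
    proof clarsimp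
      fix C D :: "real set" assume "C \<in> sets borel" "D \<in> sets borel"
      then show "\<exists>E. g -` C \<inter> space M \<inter> (g -` D \<inter> space M) = g -` E \<inter> space M \<and> E \<in> sets borel"
        by (intro exI[of _ "C \<inter> D"]) auto
    qed
    ultimately show "indep_set (sigma_sets (space M) {(\<lambda>\<omega>. W j u \<omega> - W j t \<omega>) -` A \<inter> space M | A. A \<in> sets borel})
        (sigma_sets (space M) {g -` A \<inter> space M | A. A \<in> sets borel})"
      using Int_stable_increment_events by (intro indep_set_sigma_sets) (auto simp: increment_events_def)
  qed
  then have "(\<integral>\<omega>. (W j u \<omega> - W j t \<omega>) * g \<omega> \<partial>M) = (\<integral>\<omega>. W j u \<omega> - W j t \<omega> \<partial>M) * (\<integral>\<omega>. g \<omega> \<partial>M)"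
    "integrable M (\<lambda>\<omega>. (W j u \<omega> - W j t \<omega>) * g \<omega>)"
    by (rule indep_var_lebesgue_integral[OF _ increment_integrable(3)[OF tu] g(2)]
        indep_var_integrable[OF _ increment_integrable(3)[OF tu] g(2)])+
  then show ?thesis by (simp add: increment_integrable(4)[OF tu])
  qed simp
  then show "integrable M (\<lambda>\<omega>. (W j u \<omega> - W j t \<omega>) * g \<omega>)"
    "(\<integral>\<omega>. (W j u \<omega> - W j t \<omega>) * g \<omega> \<partial>M) = 0" by auto
qed

end

section \<open>Linear equations with continuous coefficients\<close>

lemma bounded_bilinear_matrix_vector: "bounded_bilinear ((*v) :: real^'n^'m \<Rightarrow> real^'n \<Rightarrow> real^'m)"
  unfolding bilinear_conv_bounded_bilinear[symmetric] bilinear_def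
  by (auto intro!: linearI simp: matrix_vector_mult_add_rdistrib matrix_vector_right_distrib
      scaleR_matrix_vector_assoc matrix_vector_mult_scaleR)

lemma bounded_bilinear_matrix_matrix: "bounded_bilinear ((**) :: real^'n^'m \<Rightarrow> real^'p^'n \<Rightarrow> real^'p^'m)"
  unfolding bilinear_conv_bounded_bilinear[symmetric] bilinear_def
  by (auto intro!: linearI simp: vec_eq_iff matrix_matrix_mult_def sum.distrib sum_distrib_left algebra_simps)

lemma vec_eq_sum_axis: "(v :: real^'n) = (\<Sum>i\<in>UNIV. (v $ i) *\<^sub>R axis i 1)"
  by (simp add: vec_eq_iff axis_def if_distrib[where f = "\<lambda>x. _ * x"] sum.delta cong: if_cong)

lemma integrable_vecI:
  fixes f :: "'a \<Rightarrow> real^'n"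
  assumes "\<And>i. integrable N (\<lambda>x. f x $ i)"
  shows "integrable N f"
proof -
  have "integrable N (\<lambda>x. \<Sum>i\<in>UNIV. (f x $ i) *\<^sub>R (axis i 1 :: real^'n))"
    by (intro Bochner_Integration.integrable_sum integrable_scaleR_left assms)
  then show ?thesis by (simp only: vec_eq_sum_axis[symmetric])
qed

lemma set_integrable_vecI:
  fixes f :: "'a \<Rightarrow> real^'n"
  assumes "\<And>i. set_integrable N A (\<lambda>x. f x $ i)"
  shows "set_integrable N A f"
  using assms unfolding set_integrable_def by (intro integrable_vecI) simp

lemma set_integral_vec_nth:
  fixes f :: "'a \<Rightarrow> real^'n"
  assumes "set_integrable N A f"
  shows "set_integrable N A (\<lambda>x. f x $ i)" "(\<integral>x\<in>A. f x \<partial>N) $ i = (\<integral>x\<in>A. f x $ i \<partial>N)"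
  using integrable_bounded_linear[OF bounded_linear_vec_nth[of i] assms[unfolded set_integrable_def]]
    integral_bounded_linear[OF bounded_linear_vec_nth[of i] assms[unfolded set_integrable_def]]
  by (simp_all add: set_integrable_def set_lebesgue_integral_def)

lemma borel_measurable_vecI:
  fixes f :: "'a \<Rightarrow> real^'n"
  assumes "\<And>i. (\<lambda>x. f x $ i) \<in> borel_measurable N"
  shows "f \<in> borel_measurable N"
proof -
  have "(\<lambda>x. \<Sum>i\<in>UNIV. (f x $ i) *\<^sub>R (axis i 1 :: real^'n)) \<in> borel_measurable N"
    by (intro borel_measurable_sum borel_measurable_scaleR assms) auto
  then show ?thesis by (simp only: vec_eq_sum_axis[symmetric])
qed

lemma set_integrable_continuous:
  fixes f :: "real \<Rightarrow> 'a::euclidean_space"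
  assumes "continuous_on {a..b} f" shows "set_integrable lborel {a..b} f"
  unfolding set_integrable_def by (rule borel_integrable_compact[OF compact_Icc assms])

lemma continuous_bilinear_bound:
  fixes pr :: "'a::real_normed_vector \<Rightarrow> 'b::real_normed_vector \<Rightarrow> 'c::real_normed_vector"
    and C :: "real \<Rightarrow> 'a"
  assumes pr: "bounded_bilinear pr" and C: "continuous_on {0..T} C"
  obtains K where "0 < K" "\<And>t x. t \<in> {0..T} \<Longrightarrow> norm (pr (C t) x) \<le> K * norm x"
proof -
  obtain k where k: "0 < k" "\<And>A x. norm (pr A x) \<le> norm A * norm x * k"
    using bounded_bilinear.pos_bounded[OF pr] by blast
  obtain b where b: "0 < b" "\<forall>x\<in>C ` {0..T}. norm x \<le> b"
    using compact_imp_bounded[OF compact_continuous_image[OF C compact_Icc]] bounded_pos by metis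
  show thesis
  proof (rule that[of "b * k"])
    show "0 < b * k" using b(1) k(1) by simp
    fix t and x :: 'b assume "t \<in> {0..T}"
    then have "norm (C t) \<le> b" using b(2) by blast
    then have "norm (C t) * (norm x * k) \<le> b * (norm x * k)" using k(1) by (intro mult_right_mono) auto
    then show "norm (pr (C t) x) \<le> b * k * norm x" using k(2)[of "C t" x] by (simp add: mult_ac)
  qed
qed

lemma linear_ode_exists:
  fixes f :: "real \<Rightarrow> 'a::euclidean_space \<Rightarrow> 'a"
  assumes T: "0 \<le> T" and K: "0 < K"
    and lip: "\<And>t x y. t \<in> {0..T} \<Longrightarrow> norm (f t x - f t y) \<le> K * norm (x - y)"
    and cont: "\<And>x. continuous_on {0..T} x \<Longrightarrow> continuous_on {0..T} (\<lambda>t. f t (x t))"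
  obtains x where "x 0 = z" "\<And>t. t \<in> {0..T} \<Longrightarrow> (x has_vector_derivative f t (x t)) (at t within {0..T})"
proof -
  obtain x where x: "continuous_on {0..T} x" "\<And>t. t \<in> {0..T} \<Longrightarrow> x t = z + integral {0..t} (\<lambda>s. f s (x s))"
  proof (rule picard_invariant[where T = T and K = K and C = "\<lambda>_. UNIV" and f = f and z = z and ?x0.0 = "\<lambda>_. 0"])
    show "norm (f t x - f t y) \<le> K * norm (x - y)" if "t \<in> {0..T}" for t x y by (rule lip[OF that])
    show "continuous_on {0..T} (\<lambda>t. f t (x t))" if "continuous_on {0..T} x" for x by (rule cont[OF that])
  qed (use T K in auto)
  show thesis
  proof (rule that[of x])
    show "x 0 = z" using x(2)[of 0] T by simp
    fix t assume t: "t \<in> {0..T}"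
    show "(x has_vector_derivative f t (x t)) (at t within {0..T})"
    proof (rule has_vector_derivative_transform[OF t])
      show "x s = z + integral {0..s} (\<lambda>s. f s (x s))" if "s \<in> {0..T}" for s by (rule x(2)[OF that])
      show "((\<lambda>s. z + integral {0..s} (\<lambda>s. f s (x s))) has_vector_derivative f t (x t)) (at t within {0..T})"
        using has_vector_derivative_add[OF has_vector_derivative_const
            integral_has_vector_derivative[OF cont[OF x(1)] t], of z] by simp
    qed
  qed
qed

text \<open>
  The inverse of the fundamental matrix solves the adjoint equation. It is obtained as a separate solution,
  whose product with the fundamental matrix has derivative zero.
\<close>

lemma fundamental_matrix:
  fixes C :: "real \<Rightarrow> real^'n^'n"
  assumes T: "0 \<le> T" and C: "continuous_on {0..T} C"
  obtains \<Phi> \<Psi> where "\<Phi> 0 = mat 1"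
    "\<And>t. t \<in> {0..T} \<Longrightarrow> (\<Phi> has_vector_derivative C t ** \<Phi> t) (at t within {0..T})"
    "continuous_on {0..T} \<Phi>" "continuous_on {0..T} \<Psi>"
    "\<And>t. t \<in> {0..T} \<Longrightarrow> \<Phi> t ** \<Psi> t = mat 1"
proof -
  note mm = bounded_bilinear_matrix_matrix[where 'n = 'n and 'm = 'n and 'p = 'n]
  obtain K where K: "0 < K" "\<And>t (A :: real^'n^'n). t \<in> {0..T} \<Longrightarrow> norm (C t ** A) \<le> K * norm A"
    by (rule continuous_bilinear_bound[OF mm C]) (rule that)
  obtain K' where K': "0 < K'" "\<And>t (A :: real^'n^'n). t \<in> {0..T} \<Longrightarrow> norm (A ** C t) \<le> K' * norm A"
    by (rule continuous_bilinear_bound[OF bounded_bilinear.flip[OF mm] C]) (rule that)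
  obtain \<Phi> where \<Phi>: "\<Phi> 0 = mat 1"
    "\<And>t. t \<in> {0..T} \<Longrightarrow> (\<Phi> has_vector_derivative C t ** \<Phi> t) (at t within {0..T})"
  proof (rule linear_ode_exists[OF T K(1), where f = "\<lambda>t A. C t ** A" and z = "mat 1"])
    fix t and A B :: "real^'n^'n" assume t: "t \<in> {0..T}"
    show "norm (C t ** A - C t ** B) \<le> K * norm (A - B)"
      using K(2)[OF t, of "A - B"] by (simp add: bounded_bilinear.diff_right[OF mm])
  next
    fix x :: "real \<Rightarrow> real^'n^'n" assume "continuous_on {0..T} x"
    then show "continuous_on {0..T} (\<lambda>t. C t ** x t)" by (rule bounded_bilinear.continuous_on[OF mm C])
  qed blast
  obtain \<Psi> where \<Psi>: "\<Psi> 0 = mat 1"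
    "\<And>t. t \<in> {0..T} \<Longrightarrow> (\<Psi> has_vector_derivative - (\<Psi> t ** C t)) (at t within {0..T})"
  proof (rule linear_ode_exists[OF T K'(1), where f = "\<lambda>t A. - (A ** C t)" and z = "mat 1"])
    fix t and A B :: "real^'n^'n" assume t: "t \<in> {0..T}"
    show "norm (- (A ** C t) - - (B ** C t)) \<le> K' * norm (A - B)"
      using K'(2)[OF t, of "A - B"] by (simp add: bounded_bilinear.diff_left[OF mm] norm_minus_commute)
  next
    fix x :: "real \<Rightarrow> real^'n^'n" assume "continuous_on {0..T} x"
    then show "continuous_on {0..T} (\<lambda>t. - (x t ** C t))"
      by (intro continuous_on_minus bounded_bilinear.continuous_on[OF mm _ C])
  qed blast
  obtain c0 where c0: "\<And>t. t \<in> {0..T} \<Longrightarrow> \<Psi> t ** \<Phi> t = c0"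
  proof (rule has_vector_derivative_zero_constant[of "{0..T}" "\<lambda>t. \<Psi> t ** \<Phi> t"])
    fix t assume t: "t \<in> {0..T}"
    show "((\<lambda>t. \<Psi> t ** \<Phi> t) has_vector_derivative 0) (at t within {0..T})"
      using bounded_bilinear.has_vector_derivative[OF mm \<Psi>(2)[OF t] \<Phi>(2)[OF t]]
      by (simp add: matrix_mul_assoc bounded_bilinear.minus_left[OF mm])
  qed (auto intro: that)
  have "c0 = mat 1" using c0[of 0] \<Phi>(1) \<Psi>(1) T by simp
  then have inv: "\<Psi> t ** \<Phi> t = mat 1" if "t \<in> {0..T}" for t
    using c0[OF that] by simp
  show thesis
  proof (rule that[of \<Phi> \<Psi>])
    show "\<Phi> t ** \<Psi> t = mat 1" if "t \<in> {0..T}" for t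
      using inv[OF that] matrix_left_right_inverse by blast
    show "continuous_on {0..T} \<Phi>" by (rule continuous_on_vector_derivative[OF \<Phi>(2)])
    show "continuous_on {0..T} \<Psi>" by (rule continuous_on_vector_derivative[OF \<Psi>(2)])
  qed (use \<Phi> in blast)+
qed

lemma primitive_on_cong:
  assumes u: "primitive_on T u f" and "\<And>t. t \<in> {0..T} \<Longrightarrow> u t = v t" "\<And>t. t \<in> {0..T} \<Longrightarrow> f t = g t"
  shows "primitive_on T v g"
  unfolding primitive_on_def
proof (intro conjI ballI)
  have "set_integrable lborel {0..T} f = set_integrable lborel {0..T} g"
    by (rule set_integrable_cong) (use assms(3) in auto)
  then show "set_integrable lborel {0..T} g" using u unfolding primitive_on_def by blast
  fix t assume t: "t \<in> {0..T}"
  have "(LBINT s:{0..t}. f s) = (LBINT s:{0..t}. g s)"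
    by (rule set_lebesgue_integral_cong) (use t assms(3) in auto)
  moreover have "u 0 = v 0" "u t = v t" using t assms(2) by auto
  ultimately show "v t = v 0 + (LBINT s:{0..t}. g s)" using primitive_onD(2)[OF u t]
    by (simp add: diff_eq_eq add.commute)
qed

text \<open>
  The path \<open>x\<close> solves \<open>dx = (C x + h) dt + \<sigma> dv\<close>, where subtracting \<open>\<sigma> v\<close> leaves an integral equation.
\<close>

definition linear_path :: "real \<Rightarrow> real \<Rightarrow> (real \<Rightarrow> real^'n^'n) \<Rightarrow> (real \<Rightarrow> real^'n) \<Rightarrow> real^'n \<Rightarrow>
    (real \<Rightarrow> real^'n) \<Rightarrow> (real \<Rightarrow> real^'n) \<Rightarrow> bool" where
  "linear_path T \<sigma> C h x0 v x \<longleftrightarrow>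
     primitive_on T (\<lambda>t. x t - \<sigma> *\<^sub>R v t) (\<lambda>s. C s *v x s + h s) \<and> x 0 - \<sigma> *\<^sub>R v 0 = x0"

text \<open>
  Variation of constants for \<open>z = x - \<sigma> v\<close>, which solves \<open>z' = C z + (h + \<sigma> C v)\<close>. The explicit formula makes
  measurability of the solution in the noise evident.
\<close>

lemma linear_path_solution:
  assumes T: "0 \<le> T" and C: "continuous_on {0..T} C"
    and \<Phi>: "\<Phi> 0 = mat 1" "\<And>t. t \<in> {0..T} \<Longrightarrow> (\<Phi> has_vector_derivative C t ** \<Phi> t) (at t within {0..T})"
      "continuous_on {0..T} \<Phi>" "continuous_on {0..T} \<Psi>" "\<And>t. t \<in> {0..T} \<Longrightarrow> \<Phi> t ** \<Psi> t = mat 1"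
    and h: "set_integrable lborel {0..T} h" and v: "continuous_on {0..T} v"
  shows "linear_path T \<sigma> C h x0 v
    (\<lambda>t. \<Phi> t *v (x0 + (LBINT s:{0..t}. \<Psi> s *v (h s + \<sigma> *\<^sub>R (C s *v v s)))) + \<sigma> *\<^sub>R v t)"
proof -
  note mv = bounded_bilinear_matrix_vector[where 'n = 'a and 'm = 'a]
  note mm = bounded_bilinear_matrix_matrix[where 'n = 'a and 'm = 'a and 'p = 'a]
  define m where "m s = \<Psi> s *v (h s + \<sigma> *\<^sub>R (C s *v v s))" for s
  define y where "y t = x0 + (LBINT s:{0..t}. m s)" for t
  define k where "k s = h s + \<sigma> *\<^sub>R (C s *v v s)" for s
  have k: "set_integrable lborel {0..T} k"
    unfolding k_def
    by (intro set_integral_add h set_integrable_continuous continuous_intros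
        bounded_bilinear.continuous_on[OF mv] C v)
  obtain b where b: "0 < b" "\<And>t x. t \<in> {0..T} \<Longrightarrow> norm (\<Psi> t *v x) \<le> b * norm x"
    by (rule continuous_bilinear_bound[OF mv \<Phi>(4)]) (rule that)
  have m: "set_integrable lborel {0..T} m"
    unfolding set_integrable_def
  proof (rule Bochner_Integration.integrable_bound)
    show "integrable lborel (\<lambda>s. b * norm (indicator {0..T} s *\<^sub>R k s))"
      using k unfolding set_integrable_def by (intro integrable_mult_right integrable_norm)
    have e: "indicator {0..T} s *\<^sub>R m s = (indicator {0..T} s *\<^sub>R \<Psi> s) *v (indicator {0..T} s *\<^sub>R k s)" for s
      by (auto simp: indicator_def m_def k_def)
    have "(\<lambda>s. indicator {0..T} s *\<^sub>R \<Psi> s) \<in> borel_measurable lborel"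
      using set_integrable_continuous[OF \<Phi>(4)] unfolding set_integrable_def by auto
    moreover have "(\<lambda>s. indicator {0..T} s *\<^sub>R k s) \<in> borel_measurable lborel"
      using k unfolding set_integrable_def by auto
    ultimately show "(\<lambda>s. indicator {0..T} s *\<^sub>R m s) \<in> borel_measurable lborel"
      unfolding e by (rule bounded_bilinear_measurable[OF mv])
    show "AE s in lborel. norm (indicator {0..T} s *\<^sub>R m s) \<le> norm (b * norm (indicator {0..T} s *\<^sub>R k s))"
      using b(1,2) by (auto simp: indicator_def m_def k_def)
  qed
  have y0: "y 0 = x0"
  proof -
    have "set_integrable lborel {0..0} m" by (rule set_integrable_subset[OF m]) (use T in auto)
    then have "(LBINT s:{0..0}. m s) = integral {0..0} m" by (rule set_borel_integral_eq_integral(2))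
    also have "\<dots> = 0" by simp
    finally show ?thesis by (simp only: y_def add_0_right)
  qed
  have y: "primitive_on T y m"
    unfolding primitive_on_def y0 by (intro conjI m ballI) (rule y_def)
  have "primitive_on T \<Phi> (\<lambda>t. C t ** \<Phi> t)"
    by (rule primitive_on_C1[OF \<Phi>(2)]) (auto intro: bounded_bilinear.continuous_on[OF mm C \<Phi>(3)])
  from primitive_on_product[OF mv this y]
  have P: "primitive_on T (\<lambda>t. \<Phi> t *v y t) (\<lambda>t. (C t ** \<Phi> t) *v y t + \<Phi> t *v m t)" .
  have d: "(C t ** \<Phi> t) *v y t + \<Phi> t *v m t = C t *v (\<Phi> t *v y t + \<sigma> *\<^sub>R v t) + h t" if "t \<in> {0..T}" for t
  proof -
    have "\<Phi> t *v m t = (\<Phi> t ** \<Psi> t) *v k t" by (simp add: m_def k_def matrix_vector_mul_assoc)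
    also have "\<dots> = k t" by (simp add: \<Phi>(5)[OF that])
    finally show ?thesis
      by (simp add: k_def matrix_vector_right_distrib matrix_vector_mul_assoc matrix_vector_mult_scaleR)
  qed
  have "primitive_on T (\<lambda>t. \<Phi> t *v y t) (\<lambda>t. C t *v (\<Phi> t *v y t + \<sigma> *\<^sub>R v t) + h t)"
    by (rule primitive_on_cong[OF P]) (use d in auto)
  then show ?thesis
    unfolding linear_path_def using y0 \<Phi>(1) by (simp add: y_def m_def)
qed

text \<open>
  The bound involves the noise through its value at the current time and its square integral over time, so
  square integrability of the solution follows from the second moments of the noise at fixed times.
\<close>

lemma linear_path_bound:
  fixes C :: "real \<Rightarrow> real^'n^'n"
  assumes T: "0 < T" and C: "continuous_on {0..T} C"
  obtains c where "0 \<le> c"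
    "\<And>h x0 v x t. linear_path T \<sigma> C h x0 v x \<Longrightarrow> continuous_on {0..T} v \<Longrightarrow>
       set_integrable lborel {0..T} (\<lambda>s. (norm (h s))\<^sup>2) \<Longrightarrow> t \<in> {0..T} \<Longrightarrow>
       (norm (x t))\<^sup>2 \<le> c * ((norm x0)\<^sup>2 + (LBINT s:{0..T}. (norm (v s))\<^sup>2 + (norm (h s))\<^sup>2) + (norm (v t))\<^sup>2)"
proof -
  note mv = bounded_bilinear_matrix_vector[where 'n = 'n and 'm = 'n]
  obtain K where K: "0 < K" "\<And>t x. t \<in> {0..T} \<Longrightarrow> norm (C t *v x) \<le> K * norm x"
    by (rule continuous_bilinear_bound[OF mv C]) (rule that)
  define E where "E = 2 * exp (2 * K * T)"
  define d where "d = 1 + T + T * (K * \<bar>\<sigma>\<bar>)\<^sup>2"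
  define c where "c = 2 * E\<^sup>2 * (3 * d) + 2 * \<sigma>\<^sup>2"
  show thesis
  proof (rule that[of c])
    show c0: "0 \<le> c" using T by (auto simp: c_def d_def intro!: add_nonneg_nonneg mult_nonneg_nonneg)
    fix h x0 v x t
    assume lp: "linear_path T \<sigma> C h x0 v x" and v: "continuous_on {0..T} v"
      and h2: "set_integrable lborel {0..T} (\<lambda>s. (norm (h s))\<^sup>2)" and t: "t \<in> {0..T}"
    define z where "z t = x t - \<sigma> *\<^sub>R v t" for t
    have P: "primitive_on T z (\<lambda>s. C s *v x s + h s)" and z0: "z 0 = x0"
      using lp by (auto simp: linear_path_def z_def[abs_def])
    have zc: "continuous_on {0..T} z" by (rule primitive_on_continuous[OF P])
    have xe: "x = (\<lambda>t. z t + \<sigma> *\<^sub>R v t)" by (auto simp: z_def)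
    have xc: "continuous_on {0..T} x" unfolding xe by (intro continuous_intros zc v)
    have hi: "set_integrable lborel {0..T} h"
    proof -
      have "set_integrable lborel {0..T} (\<lambda>s. C s *v x s + h s)"
        using P unfolding primitive_on_def by blast
      from set_integral_diff(1)[OF this set_integrable_continuous[OF bounded_bilinear.continuous_on[OF mv C xc]]]
      have "set_integrable lborel {0..T} (\<lambda>s. (C s *v x s + h s) - C s *v x s)" .
      then show ?thesis by simp
    qed
    have hn: "set_integrable lborel {0..T} (\<lambda>s. norm (h s))" using set_integrable_norm[OF hi] .
    have vn: "set_integrable lborel {0..T} (\<lambda>s. norm (v s))"
      by (intro set_integrable_continuous continuous_intros v)
    have vn2: "set_integrable lborel {0..T} (\<lambda>s. (norm (v s))\<^sup>2)"
      by (intro set_integrable_continuous continuous_intros v)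
    define Iv where "Iv = (LBINT s:{0..T}. norm (v s))"
    define Ih where "Ih = (LBINT s:{0..T}. norm (h s))"
    define A where "A = norm x0 + (K * \<bar>\<sigma>\<bar>) * Iv + Ih"
    have Iv0: "0 \<le> Iv" and Ih0: "0 \<le> Ih"
      by (auto simp: Iv_def Ih_def set_lebesgue_integral_def intro!: integral_nonneg_AE)
    have A0: "0 \<le> A" using Iv0 Ih0 K by (simp add: A_def)
    have main: "norm (z s) \<le> A * exp (2 * K * s) + K * integral {0..s} (\<lambda>s. norm (z s))" if s: "s \<in> {0..T}" for s
    proof -
      have sub: "{0..s} \<subseteq> {0..T}" using s by auto
      have mono: "(LBINT r:{0..s}. f r) \<le> (LBINT r:{0..T}. f r)"
        if "set_integrable lborel {0..T} f" "\<And>r. 0 \<le> f r" for f :: "real \<Rightarrow> real"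
        using that sub unfolding set_lebesgue_integral_def
        by (intro integral_mono set_integrable_subset[OF that(1), unfolded set_integrable_def])
           (auto simp: set_integrable_def indicator_def)
      have zi: "set_integrable lborel {0..s} (\<lambda>r. norm (z r))"
        by (intro set_integrable_continuous continuous_intros continuous_on_subset[OF zc sub])
      have vi: "set_integrable lborel {0..s} (\<lambda>r. norm (v r))"
        and hi': "set_integrable lborel {0..s} (\<lambda>r. norm (h r))"
        using set_integrable_subset[OF vn _ sub] set_integrable_subset[OF hn _ sub] by auto
      have fi: "set_integrable lborel {0..s} (\<lambda>r. C r *v x r + h r)"
        by (rule primitive_onD(1)[OF P s])
      have "norm (z s) \<le> norm x0 + norm (LBINT r:{0..s}. C r *v x r + h r)"
        using primitive_onD(2)[OF P s] z0 norm_triangle_ineq[of x0 "z s - x0"] by simp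
      also have "norm (LBINT r:{0..s}. C r *v x r + h r) \<le> (LBINT r:{0..s}. norm (C r *v x r + h r))"
        by (rule set_integral_norm_bound[OF fi])
      also have "\<dots> \<le> (LBINT r:{0..s}. (K * norm (z r) + (K * \<bar>\<sigma>\<bar>) * norm (v r)) + norm (h r))"
      proof (rule set_integral_mono)
        show "set_integrable lborel {0..s} (\<lambda>r. norm (C r *v x r + h r))" by (rule set_integrable_norm[OF fi])
        show "set_integrable lborel {0..s} (\<lambda>r. (K * norm (z r) + (K * \<bar>\<sigma>\<bar>) * norm (v r)) + norm (h r))"
          by (intro set_integral_add set_integrable_mult_right zi vi hi')
        fix r assume "r \<in> {0..s}"
        then have r: "r \<in> {0..T}" using sub by auto
        have "norm (x r) \<le> norm (z r) + \<bar>\<sigma>\<bar> * norm (v r)"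
          unfolding xe using norm_triangle_ineq[of "z r" "\<sigma> *\<^sub>R v r"] by simp
        then have "K * norm (x r) \<le> K * (norm (z r) + \<bar>\<sigma>\<bar> * norm (v r))" using K by (intro mult_left_mono) auto
        then show "norm (C r *v x r + h r) \<le> (K * norm (z r) + (K * \<bar>\<sigma>\<bar>) * norm (v r)) + norm (h r)"
          using norm_triangle_ineq[of "C r *v x r" "h r"] K(2)[OF r, of "x r"] by (simp add: algebra_simps)
      qed
      also have "\<dots> = (K * (LBINT r:{0..s}. norm (z r)) + (K * \<bar>\<sigma>\<bar>) * (LBINT r:{0..s}. norm (v r))) + (LBINT r:{0..s}. norm (h r))"
        using zi vi hi' by (simp add: set_integral_add)
      also have "\<dots> \<le> (K * (LBINT r:{0..s}. norm (z r)) + (K * \<bar>\<sigma>\<bar>) * Iv) + Ih"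
        using mono[OF vn] mono[OF hn] K unfolding Iv_def Ih_def
        by (intro add_mono mult_left_mono order_refl) auto
      also have "(LBINT r:{0..s}. norm (z r)) = integral {0..s} (\<lambda>s. norm (z s))"
        by (rule set_borel_integral_eq_integral(2)[OF zi])
      finally have "norm (z s) \<le> A * 1 + K * integral {0..s} (\<lambda>s. norm (z s))" by (simp add: A_def)
      also have "A * 1 \<le> A * exp (2 * K * s)" using A0 K s by (intro mult_left_mono) auto
      finally show ?thesis by simp
    qed
    have zb: "norm (z t) \<le> 2 * A * exp (2 * K * t)"
      by (rule gronwall_weighted[OF _ _ _ _ A0 main t])
         (use K in \<open>auto intro!: continuous_intros zc\<close>)
    also have "\<dots> \<le> 2 * A * exp (2 * K * T)" using A0 K t by (intro mult_left_mono) auto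
    finally have zE: "norm (z t) \<le> E * A" by (simp add: E_def mult_ac)
    define J where "J = (LBINT s:{0..T}. (norm (v s))\<^sup>2 + (norm (h s))\<^sup>2)"
    have Jsplit: "J = (LBINT s:{0..T}. (norm (v s))\<^sup>2) + (LBINT s:{0..T}. (norm (h s))\<^sup>2)"
      unfolding J_def by (rule set_integral_add[OF vn2 h2])
    have J1: "0 \<le> (LBINT s:{0..T}. (norm (v s))\<^sup>2)" and J2: "0 \<le> (LBINT s:{0..T}. (norm (h s))\<^sup>2)"
      by (auto simp: set_lebesgue_integral_def intro!: integral_nonneg_AE)
    have "Iv\<^sup>2 \<le> T * (LBINT s:{0..T}. (norm (v s))\<^sup>2)" unfolding Iv_def by (rule square_integral_le[OF T vn vn2])
    also have "\<dots> \<le> T * J" using T Jsplit J1 J2 by (intro mult_left_mono) auto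
    finally have IvJ: "Iv\<^sup>2 \<le> T * J" .
    have "Ih\<^sup>2 \<le> T * (LBINT s:{0..T}. (norm (h s))\<^sup>2)" unfolding Ih_def by (rule square_integral_le[OF T hn h2])
    also have "\<dots> \<le> T * J" using T Jsplit J1 J2 by (intro mult_left_mono) auto
    finally have IhJ: "Ih\<^sup>2 \<le> T * J" .
    have J0: "0 \<le> J" using Jsplit J1 J2 by simp
    have three: "(a + b + e)\<^sup>2 \<le> 3 * (a\<^sup>2 + b\<^sup>2 + e\<^sup>2)" for a b e :: real
    proof -
      have "0 \<le> (a - b)\<^sup>2 + (b - e)\<^sup>2 + (a - e)\<^sup>2" by simp
      then show ?thesis by (simp add: power2_eq_square algebra_simps)
    qed
    have "A\<^sup>2 \<le> 3 * ((norm x0)\<^sup>2 + ((K * \<bar>\<sigma>\<bar>) * Iv)\<^sup>2 + Ih\<^sup>2)" unfolding A_def by (rule three)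
    also have "\<dots> \<le> 3 * ((norm x0)\<^sup>2 + (K * \<bar>\<sigma>\<bar>)\<^sup>2 * (T * J) + T * J)"
      using IvJ IhJ by (intro mult_left_mono add_mono order_refl) (auto simp: power_mult_distrib intro!: mult_left_mono)
    also have "\<dots> \<le> 3 * (d * ((norm x0)\<^sup>2 + J))"
    proof -
      have "0 \<le> (T + T * (K * \<bar>\<sigma>\<bar>)\<^sup>2) * (norm x0)\<^sup>2 + J" using T J0 by (intro add_nonneg_nonneg mult_nonneg_nonneg) auto
      then show ?thesis by (simp add: d_def algebra_simps)
    qed
    finally have A2: "A\<^sup>2 \<le> 3 * (d * ((norm x0)\<^sup>2 + J))" .
    have "(norm (z t))\<^sup>2 \<le> (E * A)\<^sup>2" using zE by (intro power_mono) auto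
    also have "\<dots> = E\<^sup>2 * A\<^sup>2" by (simp add: power_mult_distrib)
    also have "\<dots> \<le> E\<^sup>2 * (3 * (d * ((norm x0)\<^sup>2 + J)))" using A2 by (intro mult_left_mono) auto
    finally have z2: "(norm (z t))\<^sup>2 \<le> E\<^sup>2 * (3 * d) * ((norm x0)\<^sup>2 + J)" by (simp only: mult.assoc)
    have "norm (x t) \<le> norm (z t) + \<bar>\<sigma>\<bar> * norm (v t)"
      unfolding xe using norm_triangle_ineq[of "z t" "\<sigma> *\<^sub>R v t"] by simp
    then have "(norm (x t))\<^sup>2 \<le> (norm (z t) + \<bar>\<sigma>\<bar> * norm (v t))\<^sup>2" by (intro power_mono) auto
    also have "\<dots> \<le> 2 * (norm (z t))\<^sup>2 + 2 * (\<bar>\<sigma>\<bar> * norm (v t))\<^sup>2"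
      using zero_le_power2[of "norm (z t) - \<bar>\<sigma>\<bar> * norm (v t)"] by (simp add: power2_eq_square algebra_simps)
    also have "\<dots> \<le> 2 * (E\<^sup>2 * (3 * d) * ((norm x0)\<^sup>2 + J)) + 2 * \<sigma>\<^sup>2 * (norm (v t))\<^sup>2"
    proof -
      have "(\<bar>\<sigma>\<bar> * norm (v t))\<^sup>2 = \<sigma>\<^sup>2 * (norm (v t))\<^sup>2" by (simp add: power_mult_distrib)
      with z2 show ?thesis by linarith
    qed
    also have "\<dots> \<le> c * ((norm x0)\<^sup>2 + J + (norm (v t))\<^sup>2)"
    proof -
      have "0 \<le> 2 * E\<^sup>2 * (3 * d) * (norm (v t))\<^sup>2 + 2 * \<sigma>\<^sup>2 * ((norm x0)\<^sup>2 + J)"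
        using T J0 by (intro add_nonneg_nonneg mult_nonneg_nonneg) (auto simp: d_def)
      then show ?thesis by (simp add: c_def algebra_simps)
    qed
    finally show "(norm (x t))\<^sup>2 \<le> c * ((norm x0)\<^sup>2 + (LBINT s:{0..T}. (norm (v s))\<^sup>2 + (norm (h s))\<^sup>2) + (norm (v t))\<^sup>2)"
      by (simp add: J_def)
  qed
qed

section \<open>Progressive measurability and square integrability\<close>

context brownian_family
begin

abbreviation prog :: "real \<Rightarrow> (real \<Rightarrow> 'w \<Rightarrow> 'b::topological_space) \<Rightarrow> bool" where
  "prog T X \<equiv> progressively_measurable T FF X"

lemma progI:
  assumes "\<And>t. t \<in> {0..T} \<Longrightarrow> (\<lambda>p. X (fst p) (snd p)) \<in> borel_measurable (restrict_space borel {0..t} \<Otimes>\<^sub>M FF t)"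
  shows "prog T X"
  using assms by (simp add: progressively_measurable_def case_prod_unfold)

lemma progD:
  assumes "prog T X" "t \<in> {0..T}"
  shows "(\<lambda>p. X (fst p) (snd p)) \<in> borel_measurable (restrict_space borel {0..t} \<Otimes>\<^sub>M FF t)"
  using assms by (simp add: progressively_measurable_def case_prod_unfold)

lemma prog_deterministic:
  fixes f :: "real \<Rightarrow> 'b::topological_space"
  assumes "continuous_on {0..T} f" shows "prog T (\<lambda>t \<omega>. f t)"
proof (rule progI)
  fix t assume "t \<in> {0..T}"
  then have "f \<in> borel_measurable (restrict_space borel {0..t})"
    by (intro borel_measurable_continuous_on_restrict continuous_on_subset[OF assms]) auto
  then show "(\<lambda>p. f (fst p)) \<in> borel_measurable (restrict_space borel {0..t} \<Otimes>\<^sub>M FF t)"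
    by (rule measurable_compose[OF measurable_fst])
qed

lemma prog_compose2:
  fixes X :: "real \<Rightarrow> 'w \<Rightarrow> 'b::second_countable_topology" and Y :: "real \<Rightarrow> 'w \<Rightarrow> 'c::second_countable_topology"
    and H :: "'b \<Rightarrow> 'c \<Rightarrow> 'd::topological_space"
  assumes "prog T X" "prog T Y"
    and "continuous_on UNIV (\<lambda>x. H (fst x) (snd x))"
  shows "prog T (\<lambda>t \<omega>. H (X t \<omega>) (Y t \<omega>))"
  by (rule progI, rule borel_measurable_continuous_Pair[OF progD[OF assms(1)] progD[OF assms(2)] assms(3)])

lemma prog_compose:
  fixes X :: "real \<Rightarrow> 'w \<Rightarrow> 'b::topological_space" and H :: "'b \<Rightarrow> 'd::topological_space"
  assumes "prog T X" "continuous_on UNIV H"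
  shows "prog T (\<lambda>t \<omega>. H (X t \<omega>))"
  by (rule progI, rule borel_measurable_continuous_on[OF assms(2) progD[OF assms(1)]])

lemma prog_add:
  fixes X Y :: "real \<Rightarrow> 'w \<Rightarrow> 'b::euclidean_space"
  assumes "prog T X" "prog T Y"
  shows "prog T (\<lambda>t \<omega>. X t \<omega> + Y t \<omega>)"
  by (rule prog_compose2[OF assms]) (intro continuous_intros)

lemma prog_scaleR:
  fixes X :: "real \<Rightarrow> 'w \<Rightarrow> 'b::euclidean_space"
  assumes "prog T X"
  shows "prog T (\<lambda>t \<omega>. c *\<^sub>R X t \<omega>)"
  by (rule prog_compose[OF assms]) (intro continuous_intros)

lemma prog_diff:
  assumes "prog T f" "prog T g"
  shows "prog T (\<lambda>t \<omega>. (f t \<omega> :: real) - g t \<omega>)"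
  by (rule prog_compose2[OF assms]) (intro continuous_intros)

lemma prog_scaleR_vector:
  assumes "prog T f"
  shows "prog T (\<lambda>t \<omega>. (f t \<omega> :: real) *\<^sub>R (v :: real^'k))"
  by (rule prog_compose[OF assms]) (intro continuous_intros)

lemma prog_matrix_vector:
  fixes C :: "real \<Rightarrow> real^'k^'m" and X :: "real \<Rightarrow> 'w \<Rightarrow> real^'k"
  assumes "continuous_on {0..T} C" "prog T X"
  shows "prog T (\<lambda>t \<omega>. C t *v X t \<omega>)"
  by (rule prog_compose2[OF prog_deterministic[OF assms(1)] assms(2)])
     (intro bounded_bilinear.continuous_on[OF bounded_bilinear_matrix_vector] continuous_intros)

lemma prog_vec_nth:
  fixes X :: "real \<Rightarrow> 'w \<Rightarrow> real^'k"
  assumes "prog T X"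
  shows "prog T (\<lambda>t \<omega>. X t \<omega> $ i)"
  by (rule prog_compose[OF assms]) (intro continuous_intros)

lemma prog_vecI:
  fixes X :: "real \<Rightarrow> 'w \<Rightarrow> real^'k"
  assumes "\<And>i. prog T (\<lambda>t \<omega>. X t \<omega> $ i)"
  shows "prog T X"
  by (rule progI, rule borel_measurable_vecI, rule progD[OF assms])

text \<open>
  The value at time \<open>s\<close> is the limit of the values at the last grid points not after \<open>s\<close>. These belong to the
  past of \<open>s\<close>, and each approximation has countably many values of the time argument.
\<close>

lemma prog_W: "prog T (W j)"
proof (rule progI)
  fix t assume t: "t \<in> {0..T}"
  define N where "N = restrict_space borel {0..t} \<Otimes>\<^sub>M FF t"
  \<comment> \<open>Truncation to \<open>[0, t]\<close> keeps also the grid points that are not used measurable at time \<open>t\<close>.\<close>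
  define r where "r n (k :: int) = max 0 (min t (real_of_int k / real (Suc n)))" for n k
  define g where "g n p = W j (r n \<lfloor>fst p * real (Suc n)\<rfloor>) (snd p)" for n and p :: "real \<times> 'w"
  show "(\<lambda>p. W j (fst p) (snd p)) \<in> borel_measurable (restrict_space borel {0..t} \<Otimes>\<^sub>M FF t)"
    unfolding N_def[symmetric]
  proof (rule borel_measurable_LIMSEQ_metric)
    fix n
    have fst_m: "fst \<in> borel_measurable N"
      unfolding N_def by (rule measurable_compose[OF measurable_fst]) (simp add: measurable_restrict_space1)
    have fl: "(\<lambda>p. \<lfloor>fst p * real (Suc n)\<rfloor>) \<in> measurable N (count_space UNIV)"
      using fst_m by (intro measurable_compose[OF _ measurable_real_floor] borel_measurable_times) auto
    have Wm: "(\<lambda>p. W j (r n k) (snd p)) \<in> borel_measurable N" for k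
      unfolding N_def by (rule measurable_compose[OF measurable_snd], rule W_FF) (use t in \<open>auto simp: r_def\<close>)
    show "g n \<in> borel_measurable N"
      unfolding g_def
      by (rule measurable_compose_countable[where f = "\<lambda>k p. W j (r n k) (snd p)", OF Wm fl])
  next
    fix p assume p: "p \<in> space N"
    then obtain s \<omega> where [simp]: "p = (s, \<omega>)" and s: "s \<in> {0..t}" and \<omega>: "\<omega> \<in> space M"
      by (cases p) (auto simp: N_def space_pair_measure space_restrict_space)
    have close: "\<bar>r n \<lfloor>s * real (Suc n)\<rfloor> - s\<bar> \<le> inverse (real (Suc n))" for n
    proof -
      define k where "k = \<lfloor>s * real (Suc n)\<rfloor>"
      have k0: "0 \<le> k" using s by (simp add: k_def)
      have k1: "real_of_int k \<le> s * real (Suc n)" "s * real (Suc n) \<le> real_of_int k + 1"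
        unfolding k_def by linarith+
      have l: "real_of_int k / real (Suc n) \<le> s" using k1 by (simp add: divide_le_eq)
      have "s \<le> (real_of_int k + 1) / real (Suc n)" using k1 by (simp add: le_divide_eq)
      then have u: "s \<le> real_of_int k / real (Suc n) + inverse (real (Suc n))"
        by (simp add: add_divide_distrib inverse_eq_divide)
      have "0 \<le> real_of_int k / real (Suc n)" using k0 by simp
      moreover have "real_of_int k / real (Suc n) \<le> t" using l s by simp
      ultimately have "r n k = real_of_int k / real (Suc n)" by (simp add: r_def)
      then show ?thesis using l u unfolding k_def[symmetric] by linarith
    qed
    have lim0: "(\<lambda>n. r n \<lfloor>s * real (Suc n)\<rfloor> - s) \<longlonglongrightarrow> 0"
      by (rule Lim_null_comparison[OF always_eventually LIMSEQ_inverse_real_of_nat]) (simp add: close del: of_nat_Suc)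
    have lim: "(\<lambda>n. r n \<lfloor>s * real (Suc n)\<rfloor>) \<longlonglongrightarrow> s"
      by (rule LIM_zero_cancel[OF lim0])
    have "(\<lambda>n. W j (r n \<lfloor>s * real (Suc n)\<rfloor>) \<omega>) \<longlonglongrightarrow> W j s \<omega>"
      by (rule continuous_on_tendsto_compose[OF W_cont[OF \<omega>] lim]) (use s in \<open>auto simp: r_def\<close>)
    then show "(\<lambda>n. g n p) \<longlonglongrightarrow> W j (fst p) (snd p)" by (simp add: g_def del: of_nat_Suc)
  qed
qed

definition noise :: "real \<Rightarrow> 'w \<Rightarrow> real^'n" where "noise t \<omega> = (\<chi> j. W j t \<omega>)"

lemma prog_noise: "prog T noise"
  by (rule prog_vecI) (simp add: noise_def prog_W)

lemma noise_cont: "\<omega> \<in> space M \<Longrightarrow> continuous_on {0..T} (\<lambda>t. noise t \<omega>)"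
  unfolding noise_def by (intro continuous_intros continuous_on_subset[OF W_cont]) auto

text \<open>
  Measurability of parameter integrals. The time argument is clamped to \<open>[0, t]\<close> because nothing is known
  about the process outside of this interval; the indicator of \<open>[0, u]\<close> removes the clamped values.
\<close>

lemma prog_integral:
  fixes X :: "real \<Rightarrow> 'w \<Rightarrow> real^'k"
  assumes X: "prog T X"
  shows "prog T (\<lambda>t \<omega>. LBINT s:{0..t}. X s \<omega>)"
proof (rule progI)
  fix t assume t: "t \<in> {0..T}"
  define N where "N = restrict_space borel {0..t} \<Otimes>\<^sub>M FF t"
  define c where "c s = max 0 (min s t)" for s :: real
  have cm: "(\<lambda>q. (c (snd q), snd (fst q))) \<in> measurable (N \<Otimes>\<^sub>M lborel) N"
    unfolding N_def
  proof (intro measurable_Pair measurable_restrict_space2)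
    show "(\<lambda>q. c (snd q)) \<in> space ((restrict_space borel {0..t} \<Otimes>\<^sub>M FF t) \<Otimes>\<^sub>M lborel) \<rightarrow> {0..t}"
      using t by (auto simp: c_def)
    show "(\<lambda>q. c (snd q)) \<in> borel_measurable ((restrict_space borel {0..t} \<Otimes>\<^sub>M FF t) \<Otimes>\<^sub>M lborel)"
      unfolding c_def by measurable
    show "(\<lambda>q. snd (fst q)) \<in> measurable ((restrict_space borel {0..t} \<Otimes>\<^sub>M FF t) \<Otimes>\<^sub>M lborel) (FF t)"
      by measurable
  qed
  have Xm: "(\<lambda>q. X (c (snd q)) (snd (fst q))) \<in> borel_measurable (N \<Otimes>\<^sub>M lborel)"
    using measurable_compose[OF cm progD[OF X t, folded N_def]] by simp
  have fst_m: "fst \<in> borel_measurable N"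
    unfolding N_def by (rule measurable_compose[OF measurable_fst]) (simp add: measurable_restrict_space1)
  have fm: "(\<lambda>q. fst (fst q)) \<in> borel_measurable (N \<Otimes>\<^sub>M lborel)"
    by (rule measurable_compose[OF measurable_fst fst_m])
  have sm: "(\<lambda>q. snd q) \<in> borel_measurable (N \<Otimes>\<^sub>M lborel)" by measurable
  have S: "{q \<in> space (N \<Otimes>\<^sub>M lborel). 0 \<le> snd q \<and> snd q \<le> fst (fst q)} \<in> sets (N \<Otimes>\<^sub>M lborel)"
    using fm sm by measurable
  have "(\<lambda>q. if 0 \<le> snd q \<and> snd q \<le> fst (fst q) then X (c (snd q)) (snd (fst q)) else 0)
      \<in> borel_measurable (N \<Otimes>\<^sub>M lborel)"
    by (intro measurable_If Xm S) auto
  then have "(\<lambda>p. \<integral>s. (if 0 \<le> s \<and> s \<le> fst p then X (c s) (snd p) else 0) \<partial>lborel) \<in> borel_measurable N"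
    by (intro lborel.borel_measurable_lebesgue_integral) (simp add: split_beta)
  moreover have "(\<integral>s. (if 0 \<le> s \<and> s \<le> fst p then X (c s) (snd p) else 0) \<partial>lborel) = (LBINT s:{0..fst p}. X s (snd p))"
    if "p \<in> space N" for p
    unfolding set_lebesgue_integral_def
  proof (rule Bochner_Integration.integral_cong)
    fix s show "(if 0 \<le> s \<and> s \<le> fst p then X (c s) (snd p) else 0) = indicator {0..fst p} s *\<^sub>R X s (snd p)"
      using that by (auto simp: N_def space_pair_measure space_restrict_space c_def indicator_def max_def min_def)
  qed simp
  ultimately show "(\<lambda>p. LBINT s:{0..fst p}. X s (snd p)) \<in> borel_measurable (restrict_space borel {0..t} \<Otimes>\<^sub>M FF t)"
    unfolding N_def[symmetric] by (subst measurable_cong[symmetric]) auto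
qed

lemma prog_section:
  assumes X: "prog T X" and t: "t \<in> {0..T}"
  shows "X t \<in> borel_measurable (FF t)"
proof -
  have "(\<lambda>\<omega>. (t, \<omega>)) \<in> measurable (FF t) (restrict_space borel {0..t} \<Otimes>\<^sub>M FF t)"
    by (intro measurable_Pair measurable_const) (use t in \<open>auto simp: space_restrict_space\<close>)
  from measurable_compose[OF this progD[OF X t]] show ?thesis by simp
qed

abbreviation time :: "real \<Rightarrow> real measure" where "time T \<equiv> restrict_space lborel {0..T}"

lemma finite_measure_time: "finite_measure (time T)"
  by (rule finite_measureI) (simp add: emeasure_restrict_space space_restrict_space emeasure_lborel_Icc_eq)

lemma pair_time: "pair_sigma_finite (time T) M"
  by (intro pair_sigma_finite.intro finite_measure.sigma_finite_measure finite_measure_time)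
     (rule finite_measure_axioms)

abbreviation time_path :: "real \<Rightarrow> (real \<times> 'w) measure" where "time_path T \<equiv> time T \<Otimes>\<^sub>M M"

lemma space_time_path: "space (time_path T) = {0..T} \<times> space M"
  by (simp add: space_pair_measure space_restrict_space)

lemma prog_joint:
  assumes "prog T X" "0 \<le> T"
  shows "(\<lambda>p. X (fst p) (snd p)) \<in> borel_measurable (time_path T)"
proof -
  have "(\<lambda>p. (fst p, snd p)) \<in> measurable (time_path T) (restrict_space borel {0..T} \<Otimes>\<^sub>M FF T)"
  proof (intro measurable_Pair)
    show "fst \<in> measurable (time_path T) (restrict_space borel {0..T})"
    proof -
      have "fst \<in> measurable (time_path T) (time T)" by measurable
      moreover have "sets (time T) = sets (restrict_space borel {0..T})"
        by (rule sets_restrict_space_cong) simp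
      ultimately show ?thesis using measurable_cong_sets[OF refl] by blast
    qed
    show "snd \<in> measurable (time_path T) (FF T)"
      by (rule measurable_compose[OF measurable_snd id_M_FF])
  qed
  from measurable_compose[OF this progD[OF assms(1), of T]] assms(2) show ?thesis by simp
qed

lemma set_integral_time:
  fixes f :: "real \<Rightarrow> 'b::{banach, second_countable_topology}"
  shows "set_integrable lborel {0..T} f \<longleftrightarrow> integrable (time T) f"
    "(LBINT t:{0..T}. f t) = (\<integral>t. f t \<partial>time T)"
  by (simp_all add: set_integrable_def set_lebesgue_integral_def integrable_restrict_space integral_restrict_space)

lemma fubini_time_path:
  fixes f :: "real \<Rightarrow> 'w \<Rightarrow> 'b::{banach, second_countable_topology}"
  assumes f: "integrable (time_path T) (\<lambda>p. f (fst p) (snd p))"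
  shows "AE \<omega> in M. set_integrable lborel {0..T} (\<lambda>t. f t \<omega>)"
    "integrable M (\<lambda>\<omega>. LBINT t:{0..T}. f t \<omega>)"
    "AE t in time T. integrable M (f t)"
    "(\<integral>\<omega>. (LBINT t:{0..T}. f t \<omega>) \<partial>M) = (\<integral>t. (\<integral>\<omega>. f t \<omega> \<partial>M) \<partial>time T)"
proof -
  interpret P: pair_sigma_finite "time T" M by (rule pair_time)
  have f': "integrable (time_path T) (\<lambda>(t, \<omega>). f t \<omega>)" using f by (simp add: case_prod_unfold)
  show "AE \<omega> in M. set_integrable lborel {0..T} (\<lambda>t. f t \<omega>)"
    using P.AE_integrable_snd[OF f'] by (simp add: set_integral_time)
  show "integrable M (\<lambda>\<omega>. LBINT t:{0..T}. f t \<omega>)"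
    using P.integrable_snd[OF f'] by (simp add: set_integral_time)
  show "AE t in time T. integrable M (f t)" using P.AE_integrable_fst[OF f'] by simp
  show "(\<integral>\<omega>. (LBINT t:{0..T}. f t \<omega>) \<partial>M) = (\<integral>t. (\<integral>\<omega>. f t \<omega> \<partial>M) \<partial>time T)"
    using P.Fubini_integral[OF f'] by (simp add: set_integral_time)
qed

text \<open>
  Square integrability with respect to the product of Lebesgue measure on \<open>[0, T]\<close> and the probability. All
  integrals in the costs are integrals of products of two such processes.
\<close>

definition sq_int :: "real \<Rightarrow> (real \<Rightarrow> 'w \<Rightarrow> 'b::euclidean_space) \<Rightarrow> bool" where
  "sq_int T f \<longleftrightarrow> (\<lambda>p. f (fst p) (snd p)) \<in> borel_measurable (time_path T) \<and>
     integrable (time_path T) (\<lambda>p. (norm (f (fst p) (snd p)))\<^sup>2)"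

lemma sq_int_bound:
  fixes f :: "real \<Rightarrow> 'w \<Rightarrow> 'b::euclidean_space" and g :: "real \<Rightarrow> 'w \<Rightarrow> 'c::euclidean_space"
  assumes m: "(\<lambda>p. f (fst p) (snd p)) \<in> borel_measurable (time_path T)" and g: "sq_int T g"
    and le: "\<And>t \<omega>. t \<in> {0..T} \<Longrightarrow> \<omega> \<in> space M \<Longrightarrow> norm (f t \<omega>) \<le> K * norm (g t \<omega>)"
  shows "sq_int T f"
  unfolding sq_int_def
proof (intro conjI m)
  have "integrable (time_path T) (\<lambda>p. K\<^sup>2 * (norm (g (fst p) (snd p)))\<^sup>2)"
    using g by (intro integrable_mult_right) (simp add: sq_int_def)
  then show "integrable (time_path T) (\<lambda>p. (norm (f (fst p) (snd p)))\<^sup>2)"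
  proof (rule Bochner_Integration.integrable_bound)
    show "(\<lambda>p. (norm (f (fst p) (snd p)))\<^sup>2) \<in> borel_measurable (time_path T)"
      by (intro borel_measurable_power measurable_compose[OF m borel_measurable_norm])
    show "AE p in time_path T. norm ((norm (f (fst p) (snd p)))\<^sup>2) \<le> norm (K\<^sup>2 * (norm (g (fst p) (snd p)))\<^sup>2)"
    proof (rule AE_I2)
      fix p assume "p \<in> space (time_path T)"
      then have "norm (f (fst p) (snd p)) \<le> K * norm (g (fst p) (snd p))"
        using le[of "fst p" "snd p"] by (auto simp: space_time_path)
      then have "(norm (f (fst p) (snd p)))\<^sup>2 \<le> (K * norm (g (fst p) (snd p)))\<^sup>2" by (intro power_mono) auto
      then show "norm ((norm (f (fst p) (snd p)))\<^sup>2) \<le> norm (K\<^sup>2 * (norm (g (fst p) (snd p)))\<^sup>2)"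
        by (simp add: power_mult_distrib)
    qed
  qed
qed

lemma sq_int_add:
  fixes f g :: "real \<Rightarrow> 'w \<Rightarrow> 'b::euclidean_space"
  assumes f: "sq_int T f" and g: "sq_int T g"
  shows "sq_int T (\<lambda>t \<omega>. f t \<omega> + g t \<omega>)"
  unfolding sq_int_def
proof (intro conjI)
  show m: "(\<lambda>p. f (fst p) (snd p) + g (fst p) (snd p)) \<in> borel_measurable (time_path T)"
    using f g by (intro borel_measurable_add) (auto simp: sq_int_def)
  have "integrable (time_path T) (\<lambda>p. 2 * (norm (f (fst p) (snd p)))\<^sup>2 + 2 * (norm (g (fst p) (snd p)))\<^sup>2)"
    using f g by (intro Bochner_Integration.integrable_add integrable_mult_right) (auto simp: sq_int_def)
  then show "integrable (time_path T) (\<lambda>p. (norm (f (fst p) (snd p) + g (fst p) (snd p)))\<^sup>2)"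
  proof (rule Bochner_Integration.integrable_bound)
    show "(\<lambda>p. (norm (f (fst p) (snd p) + g (fst p) (snd p)))\<^sup>2) \<in> borel_measurable (time_path T)"
      by (intro borel_measurable_power measurable_compose[OF m borel_measurable_norm])
    show "AE p in time_path T. norm ((norm (f (fst p) (snd p) + g (fst p) (snd p)))\<^sup>2) \<le>
        norm (2 * (norm (f (fst p) (snd p)))\<^sup>2 + 2 * (norm (g (fst p) (snd p)))\<^sup>2)"
    proof (rule AE_I2)
      fix p
      define x y where "x = f (fst p) (snd p)" and "y = g (fst p) (snd p)"
      have "(norm (x + y))\<^sup>2 \<le> (norm x + norm y)\<^sup>2" by (intro power_mono norm_triangle_ineq) auto
      also have "\<dots> \<le> 2 * (norm x)\<^sup>2 + 2 * (norm y)\<^sup>2"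
        using zero_le_power2[of "norm x - norm y"] by (simp add: power2_eq_square algebra_simps)
      finally show "norm ((norm (f (fst p) (snd p) + g (fst p) (snd p)))\<^sup>2) \<le>
        norm (2 * (norm (f (fst p) (snd p)))\<^sup>2 + 2 * (norm (g (fst p) (snd p)))\<^sup>2)"
        by (simp add: x_def y_def)
    qed
  qed
qed

lemma sq_int_mult_left:
  fixes f :: "real \<Rightarrow> 'w \<Rightarrow> 'b::euclidean_space"
  assumes "sq_int T f" shows "sq_int T (\<lambda>t \<omega>. c *\<^sub>R f t \<omega>)"
  by (rule sq_int_bound[OF _ assms, of _ "\<bar>c\<bar>"]) (use assms in \<open>auto simp: sq_int_def\<close>)

lemma sq_int_scaleR_vector:
  assumes "sq_int T f"
  shows "sq_int T (\<lambda>t \<omega>. (f t \<omega> :: real) *\<^sub>R (v :: real^'k))"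
  by (rule sq_int_bound[OF _ assms, of _ "norm v"])
     (use assms in \<open>auto simp: sq_int_def mult.commute intro!: borel_measurable_scaleR\<close>)

lemma sq_int_diff:
  fixes f g :: "real \<Rightarrow> 'w \<Rightarrow> 'b::euclidean_space"
  assumes f: "sq_int T f" and g: "sq_int T g"
  shows "sq_int T (\<lambda>t \<omega>. f t \<omega> - g t \<omega>)"
  using sq_int_add[OF f sq_int_mult_left[OF g, of "-1"]] by simp

lemma sq_int_vec_nth:
  fixes f :: "real \<Rightarrow> 'w \<Rightarrow> real^'k"
  assumes "sq_int T f" shows "sq_int T (\<lambda>t \<omega>. f t \<omega> $ i)"
proof (rule sq_int_bound[OF _ assms, of _ 1])
  show "(\<lambda>p. f (fst p) (snd p) $ i) \<in> borel_measurable (time_path T)"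
    by (rule borel_measurable_continuous_on[of "\<lambda>x. x $ i"])
       (use assms in \<open>auto simp: sq_int_def intro!: continuous_intros\<close>)
qed (auto simp: component_le_norm_cart)

lemma sq_int_matrix_vector:
  fixes C :: "real \<Rightarrow> real^'k^'k" and f :: "real \<Rightarrow> 'w \<Rightarrow> real^'k"
  assumes T: "0 \<le> T" and C: "continuous_on {0..T} C" and f: "sq_int T f"
  shows "sq_int T (\<lambda>t \<omega>. C t *v f t \<omega>)"
proof -
  obtain K where K: "0 < K" "\<And>t x. t \<in> {0..T} \<Longrightarrow> norm (C t *v x) \<le> K * norm x"
    by (rule continuous_bilinear_bound[OF bounded_bilinear_matrix_vector C]) (rule that)
  show ?thesis
  proof (rule sq_int_bound[OF _ f, of _ K])
    show "(\<lambda>p. C (fst p) *v f (fst p) (snd p)) \<in> borel_measurable (time_path T)"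
      using f prog_joint[OF prog_deterministic[OF C] T]
      by (intro bounded_bilinear_measurable[OF bounded_bilinear_matrix_vector]) (auto simp: sq_int_def)
  qed (use K in auto)
qed

lemma sq_int_integrable_mult:
  fixes f g :: "real \<Rightarrow> 'w \<Rightarrow> real"
  assumes f: "sq_int T f" and g: "sq_int T g"
  shows "integrable (time_path T) (\<lambda>p. f (fst p) (snd p) * g (fst p) (snd p))"
proof -
  have "integrable (time_path T) (\<lambda>p. (norm (f (fst p) (snd p)))\<^sup>2 + (norm (g (fst p) (snd p)))\<^sup>2)"
    using f g by (intro Bochner_Integration.integrable_add) (auto simp: sq_int_def)
  then show ?thesis
  proof (rule Bochner_Integration.integrable_bound)
    show "(\<lambda>p. f (fst p) (snd p) * g (fst p) (snd p)) \<in> borel_measurable (time_path T)"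
      using f g by (intro borel_measurable_times) (auto simp: sq_int_def)
    show "AE p in time_path T. norm (f (fst p) (snd p) * g (fst p) (snd p)) \<le>
        norm ((norm (f (fst p) (snd p)))\<^sup>2 + (norm (g (fst p) (snd p)))\<^sup>2)"
    proof (rule AE_I2)
      fix p
      define x y where "x = \<bar>f (fst p) (snd p)\<bar>" and "y = \<bar>g (fst p) (snd p)\<bar>"
      have "0 \<le> x * y" by (simp add: x_def y_def)
      moreover have "2 * (x * y) \<le> x\<^sup>2 + y\<^sup>2"
        using zero_le_power2[of "x - y"] unfolding power2_diff by simp
      ultimately have "x * y \<le> x\<^sup>2 + y\<^sup>2" by linarith
      then show "norm (f (fst p) (snd p) * g (fst p) (snd p)) \<le>
        norm ((norm (f (fst p) (snd p)))\<^sup>2 + (norm (g (fst p) (snd p)))\<^sup>2)"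
        by (simp add: x_def y_def abs_mult)
    qed
  qed
qed

lemma sq_int_W:
  assumes T: "0 \<le> T" shows "sq_int T (W j)"
  unfolding sq_int_def
proof (intro conjI)
  show m: "(\<lambda>p. W j (fst p) (snd p)) \<in> borel_measurable (time_path T)"
    by (rule prog_joint[OF prog_W T])
  interpret P: pair_sigma_finite "time T" M by (rule pair_time)
  have sq: "integrable M (\<lambda>\<omega>. (W j t \<omega>)\<^sup>2) \<and> (\<integral>\<omega>. (W j t \<omega>)\<^sup>2 \<partial>M) = t" if "0 \<le> t" for t
  proof -
    have e: "\<omega> \<in> space M \<Longrightarrow> (W j t \<omega> - W j 0 \<omega>)\<^sup>2 = (W j t \<omega>)\<^sup>2" for \<omega> by (simp add: W_0)
    have "integrable M (\<lambda>\<omega>. (W j t \<omega>)\<^sup>2) = integrable M (\<lambda>\<omega>. (W j t \<omega> - W j 0 \<omega>)\<^sup>2)"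
      by (rule Bochner_Integration.integrable_cong) (auto simp: e)
    moreover have "(\<integral>\<omega>. (W j t \<omega>)\<^sup>2 \<partial>M) = (\<integral>\<omega>. (W j t \<omega> - W j 0 \<omega>)\<^sup>2 \<partial>M)"
      by (rule Bochner_Integration.integral_cong) (auto simp: e)
    ultimately show ?thesis using increment_integrable(1,2)[of 0 t j] that by simp
  qed
  show "integrable (time_path T) (\<lambda>p. (norm (W j (fst p) (snd p)))\<^sup>2)"
  proof (rule P.Fubini_integrable)
    show "(\<lambda>p. (norm (W j (fst p) (snd p)))\<^sup>2) \<in> borel_measurable (time_path T)"
      by (intro borel_measurable_power measurable_compose[OF m borel_measurable_norm])
    have "integrable (time T) (\<lambda>t. t)"
      unfolding set_integral_time(1)[symmetric] by (rule set_integrable_continuous) (rule continuous_on_id)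
    then show "integrable (time T) (\<lambda>t. \<integral>\<omega>. norm ((norm (W j (fst (t, \<omega>)) (snd (t, \<omega>))))\<^sup>2) \<partial>M)"
      by (subst Bochner_Integration.integrable_cong[OF refl, where g = "\<lambda>t. t"])
         (auto simp: space_restrict_space sq)
    show "AE t in time T. integrable M (\<lambda>\<omega>. (norm (W j (fst (t, \<omega>)) (snd (t, \<omega>))))\<^sup>2)"
      by (rule AE_I2) (auto simp: space_restrict_space sq)
  qed
qed

lemma sq_int_vecI:
  fixes f :: "real \<Rightarrow> 'w \<Rightarrow> real^'k"
  assumes "\<And>i. sq_int T (\<lambda>t \<omega>. f t \<omega> $ i)"
  shows "sq_int T f"
  unfolding sq_int_def
proof (intro conjI)
  show "(\<lambda>p. f (fst p) (snd p)) \<in> borel_measurable (time_path T)"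
    using assms by (intro borel_measurable_vecI) (auto simp: sq_int_def)
  have "(norm x)\<^sup>2 = (\<Sum>i\<in>UNIV. (norm (x $ i))\<^sup>2)" for x :: "real^'k"
    unfolding power2_norm_eq_inner by (simp add: inner_vec_def power2_eq_square)
  then show "integrable (time_path T) (\<lambda>p. (norm (f (fst p) (snd p)))\<^sup>2)"
    using assms by (auto simp: sq_int_def)
qed

lemma sq_int_noise: "0 \<le> T \<Longrightarrow> sq_int T noise"
  by (rule sq_int_vecI) (simp add: noise_def sq_int_W)

text \<open>
  Tonelli's theorem exchanges the order of the two integrations in the definition of admissibility.
\<close>

lemma admissible_iff:
  assumes T: "0 \<le> T"
  shows "\<alpha> \<in> admissible_controls M W T \<longleftrightarrow> prog T \<alpha> \<and> sq_int T \<alpha>"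
proof (cases "prog T \<alpha>")
  case True
  interpret P: pair_sigma_finite "time T" M by (rule pair_time)
  have m: "(\<lambda>p. \<alpha> (fst p) (snd p)) \<in> borel_measurable (time_path T)" by (rule prog_joint[OF True T])
  have m2: "(\<lambda>p. (norm (\<alpha> (fst p) (snd p)))\<^sup>2) \<in> borel_measurable (time_path T)"
    by (intro borel_measurable_power measurable_compose[OF m borel_measurable_norm])
  have "(\<integral>\<^sup>+\<omega>. (\<integral>\<^sup>+t\<in>{0..T}. ennreal (\<bar>\<alpha> t \<omega>\<bar>\<^sup>2) \<partial>lborel) \<partial>M) =
      (\<integral>\<^sup>+\<omega>. (\<integral>\<^sup>+t. ennreal (\<bar>\<alpha> t \<omega>\<bar>\<^sup>2) \<partial>time T) \<partial>M)"
    by (simp add: nn_integral_restrict_space)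
  also have "\<dots> = (\<integral>\<^sup>+p. ennreal (norm ((norm (\<alpha> (fst p) (snd p)))\<^sup>2)) \<partial>time_path T)"
    using P.nn_integral_snd[of "\<lambda>p. ennreal (norm ((norm (\<alpha> (fst p) (snd p)))\<^sup>2))"] m2
    by simp
  finally have "(\<integral>\<^sup>+\<omega>. (\<integral>\<^sup>+t\<in>{0..T}. ennreal (\<bar>\<alpha> t \<omega>\<bar>\<^sup>2) \<partial>lborel) \<partial>M) < \<infinity> \<longleftrightarrow> sq_int T \<alpha>"
    using m m2 by (simp add: sq_int_def integrable_iff_bounded)
  then show ?thesis using True by (simp add: admissible_controls_def)
qed (simp add: admissible_controls_def)

definition linear_state :: "real \<Rightarrow> real \<Rightarrow> (real \<Rightarrow> real^'n^'n) \<Rightarrow> (real \<Rightarrow> 'w \<Rightarrow> real^'n) \<Rightarrow> real^'n \<Rightarrow>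
    (real \<Rightarrow> 'w \<Rightarrow> real^'n) \<Rightarrow> bool" where
  "linear_state T \<sigma> C h x0 X \<longleftrightarrow> prog T X \<and>
     (AE \<omega> in M. linear_path T \<sigma> C (\<lambda>s. h s \<omega>) x0 (\<lambda>t. noise t \<omega>) (\<lambda>t. X t \<omega>))"

lemma sq_int_AE_set_integrable:
  fixes h :: "real \<Rightarrow> 'w \<Rightarrow> 'b::euclidean_space"
  assumes T: "0 \<le> T" and h: "sq_int T h"
  shows "AE \<omega> in M. set_integrable lborel {0..T} (\<lambda>s. (norm (h s \<omega>))\<^sup>2)"
    "AE \<omega> in M. set_integrable lborel {0..T} (\<lambda>s. h s \<omega>)"
proof -
  interpret P: pair_sigma_finite "time T" M by (rule pair_time)
  interpret F: finite_measure "time T" by (rule finite_measure_time)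
  interpret PF: finite_measure "time_path T"
    by (intro finite_measure_pair_measure finite_measure_time) (rule finite_measure_axioms)
  show "AE \<omega> in M. set_integrable lborel {0..T} (\<lambda>s. (norm (h s \<omega>))\<^sup>2)"
    by (rule fubini_time_path(1)) (use h in \<open>simp add: sq_int_def\<close>)
  have "integrable (time_path T) (\<lambda>p. 1 + (norm (h (fst p) (snd p)))\<^sup>2)"
    using h by (intro Bochner_Integration.integrable_add) (auto simp: sq_int_def)
  then have "integrable (time_path T) (\<lambda>p. h (fst p) (snd p))"
  proof (rule Bochner_Integration.integrable_bound)
    show "(\<lambda>p. h (fst p) (snd p)) \<in> borel_measurable (time_path T)" using h by (simp add: sq_int_def)
    show "AE p in time_path T. norm (h (fst p) (snd p)) \<le> norm (1 + (norm (h (fst p) (snd p)))\<^sup>2)"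
    proof (rule AE_I2)
      fix p
      define x where "x = norm (h (fst p) (snd p))"
      have "0 \<le> x" by (simp add: x_def)
      moreover have "2 * x \<le> 1 + x\<^sup>2"
        using zero_le_power2[of "x - 1"] unfolding power2_diff by simp
      ultimately have "x \<le> 1 + x\<^sup>2" by linarith
      then show "norm (h (fst p) (snd p)) \<le> norm (1 + (norm (h (fst p) (snd p)))\<^sup>2)"
        by (simp add: x_def)
    qed
  qed
  then show "AE \<omega> in M. set_integrable lborel {0..T} (\<lambda>s. h s \<omega>)" by (rule fubini_time_path(1))
qed

lemma linear_state_exists:
  assumes T: "0 \<le> T" and C: "continuous_on {0..T} C"
    and h: "prog T h" "sq_int T h"
  shows "\<exists>X. linear_state T \<sigma> C h x0 X"
proof -
  obtain \<Phi> \<Psi> where F: "\<Phi> 0 = mat 1"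
    "\<And>t. t \<in> {0..T} \<Longrightarrow> (\<Phi> has_vector_derivative C t ** \<Phi> t) (at t within {0..T})"
    "continuous_on {0..T} \<Phi>" "continuous_on {0..T} \<Psi>"
    "\<And>t. t \<in> {0..T} \<Longrightarrow> \<Phi> t ** \<Psi> t = mat 1"
    by (rule fundamental_matrix[OF T C]) (rule that)
  define X where "X t \<omega> = \<Phi> t *v (x0 + (LBINT s:{0..t}. \<Psi> s *v (h s \<omega> + \<sigma> *\<^sub>R (C s *v noise s \<omega>)))) + \<sigma> *\<^sub>R noise t \<omega>" for t \<omega>
  have "prog T X"
    unfolding X_def[abs_def]
    by (intro prog_add prog_scaleR prog_noise prog_matrix_vector F C prog_integral h prog_deterministic continuous_on_const)
  moreover have "AE \<omega> in M. linear_path T \<sigma> C (\<lambda>s. h s \<omega>) x0 (\<lambda>t. noise t \<omega>) (\<lambda>t. X t \<omega>)"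
    using sq_int_AE_set_integrable(2)[OF T h(2)] AE_space
  proof eventually_elim
    case (elim \<omega>)
    show ?case unfolding X_def
      by (rule linear_path_solution[OF T C F elim(1) noise_cont[OF elim(2)]])
  qed
  ultimately show ?thesis unfolding linear_state_def by blast
qed

text \<open>
  The pathwise bound is integrated over time and probability. The case \<open>t = T\<close> is treated separately, since a
  single time is a null set.
\<close>

lemma linear_state_sq_int:
  assumes T: "0 < T" and C: "continuous_on {0..T} C" and h: "sq_int T h"
    and X: "linear_state T \<sigma> C h x0 X"
  shows "sq_int T X" "integrable M (\<lambda>\<omega>. (norm (X T \<omega>))\<^sup>2)"
proof -
  interpret P: pair_sigma_finite "time T" M by (rule pair_time)
  interpret F: finite_measure "time T" by (rule finite_measure_time)
  interpret PF: finite_measure "time_path T"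
    by (intro finite_measure_pair_measure finite_measure_time) (rule finite_measure_axioms)
  have T': "0 \<le> T" using T by simp
  have Xp: "prog T X" using X by (simp add: linear_state_def)
  have Xm: "(\<lambda>p. X (fst p) (snd p)) \<in> borel_measurable (time_path T)" by (rule prog_joint[OF Xp T'])
  obtain c where c: "0 \<le> c"
    "\<And>h x0 v x t. linear_path T \<sigma> C h x0 v x \<Longrightarrow> continuous_on {0..T} v \<Longrightarrow>
       set_integrable lborel {0..T} (\<lambda>s. (norm (h s))\<^sup>2) \<Longrightarrow> t \<in> {0..T} \<Longrightarrow>
       (norm (x t))\<^sup>2 \<le> c * ((norm x0)\<^sup>2 + (LBINT s:{0..T}. (norm (v s))\<^sup>2 + (norm (h s))\<^sup>2) + (norm (v t))\<^sup>2)"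
    by (rule linear_path_bound[OF T C]) (rule that)
  define R where "R \<omega> = (LBINT s:{0..T}. (norm (noise s \<omega>))\<^sup>2 + (norm (h s \<omega>))\<^sup>2)" for \<omega>
  have "integrable (time_path T) (\<lambda>p. (norm (noise (fst p) (snd p)))\<^sup>2 + (norm (h (fst p) (snd p)))\<^sup>2)"
    using sq_int_noise[OF T'] h by (intro Bochner_Integration.integrable_add) (auto simp: sq_int_def)
  then have RM: "integrable M R" unfolding R_def by (rule fubini_time_path(2))
  have RP: "integrable (time_path T) (\<lambda>p. R (snd p))"
  proof (rule P.Fubini_integrable)
    show "(\<lambda>p. R (snd p)) \<in> borel_measurable (time_path T)"
      using RM by (intro measurable_compose[OF measurable_snd]) auto
  qed (use RM in auto)
  have bound: "AE \<omega> in M. \<forall>t\<in>{0..T}. (norm (X t \<omega>))\<^sup>2 \<le> c * ((norm x0)\<^sup>2 + R \<omega> + (norm (noise t \<omega>))\<^sup>2)"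
  proof -
    have "AE \<omega> in M. linear_path T \<sigma> C (\<lambda>s. h s \<omega>) x0 (\<lambda>t. noise t \<omega>) (\<lambda>t. X t \<omega>)"
      using X by (simp add: linear_state_def)
    with sq_int_AE_set_integrable(1)[OF T' h] AE_space show ?thesis
    proof eventually_elim
      case (elim \<omega>)
      show ?case
        using c(2)[OF elim(3) noise_cont[OF elim(2)] elim(1)] by (simp add: R_def)
    qed
  qed
  have VT: "integrable (time_path T) (\<lambda>p. (norm (noise (fst p) (snd p)))\<^sup>2)"
    using sq_int_noise[OF T'] by (simp add: sq_int_def)
  define b where "b p = c * ((norm x0)\<^sup>2 + R (snd p) + (norm (noise (fst p) (snd p)))\<^sup>2)" for p
  have bi: "integrable (time_path T) b"
    unfolding b_def by (intro integrable_mult_right Bochner_Integration.integrable_add RP VT PF.integrable_const)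
  have bm: "b \<in> borel_measurable (time_path T)" using bi by auto
  have X2m: "(\<lambda>p. (norm (X (fst p) (snd p)))\<^sup>2) \<in> borel_measurable (time_path T)"
    by (intro borel_measurable_power measurable_compose[OF Xm borel_measurable_norm])
  have "AE t in time T. AE \<omega> in M. (norm (X (fst (t, \<omega>)) (snd (t, \<omega>))))\<^sup>2 \<le> b (t, \<omega>)"
  proof (rule AE_I2)
    fix t assume "t \<in> space (time T)"
    then have t: "t \<in> {0..T}" by (simp add: space_restrict_space)
    show "AE \<omega> in M. (norm (X (fst (t, \<omega>)) (snd (t, \<omega>))))\<^sup>2 \<le> b (t, \<omega>)"
      using bound by eventually_elim (use t in \<open>auto simp: b_def\<close>)
  qed
  then have "AE p in time_path T. (norm (X (fst p) (snd p)))\<^sup>2 \<le> b p"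
    using X2m bm by (intro P.AE_pair_measure borel_measurable_le) auto
  then have "integrable (time_path T) (\<lambda>p. (norm (X (fst p) (snd p)))\<^sup>2)"
    by (intro Bochner_Integration.integrable_bound[OF bi X2m]) (auto elim!: eventually_mono)
  with Xm show "sq_int T X" by (simp add: sq_int_def)
  have VWT: "integrable M (\<lambda>\<omega>. (norm (noise T \<omega>))\<^sup>2)"
  proof -
    have "integrable M (\<lambda>\<omega>. \<Sum>j\<in>UNIV. (W j T \<omega> - W j 0 \<omega>)\<^sup>2)"
      using increment_integrable(1)[of 0 T] T' by (intro Bochner_Integration.integrable_sum) auto
    moreover have "(norm (noise T \<omega>))\<^sup>2 = (\<Sum>j\<in>UNIV. (W j T \<omega> - W j 0 \<omega>)\<^sup>2)" if "\<omega> \<in> space M" for \<omega>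
      unfolding power2_norm_eq_inner using W_0[OF that] by (simp add: inner_vec_def noise_def power2_eq_square)
    ultimately show ?thesis by (simp cong: Bochner_Integration.integrable_cong)
  qed
  have "integrable M (\<lambda>\<omega>. c * ((norm x0)\<^sup>2 + R \<omega> + (norm (noise T \<omega>))\<^sup>2))"
    by (intro integrable_mult_right Bochner_Integration.integrable_add RM VWT) auto
  then show "integrable M (\<lambda>\<omega>. (norm (X T \<omega>))\<^sup>2)"
  proof (rule Bochner_Integration.integrable_bound)
    have "X T \<in> borel_measurable M"
      using T' by (intro FF_measurable_M[OF prog_section[OF Xp]]) auto
    then show "(\<lambda>\<omega>. (norm (X T \<omega>))\<^sup>2) \<in> borel_measurable M"
      by (intro borel_measurable_power measurable_compose[OF _ borel_measurable_norm])
    show "AE \<omega> in M. norm ((norm (X T \<omega>))\<^sup>2) \<le> norm (c * ((norm x0)\<^sup>2 + R \<omega> + (norm (noise T \<omega>))\<^sup>2))"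
      using bound
    proof eventually_elim
      case (elim \<omega>)
      then have "(norm (X T \<omega>))\<^sup>2 \<le> c * ((norm x0)\<^sup>2 + R \<omega> + (norm (noise T \<omega>))\<^sup>2)" using T' by auto
      then show ?case by simp
    qed
  qed
qed

end

section \<open>The state equations and the stochastic term\<close>

lemma inner_symmetric_matrix:
  "transpose A = A \<Longrightarrow> (x :: real^'n) \<bullet> (A *v y) = (A *v x) \<bullet> y"
  by (metis inner_matrix_vector)

lemma linear_path_iff:
  assumes T: "0 \<le> T"
  shows "linear_path T \<sigma> C h x0 v x \<longleftrightarrow> set_integrable lborel {0..T} (\<lambda>s. C s *v x s + h s) \<and>
    (\<forall>t\<in>{0..T}. x t - \<sigma> *\<^sub>R v t = x0 + (LBINT s:{0..t}. C s *v x s + h s))"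
proof (cases "set_integrable lborel {0..T} (\<lambda>s. C s *v x s + h s)")
  case True
  have "set_integrable lborel {0..0} (\<lambda>s. C s *v x s + h s)"
    by (rule set_integrable_subset[OF True]) (use T in auto)
  then have "(LBINT s:{0..0}. C s *v x s + h s) = integral {0..0} (\<lambda>s. C s *v x s + h s)"
    by (rule set_borel_integral_eq_integral(2))
  then have z: "(LBINT s:{0..0}. C s *v x s + h s) = 0" by simp
  have "0 \<in> {0..T}" using T by simp
  define u where "u t = x t - \<sigma> *\<^sub>R v t" for t
  define I where "I t = (LBINT s:{0..t}. C s *v x s + h s)" for t
  have "(\<forall>t\<in>{0..T}. u t = u 0 + I t) \<and> u 0 = x0 \<longleftrightarrow> (\<forall>t\<in>{0..T}. u t = x0 + I t)" (is "?l \<longleftrightarrow> ?r")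
  proof
    assume r: ?r
    then have "u 0 = x0 + I 0" using \<open>0 \<in> {0..T}\<close> by blast
    then have "u 0 = x0" using z by (simp add: I_def)
    with r show ?l by simp
  qed auto
  with True show ?thesis unfolding linear_path_def primitive_on_def u_def I_def by blast
qed (simp add: linear_path_def primitive_on_def)

context brownian_family
begin

lemma state_process_iff_linear_state:
  assumes T: "0 \<le> T"
    and eq: "\<And>t \<omega> j. t \<in> {0..T} \<Longrightarrow> \<alpha> j t \<omega> - a * (L *v X t \<omega>) $ j = (C t *v X t \<omega> + h t \<omega>) $ j"
  shows "state_process M W T a \<sigma> L x0 \<alpha> X \<longleftrightarrow> linear_state T \<sigma> C h x0 X"
proof -
  have "(\<forall>i. \<forall>t\<in>{0..T}. set_integrable lborel {0..t} (\<lambda>s. \<alpha> i s \<omega> - a * (L *v X s \<omega>) $ i) \<and>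
        X t \<omega> $ i = x0 $ i + (LBINT s:{0..t}. \<alpha> i s \<omega> - a * (L *v X s \<omega>) $ i) + \<sigma> * W i t \<omega>)
     \<longleftrightarrow> linear_path T \<sigma> C (\<lambda>s. h s \<omega>) x0 (\<lambda>t. noise t \<omega>) (\<lambda>t. X t \<omega>)" (is "?L \<longleftrightarrow> ?R") for \<omega>
  proof -
    define f where "f s = C s *v X s \<omega> + h s \<omega>" for s
    have ii: "set_integrable lborel {0..t} (\<lambda>s. \<alpha> i s \<omega> - a * (L *v X s \<omega>) $ i) = set_integrable lborel {0..t} (\<lambda>s. f s $ i)"
      if "t \<in> {0..T}" for t i
      by (rule set_integrable_cong) (use that eq in \<open>auto simp: f_def\<close>)
    have li: "(LBINT s:{0..t}. \<alpha> i s \<omega> - a * (L *v X s \<omega>) $ i) = (LBINT s:{0..t}. f s $ i)"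
      if "t \<in> {0..T}" for t i
      by (rule set_lebesgue_integral_cong) (use that eq in \<open>auto simp: f_def\<close>)
    have "?L \<longleftrightarrow> (\<forall>i. \<forall>t\<in>{0..T}. set_integrable lborel {0..t} (\<lambda>s. f s $ i) \<and>
        X t \<omega> $ i = x0 $ i + (LBINT s:{0..t}. f s $ i) + \<sigma> * W i t \<omega>)"
      using ii li by simp
    also have "\<dots> \<longleftrightarrow> set_integrable lborel {0..T} f \<and>
        (\<forall>t\<in>{0..T}. X t \<omega> - \<sigma> *\<^sub>R noise t \<omega> = x0 + (LBINT s:{0..t}. f s))" (is "?A \<longleftrightarrow> ?B")
    proof
      assume A: ?A
      have f: "set_integrable lborel {0..t} f" if "t \<in> {0..T}" for t
        by (rule set_integrable_vecI) (use A that in blast)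
      have "X t \<omega> - \<sigma> *\<^sub>R noise t \<omega> = x0 + (LBINT s:{0..t}. f s)" if t: "t \<in> {0..T}" for t
      proof -
        have "X t \<omega> $ i = x0 $ i + (LBINT s:{0..t}. f s) $ i + \<sigma> * W i t \<omega>" for i
          using A t set_integral_vec_nth(2)[OF f[OF t], of i] by auto
        then show ?thesis by (simp add: vec_eq_iff noise_def algebra_simps)
      qed
      with f T show ?B by auto
    next
      assume B: ?B
      show ?A
      proof (intro allI ballI)
        fix i t assume t: "t \<in> {0..T}"
        have f: "set_integrable lborel {0..t} f"
          by (rule set_integrable_subset[of _ "{0..T}"]) (use B t in auto)
        have "X t \<omega> - \<sigma> *\<^sub>R noise t \<omega> = x0 + (LBINT s:{0..t}. f s)" using B t by blast
        then have "(X t \<omega> - \<sigma> *\<^sub>R noise t \<omega>) $ i = (x0 + (LBINT s:{0..t}. f s)) $ i" by simp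
        then show "set_integrable lborel {0..t} (\<lambda>s. f s $ i) \<and>
            X t \<omega> $ i = x0 $ i + (LBINT s:{0..t}. f s $ i) + \<sigma> * W i t \<omega>"
          using set_integral_vec_nth[OF f, of i] by (simp add: noise_def algebra_simps)
      qed
    qed
    also have "\<dots> \<longleftrightarrow> ?R" by (simp add: linear_path_iff[OF T] f_def[abs_def])
    finally show ?thesis .
  qed
  then show ?thesis unfolding state_process_def linear_state_def by simp
qed

lemma sq_int_const_time:
  fixes f :: "'w \<Rightarrow> 'b::euclidean_space"
  assumes m: "f \<in> borel_measurable M" and i: "integrable M (\<lambda>\<omega>. (norm (f \<omega>))\<^sup>2)"
  shows "sq_int T (\<lambda>t. f)"
  unfolding sq_int_def
proof (intro conjI)
  interpret P: pair_sigma_finite "time T" M by (rule pair_time)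
  interpret F: finite_measure "time T" by (rule finite_measure_time)
  show "(\<lambda>p. f (snd p)) \<in> borel_measurable (time_path T)"
    by (rule measurable_compose[OF measurable_snd m])
  show "integrable (time_path T) (\<lambda>p. (norm (f (snd p)))\<^sup>2)"
  proof (rule P.Fubini_integrable)
    show "(\<lambda>p. (norm (f (snd p)))\<^sup>2) \<in> borel_measurable (time_path T)"
      by (rule measurable_compose[OF measurable_snd]) (use i in auto)
  qed (use i in auto)
qed

text \<open>
  In the application, \<open>G\<close> is the derivative of the integrand of a stochastic integral, and integration by
  parts has moved the stochastic differential to the increments \<open>noise T - noise t\<close>. For almost every \<open>t\<close> the
  expectation vanishes because \<open>G t\<close> belongs to the past of \<open>t\<close>.
\<close>

lemma martingale_term_zero:
  fixes G :: "real \<Rightarrow> 'w \<Rightarrow> real^'n"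
  assumes T: "0 \<le> T" and G: "prog T G" "sq_int T G"
  shows "integrable (time_path T) (\<lambda>p. G (fst p) (snd p) \<bullet> (noise T (snd p) - noise (fst p) (snd p)))"
    "(\<integral>\<omega>. (LBINT t:{0..T}. G t \<omega> \<bullet> (noise T \<omega> - noise t \<omega>)) \<partial>M) = 0"
proof -
  have Gj: "sq_int T (\<lambda>t \<omega>. G t \<omega> $ j)" for j by (rule sq_int_vec_nth[OF G(2)])
  have WT: "sq_int T (\<lambda>t. W j T)" for j
  proof (rule sq_int_const_time)
    show "W j T \<in> borel_measurable M" using T by (rule W_rv)
    have e: "(norm (W j T \<omega>))\<^sup>2 = (W j T \<omega> - W j 0 \<omega>)\<^sup>2" if "\<omega> \<in> space M" for \<omega>
      using W_0[OF that] by simp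
    have "integrable M (\<lambda>\<omega>. (norm (W j T \<omega>))\<^sup>2) = integrable M (\<lambda>\<omega>. (W j T \<omega> - W j 0 \<omega>)\<^sup>2)"
      by (rule Bochner_Integration.integrable_cong[OF refl e])
    then show "integrable M (\<lambda>\<omega>. (norm (W j T \<omega>))\<^sup>2)"
      using increment_integrable(1)[of 0 T j] T by simp
  qed
  have prods: "integrable (time_path T) (\<lambda>p. (W j T (snd p) - W j (fst p) (snd p)) * G (fst p) (snd p) $ j)" for j
    by (rule sq_int_integrable_mult[OF sq_int_diff[OF WT sq_int_W[OF T]] Gj])
  have e: "G t \<omega> \<bullet> (noise T \<omega> - noise t \<omega>) = (\<Sum>j\<in>UNIV. (W j T \<omega> - W j t \<omega>) * G t \<omega> $ j)" for t \<omega>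
    by (simp add: inner_vec_def noise_def mult.commute)
  show int: "integrable (time_path T) (\<lambda>p. G (fst p) (snd p) \<bullet> (noise T (snd p) - noise (fst p) (snd p)))"
    unfolding e by (intro Bochner_Integration.integrable_sum prods)
  have G1: "integrable (time_path T) (\<lambda>p. G (fst p) (snd p) $ j)" for j
  proof -
    interpret F: finite_measure "time T" by (rule finite_measure_time)
    have "sq_int T (\<lambda>t \<omega>. 1 :: real)" by (rule sq_int_const_time) auto
    from sq_int_integrable_mult[OF this Gj[of j]] show ?thesis by simp
  qed
  have "AE t in time T. \<forall>j. integrable M (\<lambda>\<omega>. G t \<omega> $ j)"
    by (intro AE_all_countable[THEN iffD2] allI fubini_time_path(3)[OF G1])
  then have "AE t in time T. (\<integral>\<omega>. G t \<omega> \<bullet> (noise T \<omega> - noise t \<omega>) \<partial>M) = 0"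
    using AE_space
  proof eventually_elim
    case (elim t)
    then have t: "t \<in> {0..T}" by (simp add: space_restrict_space)
    have meas: "(\<lambda>\<omega>. G t \<omega> $ j) \<in> borel_measurable (FF t)" for j
      by (rule prog_section[OF prog_vec_nth[OF G(1)] t])
    have zero: "(\<integral>\<omega>. (W j T \<omega> - W j t \<omega>) * G t \<omega> $ j \<partial>M) = 0" for j
      by (rule increment_orthogonal_past(2)[OF _ _ meas]) (use elim t in auto)
    have int_j: "integrable M (\<lambda>\<omega>. (W j T \<omega> - W j t \<omega>) * G t \<omega> $ j)" for j
      by (rule increment_orthogonal_past(1)[OF _ _ meas]) (use elim t in auto)
    show "(\<integral>\<omega>. G t \<omega> \<bullet> (noise T \<omega> - noise t \<omega>) \<partial>M) = 0"
      unfolding e by (simp add: zero int_j)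
  qed
  then have "(\<integral>t. (\<integral>\<omega>. G t \<omega> \<bullet> (noise T \<omega> - noise t \<omega>) \<partial>M) \<partial>time T) = 0"
    by (rule integral_eq_zero_AE)
  then show "(\<integral>\<omega>. (LBINT t:{0..T}. G t \<omega> \<bullet> (noise T \<omega> - noise t \<omega>)) \<partial>M) = 0"
    using fubini_time_path(4)[OF int] by simp
qed

end

section \<open>Verification of the equilibrium\<close>

locale lq_game = brownian_family M W
  for M :: "'w measure" and W :: "'n::finite \<Rightarrow> real \<Rightarrow> 'w \<Rightarrow> real" +
  fixes L :: "real^'n^'n" and F :: "'n \<Rightarrow> real \<Rightarrow> real^'n^'n" and T a q \<epsilon> c \<sigma> :: real and x0 :: "real^'n"
  assumes T_pos: "0 < T" and L_sym: "transpose L = L" and q_le: "q\<^sup>2 \<le> \<epsilon>" and c_nonneg: "0 \<le> c"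
    and riccati: "solves_coupled_riccati T a q \<epsilon> c L F"
begin

definition feedback :: "'n \<Rightarrow> real \<Rightarrow> real^'n \<Rightarrow> real" where
  "feedback i t x = - q * (L *v x) $ i - (F i t *v x) $ i"

text \<open>
  The drift of the state is \<open>closed_loop t x\<close> when all players use the feedback, and
  \<open>open_loop i t x + \<beta> e\<^sub>i\<close> when player \<open>i\<close> uses the control \<open>\<beta>\<close> and the others keep their feedback.
\<close>

definition closed_loop :: "real \<Rightarrow> real^'n^'n" where
  "closed_loop t = - ((a + q) *\<^sub>R L) - (\<Sum>j\<in>UNIV. ee j ** F j t)"

definition open_loop :: "'n \<Rightarrow> real \<Rightarrow> real^'n^'n" where
  "open_loop i t = closed_loop t + (q *\<^sub>R (ee i ** L) + ee i ** F i t)"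

definition Fdot :: "'n \<Rightarrow> real \<Rightarrow> real^'n^'n" where
  "Fdot i t = - (\<Sum>j\<in>UNIV. (- ((a + q) *\<^sub>R L) - F j t) ** ee j ** F i t)
     - (\<Sum>j\<in>UNIV. F i t ** ee j ** (- ((a + q) *\<^sub>R L) - F j t))
     - (\<epsilon> - q\<^sup>2) *\<^sub>R (L ** ee i ** L) - F i t ** ee i ** F i t"

lemma F_sym: "t \<in> {0..T} \<Longrightarrow> transpose (F i t) = F i t"
  using riccati by (auto simp: solves_coupled_riccati_def symmetric_matrix_def)

lemma F_terminal: "F i T = c *\<^sub>R (L ** ee i ** L)"
  using riccati by (auto simp: solves_coupled_riccati_def)

lemma F_deriv:
  assumes "t \<in> {0..T}" shows "(F i has_vector_derivative Fdot i t) (at t within {0..T})"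
proof -
  obtain F' where F': "(F i has_vector_derivative F') (at t within {0..T})"
    "F' + (\<Sum>j\<in>UNIV. (- ((a + q) *\<^sub>R L) - F j t) ** ee j ** F i t)
        + (\<Sum>j\<in>UNIV. F i t ** ee j ** (- ((a + q) *\<^sub>R L) - F j t))
        + (\<epsilon> - q\<^sup>2) *\<^sub>R (L ** ee i ** L) + F i t ** ee i ** F i t = 0"
    using riccati assms unfolding solves_coupled_riccati_def by blast
  have "F' = Fdot i t"
    using F'(2) unfolding Fdot_def by (simp only: add_eq_0_iff2 minus_add_distrib) (simp add: algebra_simps)
  with F'(1) show ?thesis by simp
qed

lemma F_cont: "continuous_on {0..T} (F i)"
  by (rule continuous_on_vector_derivative[OF F_deriv])

lemma continuous_on_matrix_mult:
  fixes A :: "real \<Rightarrow> real^'n^'n"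
  assumes "continuous_on S A" "continuous_on S B"
  shows "continuous_on S (\<lambda>t. A t ** B t :: real^'n^'n)"
  by (rule bounded_bilinear.continuous_on[OF bounded_bilinear_matrix_matrix assms])

lemma closed_loop_cont: "continuous_on {0..T} closed_loop"
  unfolding closed_loop_def[abs_def] by (intro continuous_intros continuous_on_matrix_mult F_cont)

lemma open_loop_cont: "continuous_on {0..T} (open_loop i)"
  unfolding open_loop_def[abs_def] by (intro continuous_intros continuous_on_matrix_mult F_cont closed_loop_cont)

lemma Fdot_cont: "continuous_on {0..T} (Fdot i)"
  unfolding Fdot_def[abs_def] by (intro continuous_intros continuous_on_matrix_mult F_cont)

lemma closed_loop_vec: "(closed_loop t *v x) $ j = feedback j t x - a * (L *v x) $ j"
proof -
  have e: "closed_loop t *v x = - ((a + q) *\<^sub>R (L *v x)) - (\<chi> i. (F i t *v x) $ i)"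
    by (simp add: closed_loop_def matrix_vector_mult_diff_rdistrib row_vector
        bounded_bilinear.minus_left[OF bounded_bilinear_matrix_vector] scaleR_matrix_vector_assoc)
  show ?thesis unfolding e by (simp add: feedback_def algebra_simps)
qed

lemma open_loop_vec:
  "open_loop i t *v x = closed_loop t *v x + (q * (L *v x) $ i + (F i t *v x) $ i) *\<^sub>R axis i 1"
  by (simp add: open_loop_def matrix_vector_mult_add_rdistrib scaleR_matrix_vector_assoc[symmetric]
      matrix_vector_mul_assoc[symmetric] ee_mult_vec scaleR_add_left)

text \<open>
  Row \<open>j\<close> of \<open>- (a + q) L - F\<^sub>j\<close> is row \<open>j\<close> of the closed-loop matrix. This identifies the two sums over the players with \<open>closed_loop\<^sup>T F\<^sub>i\<close> and \<open>F\<^sub>i closed_loop\<close>.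
\<close>

lemma Fdot_form:
  assumes t: "t \<in> {0..T}"
  shows "x \<bullet> (Fdot i t *v d) = - ((closed_loop t *v x) \<bullet> (F i t *v d)) - x \<bullet> (F i t *v (closed_loop t *v d))
     - (\<epsilon> - q\<^sup>2) * ((L *v x) $ i * (L *v d) $ i) - (F i t *v x) $ i * (F i t *v d) $ i"
proof -
  define N where "N j = - ((a + q) *\<^sub>R L) - F j t" for j
  have N_sym: "transpose (N j) = N j" for j
    using F_sym[OF t, of j] L_sym unfolding N_def by (simp add: transpose_def vec_eq_iff)
  have N_row: "(N j *v y) $ j = (closed_loop t *v y) $ j" for j y
    by (simp add: closed_loop_vec feedback_def N_def matrix_vector_mult_diff_rdistrib
        bounded_bilinear.minus_left[OF bounded_bilinear_matrix_vector]
        scaleR_matrix_vector_assoc[symmetric] algebra_simps)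
  have e: "x \<bullet> ((A ** ee j ** B) *v d) = (A *v x) $ j * (B *v d) $ j" if "transpose A = A" for A B j
    using that by (simp add: matrix_vector_mul_assoc[symmetric] inner_symmetric_matrix[of A] inner_mult_ee)
  have s1: "x \<bullet> ((\<Sum>j\<in>UNIV. N j ** ee j ** F i t) *v d) = (closed_loop t *v x) \<bullet> (F i t *v d)"
  proof -
    have "x \<bullet> ((\<Sum>j\<in>UNIV. N j ** ee j ** F i t) *v d) = (\<Sum>j\<in>UNIV. x \<bullet> ((N j ** ee j ** F i t) *v d))"
      by (simp add: matrix_vector_mult_sum inner_sum_right)
    also have "\<dots> = (\<Sum>j\<in>UNIV. (closed_loop t *v x) $ j * (F i t *v d) $ j)"
      by (simp only: e[OF N_sym] N_row)
    finally show ?thesis by (simp add: inner_vec_def)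
  qed
  have s2: "x \<bullet> ((\<Sum>j\<in>UNIV. F i t ** ee j ** N j) *v d) = x \<bullet> (F i t *v (closed_loop t *v d))"
  proof -
    have "x \<bullet> ((\<Sum>j\<in>UNIV. F i t ** ee j ** N j) *v d) = (\<Sum>j\<in>UNIV. x \<bullet> ((F i t ** ee j ** N j) *v d))"
      by (simp add: matrix_vector_mult_sum inner_sum_right)
    also have "\<dots> = (\<Sum>j\<in>UNIV. (F i t *v x) $ j * (closed_loop t *v d) $ j)"
      by (simp only: e[OF F_sym[OF t]] N_row)
    finally show ?thesis by (simp add: inner_symmetric_matrix[OF F_sym[OF t]]) (simp add: inner_vec_def)
  qed
  have "x \<bullet> (Fdot i t *v d) = - (x \<bullet> ((\<Sum>j\<in>UNIV. N j ** ee j ** F i t) *v d))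
     - x \<bullet> ((\<Sum>j\<in>UNIV. F i t ** ee j ** N j) *v d)
     - (\<epsilon> - q\<^sup>2) * (x \<bullet> ((L ** ee i ** L) *v d)) - x \<bullet> ((F i t ** ee i ** F i t) *v d)"
    unfolding Fdot_def N_def[symmetric]
    by (simp add: matrix_vector_mult_diff_rdistrib inner_diff_right
        bounded_bilinear.minus_left[OF bounded_bilinear_matrix_vector] scaleR_matrix_vector_assoc[symmetric])
  then show ?thesis unfolding s1 s2 e[OF L_sym] e[OF F_sym[OF t]] .
qed

text \<open>
  The first variation of the running cost of player \<open>i\<close> at control \<open>\<alpha>\<close> and state \<open>x\<close> in the direction \<open>(\<delta>, d)\<close>.
\<close>

definition variation :: "'n \<Rightarrow> real \<Rightarrow> real \<Rightarrow> real^'n \<Rightarrow> real^'n \<Rightarrow> real" where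
  "variation i \<alpha> \<delta> x d = \<alpha> * \<delta> + q * \<alpha> * (L *v d) $ i + q * \<delta> * (L *v x) $ i + \<epsilon> * (L *v x) $ i * (L *v d) $ i"

text \<open>
  The velocity of the difference \<open>d\<close> between the deviated and the equilibrium state, when the control of player \<open>i\<close>
  changes by \<open>\<delta>\<close>, and the velocity of the adjoint quantity \<open>F\<^sub>i d\<close>.
\<close>

definition Ddot :: "'n \<Rightarrow> real \<Rightarrow> real \<Rightarrow> real^'n \<Rightarrow> real^'n" where
  "Ddot i t \<delta> d = closed_loop t *v d + (\<delta> + q * (L *v d) $ i + (F i t *v d) $ i) *\<^sub>R axis i 1"

definition gdot :: "'n \<Rightarrow> real \<Rightarrow> real \<Rightarrow> real^'n \<Rightarrow> real^'n" where
  "gdot i t \<delta> d = Fdot i t *v d + F i t *v Ddot i t \<delta> d"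

text \<open>
  This is where the Riccati equation is used: along the equilibrium, the drift of \<open>x \<bullet> F\<^sub>i d\<close> is the negative of
  the first variation of the running cost. Thus \<open>F\<^sub>i x\<close> is the adjoint process of the stochastic maximum
  principle.
\<close>

lemma adjoint_identity:
  assumes t: "t \<in> {0..T}"
  shows "gdot i t \<delta> d \<bullet> x + (F i t *v d) \<bullet> (closed_loop t *v x) = - variation i (feedback i t x) \<delta> x d"
proof -
  have ax: "x \<bullet> (F i t *v (r *\<^sub>R axis i 1)) = r * (F i t *v x) $ i" for r
    by (simp add: matrix_vector_mult_scaleR inner_symmetric_matrix[OF F_sym[OF t]] inner_axis)
  have "gdot i t \<delta> d \<bullet> x = x \<bullet> (Fdot i t *v d) + x \<bullet> (F i t *v (closed_loop t *v d))
     + (\<delta> + q * (L *v d) $ i + (F i t *v d) $ i) * (F i t *v x) $ i"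
    by (simp add: gdot_def Ddot_def inner_commute[of _ x] inner_add_right matrix_vector_right_distrib ax)
  then show ?thesis
    unfolding Fdot_form[OF t]
    by (simp add: variation_def feedback_def inner_commute[of "F i t *v d"] power2_eq_square algebra_simps)
qed

text \<open>
  The first variation of the total cost equals a term that has mean zero. The product rule is applied to
  \<open>(F\<^sub>i d) \<bullet> (x - \<sigma> v)\<close>, where both factors are absolutely continuous, and the missing term
  \<open>\<sigma> (F\<^sub>i d) \<bullet> v\<close> at time \<open>T\<close> is the integral of the derivative of \<open>F\<^sub>i d\<close> against the fixed vector \<open>\<sigma> v T\<close>.
\<close>

lemma pathwise_variation:
  fixes v x y :: "real \<Rightarrow> real^'n" and \<beta> :: "real \<Rightarrow> real"
  assumes x: "linear_path T \<sigma> closed_loop (\<lambda>_. 0) x0 v x"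
    and y: "linear_path T \<sigma> (open_loop i) (\<lambda>t. \<beta> t *\<^sub>R axis i 1) x0 v y"
  defines "d \<equiv> \<lambda>t. y t - x t" and "\<delta> \<equiv> \<lambda>t. \<beta> t - feedback i t (x t)"
  assumes int: "set_integrable lborel {0..T} (\<lambda>t. variation i (feedback i t (x t)) (\<delta> t) (x t) (d t))"
  shows "c * (L *v x T) $ i * (L *v d T) $ i + (LBINT t:{0..T}. variation i (feedback i t (x t)) (\<delta> t) (x t) (d t))
     = \<sigma> * (LBINT t:{0..T}. gdot i t (\<delta> t) (d t) \<bullet> (v T - v t))"
proof -
  note mv = bounded_bilinear_matrix_vector[where 'n = 'n and 'm = 'n]
  have TT: "T \<in> {0..T}" using T_pos by simp
  define z where "z t = x t - \<sigma> *\<^sub>R v t" for t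
  define zy where "zy t = y t - \<sigma> *\<^sub>R v t" for t
  define b where "b t = closed_loop t *v x t" for t
  define bY where "bY t = open_loop i t *v y t + \<beta> t *\<^sub>R axis i 1" for t
  have z: "primitive_on T z b" and z0: "z 0 = x0"
    using x by (auto simp: linear_path_def z_def[abs_def] b_def[abs_def])
  have zy: "primitive_on T zy bY" and zy0: "zy 0 = x0"
    using y by (auto simp: linear_path_def zy_def[abs_def] bY_def[abs_def])
  have "primitive_on T d (\<lambda>t. bY t - b t)"
  proof -
    have "set_integrable lborel {0..T} (\<lambda>t. bY t - b t)"
      by (rule set_integral_diff(1)) (use primitive_onD(1)[OF z TT] primitive_onD(1)[OF zy TT] in auto)
    moreover have "d t = d 0 + (LBINT s:{0..t}. bY s - b s)" if t: "t \<in> {0..T}" for t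
    proof -
      have "(LBINT s:{0..t}. bY s - b s) = (zy t - zy 0) - (z t - z 0)"
        using set_integral_diff(2)[OF primitive_onD(1)[OF zy t] primitive_onD(1)[OF z t]]
        by (simp add: primitive_onD(2)[OF zy t] primitive_onD(2)[OF z t])
      then show ?thesis by (simp add: d_def zy_def z_def)
    qed
    ultimately show ?thesis unfolding primitive_on_def by blast
  qed
  then have dp: "primitive_on T d (\<lambda>t. Ddot i t (\<delta> t) (d t))"
  proof (rule primitive_on_cong)
    fix t
    show "bY t - b t = Ddot i t (\<delta> t) (d t)"
    proof -
      have diff: "(A *v d t) = A *v y t - A *v x t" for A :: "real^'n^'n"
        by (simp add: d_def matrix_vector_mult_diff_distrib)
      have "\<delta> t + q * (L *v d t) $ i + (F i t *v d t) $ i = (q * (L *v y t) $ i + (F i t *v y t) $ i) + \<beta> t"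
        unfolding diff by (simp add: \<delta>_def feedback_def right_diff_distrib)
      then show ?thesis
        unfolding bY_def b_def Ddot_def open_loop_vec diff[of "closed_loop t"]
        by (simp only: scaleR_add_left) simp
    qed
  qed simp
  have d0: "d 0 = 0"
  proof -
    have "zy 0 - z 0 = d 0" by (simp add: zy_def z_def d_def)
    then show ?thesis using z0 zy0 by simp
  qed
  have "primitive_on T (F i) (Fdot i)" by (rule primitive_on_C1[OF F_deriv Fdot_cont])
  from primitive_on_product[OF mv this dp]
  have g: "primitive_on T (\<lambda>t. F i t *v d t) (\<lambda>t. gdot i t (\<delta> t) (d t))" by (simp add: gdot_def)
  define G where "G t = gdot i t (\<delta> t) (d t)" for t
  have g': "primitive_on T (\<lambda>t. F i t *v d t) G" using g by (simp add: G_def[abs_def])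
  have gi: "set_integrable lborel {0..T} G" and gT: "(LBINT t:{0..T}. G t) = F i T *v d T"
    using primitive_onD[OF g' TT] d0 by auto
  note gz = primitive_on_product[OF bounded_bilinear_inner g' z]
  have gzi: "set_integrable lborel {0..T} (\<lambda>t. G t \<bullet> z t + (F i t *v d t) \<bullet> b t)"
    and gzT: "(LBINT t:{0..T}. G t \<bullet> z t + (F i t *v d t) \<bullet> b t) = (F i T *v d T) \<bullet> z T"
    using primitive_onD[OF gz TT] d0 by auto
  have gvi: "set_integrable lborel {0..T} (\<lambda>t. G t \<bullet> (\<sigma> *\<^sub>R v T))"
    and gvT: "(LBINT t:{0..T}. G t \<bullet> (\<sigma> *\<^sub>R v T)) = (F i T *v d T) \<bullet> (\<sigma> *\<^sub>R v T)"
    using set_integrable_bilinear_const(1,2)[OF bounded_bilinear_inner gi] gT by auto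
  have pw: "\<sigma> * (G t \<bullet> (v T - v t)) = (G t \<bullet> z t + (F i t *v d t) \<bullet> b t) + G t \<bullet> (\<sigma> *\<^sub>R v T)
      + variation i (feedback i t (x t)) (\<delta> t) (x t) (d t)" if "t \<in> {0..T}" for t
  proof -
    have "G t \<bullet> x t + (F i t *v d t) \<bullet> b t = - variation i (feedback i t (x t)) (\<delta> t) (x t) (d t)"
      using adjoint_identity[OF that] by (simp add: G_def b_def)
    moreover have "x t = z t + \<sigma> *\<^sub>R v t" by (simp add: z_def)
    ultimately show ?thesis by (simp add: inner_add_right inner_diff_right algebra_simps)
  qed
  have "(LBINT t:{0..T}. \<sigma> * (G t \<bullet> (v T - v t))) = (LBINT t:{0..T}. ((G t \<bullet> z t + (F i t *v d t) \<bullet> b t) + G t \<bullet> (\<sigma> *\<^sub>R v T))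
      + variation i (feedback i t (x t)) (\<delta> t) (x t) (d t))"
    by (rule set_lebesgue_integral_cong) (use pw in auto)
  also have "\<dots> = ((F i T *v d T) \<bullet> z T + (F i T *v d T) \<bullet> (\<sigma> *\<^sub>R v T))
      + (LBINT t:{0..T}. variation i (feedback i t (x t)) (\<delta> t) (x t) (d t))"
    using set_integral_add(2)[OF set_integral_add(1)[OF gzi gvi] int] set_integral_add(2)[OF gzi gvi] gzT gvT by simp
  also have "(F i T *v d T) \<bullet> z T + (F i T *v d T) \<bullet> (\<sigma> *\<^sub>R v T) = x T \<bullet> (F i T *v d T)"
    by (simp add: z_def inner_diff_right inner_commute)
  also have "\<dots> = c * (L *v x T) $ i * (L *v d T) $ i"
    by (simp add: F_terminal scaleR_matrix_vector_assoc[symmetric] matrix_vector_mul_assoc[symmetric]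
        inner_symmetric_matrix[OF L_sym] inner_mult_ee)
  finally show ?thesis by (simp add: G_def)
qed

lemma T_nonneg: "0 \<le> T" using T_pos by simp

lemma equilibrium_state_iff:
  "state_process M W T a \<sigma> L x0 (feedback_controls feedback X) X \<longleftrightarrow>
    linear_state T \<sigma> closed_loop (\<lambda>_ _. 0) x0 X"
  by (rule state_process_iff_linear_state[OF T_nonneg])
     (simp add: feedback_controls_def closed_loop_vec)

lemma deviated_state_iff:
  "state_process M W T a \<sigma> L x0 ((feedback_controls feedback Y)(i := \<beta>)) Y \<longleftrightarrow>
    linear_state T \<sigma> (open_loop i) (\<lambda>t \<omega>. \<beta> t \<omega> *\<^sub>R axis i 1) x0 Y"
proof (rule state_process_iff_linear_state[OF T_nonneg])
  fix t \<omega> j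
  show "((feedback_controls feedback Y)(i := \<beta>)) j t \<omega> - a * (L *v Y t \<omega>) $ j =
      (open_loop i t *v Y t \<omega> + \<beta> t \<omega> *\<^sub>R axis i 1) $ j"
    by (cases "j = i") (simp_all add: feedback_controls_def open_loop_vec closed_loop_vec feedback_def axis_def)
qed

lemma feedback_matrix: "feedback i t x = ((- q *\<^sub>R L - F i t) *v x) $ i"
  by (simp add: feedback_def matrix_vector_mult_diff_rdistrib scaleR_matrix_vector_assoc[symmetric]
      bounded_bilinear.minus_left[OF bounded_bilinear_matrix_vector])

lemma feedback_matrix_cont: "continuous_on {0..T} (\<lambda>t. - q *\<^sub>R L - F i t)"
  by (intro continuous_intros F_cont)

lemma prog_feedback:
  assumes "prog T X"
  shows "prog T (\<lambda>t \<omega>. feedback i t (X t \<omega>))"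
  unfolding feedback_matrix by (intro prog_vec_nth prog_matrix_vector feedback_matrix_cont assms)

lemma sq_int_feedback:
  assumes "sq_int T X" shows "sq_int T (\<lambda>t \<omega>. feedback i t (X t \<omega>))"
  unfolding feedback_matrix by (intro sq_int_vec_nth sq_int_matrix_vector feedback_matrix_cont T_nonneg assms)

lemma sq_int_L: "sq_int T X \<Longrightarrow> sq_int T (\<lambda>t \<omega>. (L *v X t \<omega>) $ i)"
  by (intro sq_int_vec_nth sq_int_matrix_vector[where C = "\<lambda>_. L"] T_nonneg continuous_on_const)

lemma cost_integrable:
  assumes \<beta>: "sq_int T \<beta>" and X: "sq_int T X" "integrable M (\<lambda>\<omega>. (norm (X T \<omega>))\<^sup>2)"
    and XT: "X T \<in> borel_measurable M"
  shows "AE \<omega> in M. set_integrable lborel {0..T} (\<lambda>t. 1 / 2 * (\<beta> t \<omega>)\<^sup>2 + q * \<beta> t \<omega> * (L *v X t \<omega>) $ i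
                         + \<epsilon> / 2 * ((L *v X t \<omega>) $ i)\<^sup>2)"
    "integrable M (\<lambda>\<omega>. (LBINT t:{0..T}. 1 / 2 * (\<beta> t \<omega>)\<^sup>2 + q * \<beta> t \<omega> * (L *v X t \<omega>) $ i
                         + \<epsilon> / 2 * ((L *v X t \<omega>) $ i)\<^sup>2) + c / 2 * ((L *v X T \<omega>) $ i)\<^sup>2)"
proof -
  note LX = sq_int_L[OF X(1), of i]
  have r: "integrable (time_path T) (\<lambda>p. 1 / 2 * (\<beta> (fst p) (snd p))\<^sup>2 + q * \<beta> (fst p) (snd p) * (L *v X (fst p) (snd p)) $ i
                         + \<epsilon> / 2 * ((L *v X (fst p) (snd p)) $ i)\<^sup>2)"
    unfolding power2_eq_square mult.assoc
    by (intro Bochner_Integration.integrable_add integrable_mult_right sq_int_integrable_mult \<beta> LX)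
  show "AE \<omega> in M. set_integrable lborel {0..T} (\<lambda>t. 1 / 2 * (\<beta> t \<omega>)\<^sup>2 + q * \<beta> t \<omega> * (L *v X t \<omega>) $ i
                         + \<epsilon> / 2 * ((L *v X t \<omega>) $ i)\<^sup>2)"
    by (rule fubini_time_path(1)[OF r])
  have "integrable M (\<lambda>\<omega>. ((L *v X T \<omega>) $ i)\<^sup>2)"
  proof (rule Bochner_Integration.integrable_bound)
    show "integrable M (\<lambda>\<omega>. (matrix_2norm L)\<^sup>2 * (norm (X T \<omega>))\<^sup>2)" using X(2) by simp
    have "(\<lambda>\<omega>. (L *v X T \<omega>) $ i) \<in> borel_measurable M"
      by (rule borel_measurable_continuous_on[OF _ XT])
         (intro continuous_intros bounded_bilinear.continuous_on[OF bounded_bilinear_matrix_vector])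
    then show "(\<lambda>\<omega>. ((L *v X T \<omega>) $ i)\<^sup>2) \<in> borel_measurable M" by (rule borel_measurable_power)
    show "AE \<omega> in M. norm (((L *v X T \<omega>) $ i)\<^sup>2) \<le> norm ((matrix_2norm L)\<^sup>2 * (norm (X T \<omega>))\<^sup>2)"
    proof (rule AE_I2)
      fix \<omega>
      have "\<bar>(L *v X T \<omega>) $ i\<bar> \<le> norm (L *v X T \<omega>)" by (rule component_le_norm_cart)
      also have "\<dots> \<le> matrix_2norm L * norm (X T \<omega>)"
        by (rule op_bound_norm[OF op_bound_2norm matrix_2norm_nonneg])
      finally have "\<bar>(L *v X T \<omega>) $ i\<bar>\<^sup>2 \<le> (matrix_2norm L * norm (X T \<omega>))\<^sup>2" by (intro power_mono) auto
      then show "norm (((L *v X T \<omega>) $ i)\<^sup>2) \<le> norm ((matrix_2norm L)\<^sup>2 * (norm (X T \<omega>))\<^sup>2)"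
        by (simp add: power_mult_distrib)
    qed
  qed
  then show "integrable M (\<lambda>\<omega>. (LBINT t:{0..T}. 1 / 2 * (\<beta> t \<omega>)\<^sup>2 + q * \<beta> t \<omega> * (L *v X t \<omega>) $ i
                         + \<epsilon> / 2 * ((L *v X t \<omega>) $ i)\<^sup>2) + c / 2 * ((L *v X T \<omega>) $ i)\<^sup>2)"
    by (intro Bochner_Integration.integrable_add integrable_mult_right fubini_time_path(2)[OF r])
qed

text \<open>
  The remainder is the quadratic form \<open>\<delta>\<^sup>2 / 2 + q \<delta> d + \<epsilon> d\<^sup>2 / 2\<close>, which is nonnegative because
  \<open>q\<^sup>2 \<le> \<epsilon>\<close>.
\<close>

lemma running_cost_convex:
  "variation i \<alpha> (\<beta> - \<alpha>) x (y - x) \<le>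
    (1 / 2 * \<beta>\<^sup>2 + q * \<beta> * (L *v y) $ i + \<epsilon> / 2 * ((L *v y) $ i)\<^sup>2)
    - (1 / 2 * \<alpha>\<^sup>2 + q * \<alpha> * (L *v x) $ i + \<epsilon> / 2 * ((L *v x) $ i)\<^sup>2)"
proof -
  define \<delta> and u and d where "\<delta> = \<beta> - \<alpha>" and "u = (L *v x) $ i" and "d = (L *v (y - x)) $ i"
  have y: "(L *v y) $ i = u + d" and b: "\<beta> = \<alpha> + \<delta>"
    by (simp_all add: u_def d_def \<delta>_def matrix_vector_mult_diff_distrib)
  have "q\<^sup>2 * d\<^sup>2 \<le> \<epsilon> * d\<^sup>2" using q_le by (intro mult_right_mono) auto
  moreover have "0 \<le> (\<delta> + q * d)\<^sup>2" by simp
  ultimately have "0 \<le> 1 / 2 * \<delta>\<^sup>2 + q * \<delta> * d + \<epsilon> / 2 * d\<^sup>2"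
    by (simp add: power2_eq_square algebra_simps)
  then show ?thesis
    unfolding variation_def y \<delta>_def[symmetric] u_def[symmetric] d_def[symmetric]
    unfolding b by (simp add: power2_eq_square algebra_simps)
qed

text \<open>
  Convexity bounds the cost difference from below by the first variation, and the first variation has mean
  zero. Integrability of all terms makes the comparison of the expectations legitimate.
\<close>

lemma deviation_not_profitable:
  assumes \<beta>: "prog T \<beta>" "sq_int T \<beta>"
    and X: "linear_state T \<sigma> closed_loop (\<lambda>_ _. 0) x0 X"
    and Y: "linear_state T \<sigma> (open_loop i) (\<lambda>t \<omega>. \<beta> t \<omega> *\<^sub>R axis i 1) x0 Y"
  shows "cost M T q \<epsilon> c L i (\<lambda>t \<omega>. feedback i t (X t \<omega>)) X \<le> cost M T q \<epsilon> c L i \<beta> Y"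
proof -
  have "sq_int T (\<lambda>_ _. 0 :: real^'n)" by (rule sq_int_const_time) auto
  note XS = linear_state_sq_int[OF T_pos closed_loop_cont this X]
  note YS = linear_state_sq_int[OF T_pos open_loop_cont sq_int_scaleR_vector[OF \<beta>(2)] Y]
  have Xp: "prog T X" and Yp: "prog T Y"
    using X Y by (auto simp: linear_state_def)
  have TT: "T \<in> {0..T}" using T_pos by simp
  have XT: "X T \<in> borel_measurable M" and YT: "Y T \<in> borel_measurable M"
    using FF_measurable_M[OF prog_section[OF Xp TT]] FF_measurable_M[OF prog_section[OF Yp TT]] .
  define \<alpha> where "\<alpha> t \<omega> = feedback i t (X t \<omega>)" for t \<omega>
  define \<delta> where "\<delta> t \<omega> = \<beta> t \<omega> - \<alpha> t \<omega>" for t \<omega>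
  define D where "D t \<omega> = Y t \<omega> - X t \<omega>" for t \<omega>
  have \<alpha>p: "prog T \<alpha>" and \<alpha>s: "sq_int T \<alpha>"
    unfolding \<alpha>_def[abs_def] by (rule prog_feedback[OF Xp], rule sq_int_feedback[OF XS(1)])
  have \<delta>p: "prog T \<delta>" and \<delta>s: "sq_int T \<delta>"
    unfolding \<delta>_def[abs_def] by (rule prog_diff[OF \<beta>(1) \<alpha>p], rule sq_int_diff[OF \<beta>(2) \<alpha>s])
  have Dp: "prog T D" 
    using prog_add[OF Yp prog_scaleR[OF Xp, of "-1"]] by (simp add: D_def[abs_def])
  have Ds: "sq_int T D"
    unfolding D_def[abs_def] by (rule sq_int_diff[OF YS(1) XS(1)])
  define G where "G t \<omega> = gdot i t (\<delta> t \<omega>) (D t \<omega>)" for t \<omega>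
  have Lc: "continuous_on {0..T} (\<lambda>_. L)" by (rule continuous_on_const)
  have qr: "(q * r) = q *\<^sub>R r" for r :: real by simp
  have Gp: "prog T G"
    unfolding G_def[abs_def] gdot_def Ddot_def qr
    by (intro prog_add prog_matrix_vector prog_scaleR_vector prog_scaleR prog_vec_nth
        Fdot_cont F_cont closed_loop_cont Lc \<delta>p Dp)
  have Gs: "sq_int T G"
    unfolding G_def[abs_def] gdot_def Ddot_def qr
    by (intro sq_int_add sq_int_matrix_vector sq_int_scaleR_vector sq_int_mult_left sq_int_vec_nth
        Fdot_cont F_cont closed_loop_cont Lc T_nonneg \<delta>s Ds)
  note LX = sq_int_L[OF XS(1), of i] and LD = sq_int_L[OF Ds, of i]
  have var: "integrable (time_path T) (\<lambda>p. variation i (\<alpha> (fst p) (snd p)) (\<delta> (fst p) (snd p)) (X (fst p) (snd p)) (D (fst p) (snd p)))"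
    unfolding variation_def mult.assoc
    by (intro Bochner_Integration.integrable_add integrable_mult_right sq_int_integrable_mult \<alpha>s \<delta>s LX LD)
  define run_cost where "run_cost b x = 1 / 2 * b\<^sup>2 + q * b * (L *v x) $ i + \<epsilon> / 2 * ((L *v x) $ i)\<^sup>2" for b and x :: "real^'n"
  define A1 where "A1 \<omega> = (LBINT t:{0..T}. run_cost (\<beta> t \<omega>) (Y t \<omega>)) + c / 2 * ((L *v Y T \<omega>) $ i)\<^sup>2" for \<omega>
  define A0 where "A0 \<omega> = (LBINT t:{0..T}. run_cost (\<alpha> t \<omega>) (X t \<omega>)) + c / 2 * ((L *v X T \<omega>) $ i)\<^sup>2" for \<omega>
  define N where "N \<omega> = \<sigma> * (LBINT t:{0..T}. G t \<omega> \<bullet> (noise T \<omega> - noise t \<omega>))" for \<omega>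
  note c1 = cost_integrable[OF \<beta>(2) YS YT, of i, folded run_cost_def]
  note c0 = cost_integrable[OF \<alpha>s XS XT, of i, folded run_cost_def]
  have A1i: "integrable M A1" and A0i: "integrable M A0"
    using c1(2) c0(2) by (simp_all add: A1_def[abs_def] A0_def[abs_def])
  note mt = martingale_term_zero[OF T_nonneg Gp Gs]
  have Ni: "integrable M N"
    unfolding N_def by (intro integrable_mult_right fubini_time_path(2)[OF mt(1)])
  have NE: "(\<integral>\<omega>. N \<omega> \<partial>M) = 0" by (simp add: N_def mt(2))
  have xl: "AE \<omega> in M. linear_path T \<sigma> closed_loop (\<lambda>_. 0) x0 (\<lambda>t. noise t \<omega>) (\<lambda>t. X t \<omega>)"
    using X by (simp add: linear_state_def)
  have yl: "AE \<omega> in M. linear_path T \<sigma> (open_loop i) (\<lambda>t. \<beta> t \<omega> *\<^sub>R axis i 1) x0 (\<lambda>t. noise t \<omega>) (\<lambda>t. Y t \<omega>)"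
    using Y by (simp add: linear_state_def)
  have "AE \<omega> in M. N \<omega> \<le> A1 \<omega> - A0 \<omega>"
    using xl yl fubini_time_path(1)[OF var] c1(1) c0(1)
  proof eventually_elim
    case (elim \<omega>)
    define v where "v t = variation i (\<alpha> t \<omega>) (\<delta> t \<omega>) (X t \<omega>) (D t \<omega>)" for t
    have vi: "set_integrable lborel {0..T} v" using elim(3) by (simp add: v_def[abs_def])
    have id: "c * (L *v X T \<omega>) $ i * (L *v D T \<omega>) $ i + (LBINT t:{0..T}. v t) = N \<omega>"
      using pathwise_variation[OF elim(1) elim(2)] elim(3)
      by (simp add: N_def G_def v_def \<alpha>_def \<delta>_def D_def)
    have "(LBINT t:{0..T}. v t) \<le> (LBINT t:{0..T}. run_cost (\<beta> t \<omega>) (Y t \<omega>) - run_cost (\<alpha> t \<omega>) (X t \<omega>))"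
      by (rule set_integral_mono[OF vi set_integral_diff(1)[OF elim(4,5)]])
         (unfold v_def \<delta>_def D_def run_cost_def, rule running_cost_convex)
    also have "\<dots> = (LBINT t:{0..T}. run_cost (\<beta> t \<omega>) (Y t \<omega>)) - (LBINT t:{0..T}. run_cost (\<alpha> t \<omega>) (X t \<omega>))"
      by (rule set_integral_diff(2)[OF elim(4,5)])
    finally have run: "(LBINT t:{0..T}. v t) \<le> \<dots>" .
    have final: "c * (L *v X T \<omega>) $ i * (L *v D T \<omega>) $ i \<le> c / 2 * ((L *v Y T \<omega>) $ i)\<^sup>2 - c / 2 * ((L *v X T \<omega>) $ i)\<^sup>2"
    proof -
      define u d where "u = (L *v X T \<omega>) $ i" and "d = (L *v D T \<omega>) $ i"
      have "(L *v Y T \<omega>) $ i = u + d" by (simp add: u_def d_def D_def matrix_vector_mult_diff_distrib)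
      moreover have "0 \<le> c / 2 * d\<^sup>2" using c_nonneg by simp
      ultimately show ?thesis
        unfolding u_def[symmetric] d_def[symmetric] by (simp add: power2_eq_square algebra_simps)
    qed
    show ?case using run final id by (simp add: A1_def A0_def)
  qed
  then have "(\<integral>\<omega>. N \<omega> \<partial>M) \<le> (\<integral>\<omega>. A1 \<omega> - A0 \<omega> \<partial>M)"
    by (intro integral_mono_AE Ni Bochner_Integration.integrable_diff A1i A0i)
  then have "(\<integral>\<omega>. A0 \<omega> \<partial>M) \<le> (\<integral>\<omega>. A1 \<omega> \<partial>M)" using NE A1i A0i by simp
  then show ?thesis
    unfolding cost_def A1_def A0_def run_cost_def \<alpha>_def .
qed

lemma markovian_feedback: "markovian_feedback T (feedback i)"
  unfolding markovian_feedback_def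
proof (intro conjI)
  have e: "(\<lambda>(t, x). feedback i t x) = (\<lambda>p. ((- q *\<^sub>R L - F i (fst p)) *v snd p) $ i)"
    by (simp add: feedback_matrix case_prod_unfold)
  have "continuous_on ({0..T} \<times> UNIV) (\<lambda>p :: real \<times> (real^'n). F i (fst p))"
    by (rule continuous_on_compose2[OF F_cont]) (auto intro!: continuous_intros)
  then have "continuous_on ({0..T} \<times> UNIV) (\<lambda>p :: real \<times> (real^'n). ((- q *\<^sub>R L - F i (fst p)) *v snd p) $ i)"
    by (intro continuous_intros bounded_bilinear.continuous_on[OF bounded_bilinear_matrix_vector])
  then show "(\<lambda>(t, x). feedback i t x) \<in> borel_measurable (restrict_space borel ({0..T} \<times> UNIV))"
    unfolding e by (rule borel_measurable_continuous_on_restrict)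
  obtain K where K: "0 < K" "\<And>t x. t \<in> {0..T} \<Longrightarrow> norm ((- q *\<^sub>R L - F i t) *v x) \<le> K * norm x"
    by (rule continuous_bilinear_bound[OF bounded_bilinear_matrix_vector feedback_matrix_cont]) (rule that)
  show "bdd_above ((\<lambda>(t, x). \<bar>feedback i t x\<bar> / (1 + norm x)) ` ({0..T} \<times> UNIV))"
  proof (rule bdd_aboveI2[where M = K])
    fix p :: "real \<times> (real^'n)" assume "p \<in> {0..T} \<times> UNIV"
    then obtain t x where [simp]: "p = (t, x)" and t: "t \<in> {0..T}" by auto
    have "\<bar>feedback i t x\<bar> \<le> norm ((- q *\<^sub>R L - F i t) *v x)"
      unfolding feedback_matrix by (rule component_le_norm_cart)
    also have "\<dots> \<le> K * norm x" by (rule K(2)[OF t])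
    also have "\<dots> \<le> K * (1 + norm x)" using K(1) by (intro mult_left_mono) auto
    finally have "\<bar>feedback i t x\<bar> / (1 + norm x) \<le> K"
      by (simp add: divide_le_eq add_pos_nonneg)
    then show "(case p of (t, x) \<Rightarrow> \<bar>feedback i t x\<bar> / (1 + norm x)) \<le> K" by simp
  qed
qed

lemma nash_equilibrium: "markovian_nash_equilibrium M W T a q \<epsilon> c \<sigma> L x0 feedback"
  unfolding markovian_nash_equilibrium_def equilibrium_state_iff deviated_state_iff
proof (intro conjI allI ballI impI)
  have z: "sq_int T (\<lambda>_ _. 0 :: real^'n)" by (rule sq_int_const_time) auto
  show "markovian_feedback T (feedback i)" for i by (rule markovian_feedback)
  show "\<exists>X. linear_state T \<sigma> closed_loop (\<lambda>_ _. 0) x0 X"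
    by (rule linear_state_exists[OF T_nonneg closed_loop_cont prog_deterministic z]) (rule continuous_on_const)
  show "feedback_controls feedback X i \<in> admissible_controls M W T"
    if X: "linear_state T \<sigma> closed_loop (\<lambda>_ _. 0) x0 X" for X i
  proof -
    have "prog T X" using X by (simp add: linear_state_def)
    moreover have "sq_int T X" by (rule linear_state_sq_int[OF T_pos closed_loop_cont z X])
    ultimately show ?thesis
      unfolding admissible_iff[OF T_nonneg] feedback_controls_def[abs_def]
      by (intro conjI prog_feedback sq_int_feedback)
  qed
  fix i \<beta> assume "\<beta> \<in> admissible_controls M W T"
  then have \<beta>: "prog T \<beta>" "sq_int T \<beta>"
    by (auto simp: admissible_iff[OF T_nonneg])
  show "\<exists>Y. linear_state T \<sigma> (open_loop i) (\<lambda>t \<omega>. \<beta> t \<omega> *\<^sub>R axis i 1) x0 Y"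
    by (rule linear_state_exists[OF T_nonneg open_loop_cont prog_scaleR_vector[OF \<beta>(1)] sq_int_scaleR_vector[OF \<beta>(2)]])
  fix X Y assume "linear_state T \<sigma> closed_loop (\<lambda>_ _. 0) x0 X"
    and "linear_state T \<sigma> (open_loop i) (\<lambda>t \<omega>. \<beta> t \<omega> *\<^sub>R axis i 1) x0 Y"
  from deviation_not_profitable[OF \<beta> this]
  show "cost M T q \<epsilon> c L i (feedback_controls feedback X i) X \<le> cost M T q \<epsilon> c L i \<beta> Y"
    by (simp add: feedback_controls_def[abs_def])
qed

end

section \<open>Convergence of fictitious play to the Nash equilibrium\<close>

lemma normalized_laplacian_symmetric:
  assumes "symp E" shows "transpose (normalized_laplacian E) = normalized_laplacian E"
  using sympD[OF assms] by (auto simp: vec_eq_iff transpose_def normalized_laplacian_def mult.commute)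

theorem corollary3p8:
  fixes E :: "'n::finite \<Rightarrow> 'n \<Rightarrow> bool"
    and L :: "real^'n^'n"
    and T a q \<epsilon> c \<sigma> :: real
    and x0 :: "real^'n"
    and M :: "'w measure"
    and W :: "'n \<Rightarrow> real \<Rightarrow> 'w \<Rightarrow> real"
  assumes "connected_simple_graph E"
    and "L = normalized_laplacian E"
    and "T > 0" and "a \<ge> 0" and "q \<ge> 0" and "\<epsilon> \<ge> 0" and "c > 0" and "\<sigma> > 0"
    and "q\<^sup>2 \<le> \<epsilon>"
    and "independent_brownian_motions M W"
    and "C_L T a q \<epsilon> c L \<le> 1"
  shows "(\<exists>F. fictitious_play_from_zero T a q \<epsilon> c L F) \<and>
    (\<forall>F. fictitious_play_from_zero T a q \<epsilon> c L F \<longrightarrow>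
      (\<exists>Finf :: 'n \<Rightarrow> real \<Rightarrow> real^'n^'n. \<exists>\<phi>hat :: 'n \<Rightarrow> real \<Rightarrow> real^'n \<Rightarrow> real.
        (\<forall>i. \<forall>t\<in>{0..T}. (\<lambda>k. F k i t) \<longlonglongrightarrow> Finf i t) \<and>
        solves_coupled_riccati T a q \<epsilon> c L Finf \<and>
        (\<forall>G. solves_coupled_riccati T a q \<epsilon> c L G \<longrightarrow> (\<forall>i. \<forall>t\<in>{0..T}. G i t = Finf i t)) \<and>
        (\<forall>i t x. \<phi>hat i t x = - q * (L *v x) $ i - (Finf i t *v x) $ i) \<and>
        (\<forall>i. \<forall>t\<in>{0..T}. \<forall>x. (\<lambda>k. linear_feedback q L (F k) i t x) \<longlonglongrightarrow> \<phi>hat i t x) \<and>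
        markovian_nash_equilibrium M W T a q \<epsilon> c \<sigma> L x0 \<phi>hat))"
proof -
  have sym: "transpose L = L"
    using assms(1,2) normalized_laplacian_symmetric unfolding connected_simple_graph_def by blast
  interpret graph_riccati L T a q \<epsilon> c
    by unfold_locales (use assms sym in auto)
  obtain Finf where Finf: "solves_coupled_riccati T a q \<epsilon> c L Finf"
    "\<And>G i t. solves_coupled_riccati T a q \<epsilon> c L G \<Longrightarrow> t \<in> {0..T} \<Longrightarrow> G i t = Finf i t"
    "\<And>F i t. fictitious_play_from_zero T a q \<epsilon> c L F \<Longrightarrow> t \<in> {0..T} \<Longrightarrow> (\<lambda>k. F k i t) \<longlonglongrightarrow> Finf i t"
    by (rule fictitious_play_converges) (rule that)
  interpret prob_space M
    using assms(10) by (simp add: independent_brownian_motions_def)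
  interpret G: lq_game M W L Finf T a q \<epsilon> c \<sigma> x0
    by unfold_locales (use assms(3,7,9,10) sym Finf(1) in simp_all)
  have conv: "(\<lambda>k. linear_feedback q L (F k) i t x) \<longlonglongrightarrow> G.feedback i t x"
    if F: "fictitious_play_from_zero T a q \<epsilon> c L F" and t: "t \<in> {0..T}" for F i t x
  proof -
    have "(\<lambda>k. - (((F k i t + q *\<^sub>R L) *v x) $ i)) \<longlonglongrightarrow> - (((Finf i t + q *\<^sub>R L) *v x) $ i)"
      by (intro tendsto_intros bounded_bilinear.tendsto[OF bounded_bilinear_matrix_vector] Finf(3)[OF F t])
    moreover have "G.feedback i t x = - (((Finf i t + q *\<^sub>R L) *v x) $ i)"
      by (simp add: G.feedback_def matrix_vector_mult_add_rdistrib scaleR_matrix_vector_assoc[symmetric])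
    ultimately show ?thesis by (simp only: linear_feedback_def)
  qed
  show ?thesis
  proof (intro conjI allI impI)
    show "\<exists>F. fictitious_play_from_zero T a q \<epsilon> c L F" by (rule fictitious_play_exists)
    fix F assume F: "fictitious_play_from_zero T a q \<epsilon> c L F"
    show "\<exists>Finf :: 'n \<Rightarrow> real \<Rightarrow> real^'n^'n. \<exists>\<phi>hat :: 'n \<Rightarrow> real \<Rightarrow> real^'n \<Rightarrow> real.
        (\<forall>i. \<forall>t\<in>{0..T}. (\<lambda>k. F k i t) \<longlonglongrightarrow> Finf i t) \<and>
        solves_coupled_riccati T a q \<epsilon> c L Finf \<and>
        (\<forall>G. solves_coupled_riccati T a q \<epsilon> c L G \<longrightarrow> (\<forall>i. \<forall>t\<in>{0..T}. G i t = Finf i t)) \<and>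
        (\<forall>i t x. \<phi>hat i t x = - q * (L *v x) $ i - (Finf i t *v x) $ i) \<and>
        (\<forall>i. \<forall>t\<in>{0..T}. \<forall>x. (\<lambda>k. linear_feedback q L (F k) i t x) \<longlonglongrightarrow> \<phi>hat i t x) \<and>
        markovian_nash_equilibrium M W T a q \<epsilon> c \<sigma> L x0 \<phi>hat"
    proof (intro exI[of _ Finf] exI[of _ G.feedback] conjI allI ballI impI)
      show "(\<lambda>k. F k i t) \<longlonglongrightarrow> Finf i t" if "t \<in> {0..T}" for i t by (rule Finf(3)[OF F that])
      show "solves_coupled_riccati T a q \<epsilon> c L Finf" by (rule Finf(1))
      show "G i t = Finf i t" if "solves_coupled_riccati T a q \<epsilon> c L G" "t \<in> {0..T}" for G i t
        by (rule Finf(2)[OF that])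
      show "G.feedback i t x = - q * (L *v x) $ i - (Finf i t *v x) $ i" for i t x
        by (rule G.feedback_def)
      show "(\<lambda>k. linear_feedback q L (F k) i t x) \<longlonglongrightarrow> G.feedback i t x" if "t \<in> {0..T}" for i t x
        by (rule conv[OF F that])
      show "markovian_nash_equilibrium M W T a q \<epsilon> c \<sigma> L x0 G.feedback" by (rule G.nash_equilibrium)
    qed
  qed
qed

end
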